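(* Let $H\in(1/2,1)$. For $n\ge 1$ let $B^{(n)}=\{B^{(n)}(t)\}_{t\ge 0}$ be the renormalized $n\times n$ symmetric matrix fractional Brownian motion of Hurst parameter $H$, and let $\mu^{(n)}_t=\frac1n\sum_{j=1}^n\delta_{\lambda^{(n)}_j(t)}$, $t\ge 0$, be the empirical measure-valued process of its eigenvalues. Then the family of measure-valued processes $\{(\mu^{(n)}_t)_{t\ge 0}:n\ge 1\}$ converges weakly (i.e. in law), as $n\to\infty$, in $C(\mathbb{R}_+,\mathrm{Pr}(\mathbb{R}))$ to the family $(\mu_t)_{t\ge 0}$ that corresponds to the law of a non-commutative fractional Brownian motion $S^H=\{S^H_t\}_{t\ge0}$ of Hurst parameter $H$, with covariance $$\varphi(S^H_tS^H_s)=\tfrac12\left(t^{2H}+s^{2H}-|t-s|^{2H}\right).$$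
   Context: Matrix fractional Brownian motion: for each $n$ let $b=\{\{b_{ij}(t)\}_{t\ge0}:1\le i\le j\le n\}$ be independent real fractional Brownian motions with Hurst parameter $H\in(1/2,1)$ starting from $0$ (centered Gaussian, continuous paths, covariance $\frac12(t^{2H}+s^{2H}-|t-s|^{2H})$). Define the symmetric $n\times n$ matrix $B(t)$ by $B_{ij}(t)=B_{ji}(t)=b_{ij}(t)$ for $i<j$ and $B_{ii}(t)=\sqrt2\,b_{ii}(t)$, and put $B^{(n)}(t)=\frac1{\sqrt n}B(t)$. The eigenvalues of $B^{(n)}(t)$ are denoted $\lambda^{(n)}_1(t)\le\dots\le\lambda^{(n)}_n(t)$; $\delta_x$ is the unit mass at $x$. Function space: $\mathrm{Pr}(\mathbb{R})$ is the space of probability measures on $\mathbb{R}$ with the topology of weak convergence; $C(\mathbb{R}_+,\mathrm{Pr}(\mathbb{R}))$ is the space of continuous functions from $\mathbb{R}_+=[0,\infty)$ to $\mathrm{Pr}(\mathbb{R})$ with the topology of uniform convergence on compact intervals. Non-commutative fractional Brownian motion: in a non-commutative probability space $(\mathcal{A},\varphi)$, a centered semicircular process is a family $\{S_t\}_{t\ge0}$ of self-adjoint elements of $\mathcal{A}$ such that every real linear combination $\lambda_1S_{t_1}+\dots+\lambda_mS_{t_m}$ has a centered semicircular distribution (the semicircle law of variance $\sigma^2>0$ being $\frac{1}{2\pi\sigma^2}\sqrt{4\sigma^2-x^2}\,1_{[-2\sigma,2\sigma]}(x)\,dx$, and $\delta_0$ if $\sigma=0$). A non-commutative fractional Brownian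 motion of Hurst parameter $H\in(0,1)$ is a centered semicircular process $S^H$ with $\varphi(S^H_tS^H_s)=\frac12(t^{2H}+s^{2H}-|t-s|^{2H})$ for all $s,t\ge0$. Its law, as a family of probability measures on $\mathbb{R}$, is $(\mu_t)_{t\ge0}$ where $\mu_t$ is the (spectral) distribution of $S^H_t$ with respect to $\varphi$. *)

theory Defs
  imports
    "HOL-Probability.Probability"
    "Jordan_Normal_Form.Char_Poly"
begin

section \<open>Fractional Brownian motion\<close>

definition fbm_cov :: "real \<Rightarrow> real \<Rightarrow> real \<Rightarrow> real" where
  "fbm_cov H s t = (t powr (2 * H) + s powr (2 * H) - \<bar>t - s\<bar> powr (2 * H)) / 2"

definition centered_normal :: "real \<Rightarrow> real measure" where
  "centered_normal \<sigma> =
     (if \<sigma> = 0 then return borel 0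
      else density lborel (\<lambda>x. ennreal (normal_density 0 \<sigma> x)))"

definition centered_gaussian :: "'w measure \<Rightarrow> ('w \<Rightarrow> real) \<Rightarrow> bool" where
  "centered_gaussian M X \<longleftrightarrow>
     X \<in> borel_measurable M \<and> (\<exists>\<sigma>\<ge>0. distr M borel X = centered_normal \<sigma>)"

definition centered_gaussian_process :: "'w measure \<Rightarrow> (real \<Rightarrow> 'w \<Rightarrow> real) \<Rightarrow> bool" where
  "centered_gaussian_process M X \<longleftrightarrow>
     (\<forall>(m::nat) (c :: nat \<Rightarrow> real) (t :: nat \<Rightarrow> real). (\<forall>i<m. 0 \<le> t i) \<longrightarrow>
        centered_gaussian M (\<lambda>\<omega>. \<Sum>i<m. c i * X (t i) \<omega>))"

definition fractional_BM :: "'w measure \<Rightarrow> real \<Rightarrow> (real \<Rightarrow> 'w \<Rightarrow> real) \<Rightarrow> bool" where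
  "fractional_BM M H X \<longleftrightarrow>
     0 < H \<and> H < 1 \<and>
     centered_gaussian_process M X \<and>
     (\<forall>s\<ge>0. \<forall>t\<ge>0. (\<integral>\<omega>. X s \<omega> * X t \<omega> \<partial>M) = fbm_cov H s t) \<and>
     (AE \<omega> in M. X 0 \<omega> = 0) \<and>
     (\<forall>\<omega>\<in>space M. continuous_on {0..} (\<lambda>t. X t \<omega>))"

text \<open>Matrix and eigenvalue indices run from \<open>0\<close> to \<open>n - 1\<close>. Independence is that of the
  processes, viewed as random elements of the product space of all functions on \<open>{0..}\<close>.\<close>

definition indep_fractional_BMs ::
  "'w measure \<Rightarrow> real \<Rightarrow> nat \<Rightarrow> (nat \<Rightarrow> nat \<Rightarrow> real \<Rightarrow> 'w \<Rightarrow> real) \<Rightarrow> bool" where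
  "indep_fractional_BMs M H n b \<longleftrightarrow>
     (\<forall>i j. i \<le> j \<and> j < n \<longrightarrow> fractional_BM M H (b i j)) \<and>
     prob_space.indep_vars M (\<lambda>_. \<Pi>\<^sub>M t\<in>{0..}. borel)
       (\<lambda>(i, j) \<omega>. \<lambda>t\<in>{0..}. b i j t \<omega>) {(i, j). i \<le> j \<and> j < n}"

definition matrix_fBM ::
  "nat \<Rightarrow> (nat \<Rightarrow> nat \<Rightarrow> real \<Rightarrow> 'w \<Rightarrow> real) \<Rightarrow> real \<Rightarrow> 'w \<Rightarrow> real mat" where
  "matrix_fBM n b t \<omega> =
     mat n n (\<lambda>(i, j). if i = j then sqrt 2 * b i i t \<omega> else b (min i j) (max i j) t \<omega>)"

definition renormalized_matrix_fBM ::
  "nat \<Rightarrow> (nat \<Rightarrow> nat \<Rightarrow> real \<Rightarrow> 'w \<Rightarrow> real) \<Rightarrow> real \<Rightarrow> 'w \<Rightarrow> real mat" where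
  "renormalized_matrix_fBM n b t \<omega> = (1 / sqrt (real n)) \<cdot>\<^sub>m matrix_fBM n b t \<omega>"


section \<open>Empirical spectral measure\<close>

text \<open>The real eigenvalues in increasing order, repeated according to their multiplicity as
  roots of the characteristic polynomial; a real symmetric \<open>n \<times> n\<close> matrix has exactly \<open>n\<close>.\<close>

definition ordered_eigenvalue :: "real mat \<Rightarrow> nat \<Rightarrow> real" where
  "ordered_eigenvalue A j = sorted_list_of_multiset (proots (char_poly A)) ! j"

definition empirical_measure :: "nat \<Rightarrow> (nat \<Rightarrow> real) \<Rightarrow> real measure" where
  "empirical_measure n x =
     measure_of UNIV (sets borel)
       (\<lambda>A. ennreal (1 / real n) * (\<Sum>j<n. emeasure (return borel (x j)) A))"

lemma sets_empirical_measure [simp, measurable_cong]: "sets (empirical_measure n x) = sets borel"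
  by (simp add: empirical_measure_def sets.sigma_sets_eq[of borel, simplified])

lemma space_empirical_measure [simp]: "space (empirical_measure n x) = UNIV"
  by (simp add: empirical_measure_def)

lemma emeasure_empirical_measure:
  assumes "A \<in> sets borel"
  shows "emeasure (empirical_measure n x) A
    = ennreal (1 / real n) * (\<Sum>j<n. emeasure (return borel (x j)) A)"
proof -
  have "countably_additive (sets borel)
      (\<lambda>A. ennreal (1 / real n) * (\<Sum>j<n. emeasure (return borel (x j)) A))"
  proof (rule countably_additiveI)
    fix B :: "nat \<Rightarrow> real set"
    assume B: "range B \<subseteq> sets borel" "disjoint_family B" "(\<Union>i. B i) \<in> sets borel"
    have "(\<Sum>i. ennreal (1 / real n) * (\<Sum>j<n. emeasure (return borel (x j)) (B i)))
        = ennreal (1 / real n) * (\<Sum>j<n. \<Sum>i. emeasure (return borel (x j)) (B i))"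
      by (simp add: suminf_sum)
    also have "\<dots> = ennreal (1 / real n) * (\<Sum>j<n. emeasure (return borel (x j)) (\<Union>i. B i))"
      by (intro arg_cong2[where f = "(*)"] sum.cong refl suminf_emeasure) (use B in auto)
    finally show "(\<Sum>i. ennreal (1 / real n) * (\<Sum>j<n. emeasure (return borel (x j)) (B i)))
        = ennreal (1 / real n) * (\<Sum>j<n. emeasure (return borel (x j)) (\<Union>i. B i))" .
  qed
  then show ?thesis
    using assms
    by (intro emeasure_measure_of[OF empirical_measure_def])
       (auto simp: positive_def empirical_measure_def sets.sigma_sets_eq[of borel, simplified])
qed

lemma real_distribution_empirical_measure:
  assumes "n \<ge> 1"
  shows "real_distribution (empirical_measure n x)"
proof -
  have "emeasure (empirical_measure n x) UNIV = 1"
    using assms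
    by (simp add: emeasure_empirical_measure ennreal_of_nat_eq_real_of_nat
        flip: ennreal_mult'' ennreal_1)
  then show ?thesis
    by (intro real_distribution.intro real_distribution_axioms.intro prob_spaceI) simp_all
qed

definition spectral_empirical_process ::
  "nat \<Rightarrow> (nat \<Rightarrow> nat \<Rightarrow> real \<Rightarrow> 'w \<Rightarrow> real) \<Rightarrow> 'w \<Rightarrow> real \<Rightarrow> real measure" where
  "spectral_empirical_process n b \<omega> =
     (\<lambda>t\<in>{0..}. empirical_measure n (ordered_eigenvalue (renormalized_matrix_fBM n b t \<omega>)))"


section \<open>Continuous paths of probability measures\<close>

definition bounded_continuous :: "(real \<Rightarrow> real) set" where
  "bounded_continuous = {f. continuous_on UNIV f \<and> bounded (range f)}"

text \<open>The topology of weak convergence: the coarsest one for which \<open>\<mu> \<mapsto> \<integral>f d\<mu>\<close> is continuous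
  for all bounded continuous \<open>f\<close>.\<close>

definition Pr_topology :: "real measure topology" where
  "Pr_topology = topology_generated_by
     {{\<mu>. real_distribution \<mu> \<and> (\<integral>x. f x \<partial>\<mu>) \<in> U} | f U. f \<in> bounded_continuous \<and> open U}"

lemma topspace_Pr_topology: "topspace Pr_topology = {\<mu>. real_distribution \<mu>}"
proof -
  have "(\<lambda>_. 0) \<in> bounded_continuous"
    by (simp add: bounded_continuous_def)
  then show ?thesis
    unfolding Pr_topology_def topology_generated_by_topspace by blast
qed

text \<open>Paths are indexed by \<open>{0..}\<close> and take the fixed dummy value elsewhere.\<close>

definition C_Pr :: "(real \<Rightarrow> real measure) set" where
  "C_Pr = {m \<in> extensional {0..}. continuous_map (top_of_set {0..}) Pr_topology m}"

text \<open>Uniform convergence on compact intervals is taken with respect to the uniformity on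
  probability measures given by the pseudometrics \<open>\<bar>\<integral>f d\<mu> - \<integral>f d\<nu>\<bar>\<close>, \<open>f\<close> bounded continuous, which
  induces the weak topology. Any other uniformity inducing the weak topology, such as that of
  the Levy-Prokhorov metric, yields the same topology on continuous paths, namely the
  compact-open one.\<close>

definition C_Pr_nbhd ::
  "(real \<Rightarrow> real measure) \<Rightarrow> real \<Rightarrow> (real \<Rightarrow> real) set \<Rightarrow> real \<Rightarrow> (real \<Rightarrow> real measure) set" where
  "C_Pr_nbhd m T F \<epsilon> =
     {m' \<in> C_Pr. \<forall>t\<in>{0..T}. \<forall>f\<in>F. \<bar>(\<integral>x. f x \<partial>m' t) - (\<integral>x. f x \<partial>m t)\<bar> < \<epsilon>}"

definition C_Pr_topology :: "(real \<Rightarrow> real measure) topology" where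
  "C_Pr_topology = topology (\<lambda>U. U \<subseteq> C_Pr \<and>
     (\<forall>m\<in>U. \<exists>T\<ge>0. \<exists>F \<epsilon>. finite F \<and> F \<subseteq> bounded_continuous \<and> 0 < \<epsilon> \<and> C_Pr_nbhd m T F \<epsilon> \<subseteq> U))"

lemma openin_C_Pr_topology:
  "openin C_Pr_topology U \<longleftrightarrow> U \<subseteq> C_Pr \<and>
     (\<forall>m\<in>U. \<exists>T\<ge>0. \<exists>F \<epsilon>. finite F \<and> F \<subseteq> bounded_continuous \<and> 0 < \<epsilon> \<and> C_Pr_nbhd m T F \<epsilon> \<subseteq> U)"
proof -
  define N where "N m U \<longleftrightarrow> (\<exists>T\<ge>0. \<exists>F \<epsilon>. finite F \<and> F \<subseteq> bounded_continuous \<and> 0 < \<epsilon> \<and>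
    C_Pr_nbhd m T F \<epsilon> \<subseteq> U)" for m U
  have mono: "N m V" if "N m U" "U \<subseteq> V" for m U V
    using that unfolding N_def by (meson subset_trans)
  have inter: "N m (U \<inter> V)" if U: "N m U" and V: "N m V" for m U V
  proof -
    obtain T F \<epsilon> where 1: "T \<ge> 0" "finite F" "F \<subseteq> bounded_continuous" "0 < \<epsilon>"
        "C_Pr_nbhd m T F \<epsilon> \<subseteq> U"
      using U unfolding N_def by blast
    obtain T' F' \<epsilon>' where 2: "T' \<ge> 0" "finite F'" "F' \<subseteq> bounded_continuous" "0 < \<epsilon>'"
        "C_Pr_nbhd m T' F' \<epsilon>' \<subseteq> V"
      using V unfolding N_def by blast
    have "C_Pr_nbhd m (max T T') (F \<union> F') (min \<epsilon> \<epsilon>')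
        \<subseteq> C_Pr_nbhd m T F \<epsilon> \<inter> C_Pr_nbhd m T' F' \<epsilon>'"
      by (auto simp: C_Pr_nbhd_def)
    then have "C_Pr_nbhd m (max T T') (F \<union> F') (min \<epsilon> \<epsilon>') \<subseteq> U \<inter> V"
      using 1(5) 2(5) by blast
    moreover have "max T T' \<ge> 0" "finite (F \<union> F')" "F \<union> F' \<subseteq> bounded_continuous" "0 < min \<epsilon> \<epsilon>'"
      using 1 2 by auto
    ultimately show ?thesis
      unfolding N_def by blast
  qed
  have "istopology (\<lambda>U. U \<subseteq> C_Pr \<and> (\<forall>m\<in>U. N m U))"
    unfolding istopology_def
  proof (intro conjI allI impI)
    fix U V
    assume "U \<subseteq> C_Pr \<and> (\<forall>m\<in>U. N m U)" "V \<subseteq> C_Pr \<and> (\<forall>m\<in>V. N m V)"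
    then show "U \<inter> V \<subseteq> C_Pr" "\<forall>m\<in>U \<inter> V. N m (U \<inter> V)"
      using inter by auto
  next
    fix \<K>
    assume K: "\<forall>K\<in>\<K>. K \<subseteq> C_Pr \<and> (\<forall>m\<in>K. N m K)"
    then show "\<Union>\<K> \<subseteq> C_Pr" by blast
    show "\<forall>m\<in>\<Union>\<K>. N m (\<Union>\<K>)"
      using K mono by (metis Union_iff Union_upper)
  qed
  then show ?thesis
    unfolding C_Pr_topology_def N_def by (simp add: topology_inverse')
qed

lemma topspace_C_Pr_topology: "topspace C_Pr_topology = C_Pr"
proof -
  have "C_Pr_nbhd m 0 {} 1 \<subseteq> C_Pr" for m
    by (auto simp: C_Pr_nbhd_def)
  then have "openin C_Pr_topology C_Pr"
    unfolding openin_C_Pr_topology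
    by (intro conjI ballI subset_refl exI[of _ "0::real"] exI[of _ "{}"] exI[of _ "1::real"]) simp_all
  then show ?thesis
    using openin_C_Pr_topology by (metis openin_subset openin_topspace subset_antisym)
qed


section \<open>Convergence in law\<close>

definition borel_of :: "'a topology \<Rightarrow> 'a measure" where
  "borel_of T = sigma (topspace T) {U. openin T U}"

text \<open>The random elements \<open>X n\<close>, \<open>n \<ge> 1\<close>, may live on different probability spaces \<open>M n\<close>;
  \<open>L\<close> is the limit law.\<close>

definition converges_in_law ::
  "'a topology \<Rightarrow> (nat \<Rightarrow> 'w measure) \<Rightarrow> (nat \<Rightarrow> 'w \<Rightarrow> 'a) \<Rightarrow> 'a measure \<Rightarrow> bool" where
  "converges_in_law T M X L \<longleftrightarrow>
     (\<forall>n\<ge>1. X n \<in> M n \<rightarrow>\<^sub>M borel_of T) \<and>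
     prob_space L \<and> sets L = sets (borel_of T) \<and>
     (\<forall>\<Phi> :: 'a \<Rightarrow> real.
        continuous_map T euclideanreal \<Phi> \<and> bounded (\<Phi> ` topspace T) \<longrightarrow>
        (\<lambda>n. \<integral>\<omega>. \<Phi> (X n \<omega>) \<partial>M n) \<longlonglongrightarrow> (\<integral>x. \<Phi> x \<partial>L))"


section \<open>Non-commutative fractional Brownian motion\<close>

text \<open>A unital complex *-algebra with a unital positive linear functional. No norm, faithfulness
  or trace property is required, so that C*- and W*-probability spaces are instances.\<close>

locale nc_probability_space = vector_space cscale
  for cscale :: "complex \<Rightarrow> 'a :: ring_1 \<Rightarrow> 'a" +
  fixes star :: "'a \<Rightarrow> 'a" and \<phi> :: "'a \<Rightarrow> complex"
  assumes scale_mult_left: "cscale c x * y = cscale c (x * y)"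
    and scale_mult_right: "x * cscale c y = cscale c (x * y)"
    and star_star: "star (star x) = x"
    and star_add: "star (x + y) = star x + star y"
    and star_scale: "star (cscale c x) = cscale (cnj c) (star x)"
    and star_mult: "star (x * y) = star y * star x"
    and linear_phi: "Vector_Spaces.linear cscale (*) \<phi>"
    and phi_one: "\<phi> 1 = 1"
    and phi_positive: "\<phi> (star x * x) \<in> \<real>\<^sub>\<ge>\<^sub>0"

text \<open>The distribution of a self-adjoint element: the compactly supported probability measure on
  the line (unique, if it exists) with the moments of the element. For a self-adjoint element of
  a C*-algebra this is the measure given by the spectral theorem.\<close>

definition spectral_distribution ::
  "('a :: ring_1 \<Rightarrow> complex) \<Rightarrow> 'a \<Rightarrow> real measure \<Rightarrow> bool" where
  "spectral_distribution \<phi> a \<mu> \<longleftrightarrow>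
     real_distribution \<mu> \<and>
     (\<exists>K. measure \<mu> {-K..K} = 1) \<and>
     (\<forall>k. \<phi> (a ^ k) = complex_of_real (\<integral>x. x ^ k \<partial>\<mu>))"

text \<open>The centered semicircle law of variance \<open>\<sigma>\<^sup>2\<close>.\<close>

definition semicircle :: "real \<Rightarrow> real measure" where
  "semicircle \<sigma> =
     (if \<sigma> = 0 then return borel 0
      else density lborel (\<lambda>x. ennreal
        (1 / (2 * pi * \<sigma>\<^sup>2) * sqrt (4 * \<sigma>\<^sup>2 - x\<^sup>2) * indicator {-2 * \<sigma>..2 * \<sigma>} x)))"

definition centered_semicircular_process ::
  "(complex \<Rightarrow> 'a :: ring_1 \<Rightarrow> 'a) \<Rightarrow> ('a \<Rightarrow> 'a) \<Rightarrow> ('a \<Rightarrow> complex) \<Rightarrow> (real \<Rightarrow> 'a) \<Rightarrow> bool" where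
  "centered_semicircular_process cscale star \<phi> S \<longleftrightarrow>
     (\<forall>t\<ge>0. star (S t) = S t) \<and>
     (\<forall>(m::nat) (c :: nat \<Rightarrow> real) (t :: nat \<Rightarrow> real). (\<forall>i<m. 0 \<le> t i) \<longrightarrow>
        (\<exists>\<sigma>\<ge>0. spectral_distribution \<phi>
           (\<Sum>i<m. cscale (complex_of_real (c i)) (S (t i))) (semicircle \<sigma>)))"

definition nc_fractional_BM ::
  "(complex \<Rightarrow> 'a :: ring_1 \<Rightarrow> 'a) \<Rightarrow> ('a \<Rightarrow> 'a) \<Rightarrow> ('a \<Rightarrow> complex) \<Rightarrow> real \<Rightarrow> (real \<Rightarrow> 'a) \<Rightarrow> bool" where
  "nc_fractional_BM cscale star \<phi> H S \<longleftrightarrow>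
     0 < H \<and> H < 1 \<and>
     centered_semicircular_process cscale star \<phi> S \<and>
     (\<forall>s\<ge>0. \<forall>t\<ge>0. \<phi> (S t * S s) = complex_of_real (fbm_cov H s t))"

end

theory Submission
  imports Defs "Jordan_Normal_Form.Schur_Decomposition"
begin

text \<open>The limit is deterministic, so convergence in law amounts to convergence in probability,
  uniformly on compact time intervals, of the integrals of finitely many bounded continuous
  functions; by Weierstrass approximation and a Markov-type tail estimate this reduces to the
  moments \<open>\<tau>\<^sub>k(t) = n\<^sup>-\<^sup>1 tr (B\<^sup>(\<^sup>n\<^sup>)(t))\<^sup>k\<close>.

  For fixed \<open>t\<close> the matrix is a GOE matrix of variance \<open>t\<^sup>2\<^sup>H\<close>. Gaussian integration by parts (Wick's
  formula) gives the loop equation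
  \<open>E[\<tau>\<^sub>k\<^sub>+\<^sub>1 Q] = t\<^sup>2\<^sup>H \<Sum>\<^sub>l E[\<tau>\<^sub>l \<tau>\<^sub>k\<^sub>-\<^sub>1\<^sub>-\<^sub>l Q] + O(1/n)\<close> for products \<open>Q\<close> of moments, whose solution is
  asymptotically the product of the Catalan moments of the semicircle law. Induction on the degree
  therefore yields the limits and, at the same time, variances of order \<open>1/n\<close>.

  Uniformity in \<open>t\<close> comes from \<open>E |\<tau>\<^sub>k(t) - \<tau>\<^sub>k(s)|\<^sup>2 \<le> C |t - s|\<^sup>2\<^sup>H\<close>, uniformly in \<open>n\<close>. Interpolating with
  the variance bound gives \<open>C n\<^sup>-\<^sup>\<kappa> |t - s|\<^sup>a\<close> with \<open>\<kappa> > 0\<close> and, since \<open>2H > 1\<close>, still \<open>a > 1\<close>, so a dyadic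
  chaining argument with second moments alone controls the supremum over \<open>[0, T]\<close>.\<close>

text \<open>Interpretations of \<open>HOL-Algebra\<close> locales at type-class operations, inherited from the import, put
  copies of these laws into the simpset that conflict with the usual normal forms.\<close>

declare class_semiring.finsum_addf [simp del] class_cring.finprod_multf [simp del]
  class_semiring.nat_pow_Suc [simp del] class_semiring.finsum_Suc [simp del] class_cring.finprod_Suc [simp del]

section \<open>Gaussian integration by parts\<close>

text \<open>Matrices at different times are correlated, yet every moment computation concerns a
  single GOE matrix: an increment of the path is again one, of variance |t - s|^(2H), and
  expressions mixing two times are separated by Cauchy-Schwarz and a weighted AM-GM inequality. The
  loop equation is exploited only to first order, so the variances come out as 1/n; chaining is
  content with any positive power of 1/n. What it does demand is a time exponent above 1, because
  level k has 2^k increments and only second moments are used, so the interpolation must give up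
  less than 2H - 1 of the exponent 2H. The random paths must also be measurable for a topology
  defined by test functions. Measurability and convergence share one mechanism: near a path whose
  moments are locally bounded, uniform closeness of finitely many moments forces closeness in the
  path space, so that the eigenvalues enter only through continuous real processes that are
  polynomials in the matrix entries.\<close>

fun mpow :: "nat \<Rightarrow> (nat \<Rightarrow> nat \<Rightarrow> real) \<Rightarrow> nat \<Rightarrow> nat \<Rightarrow> nat \<Rightarrow> real" where
  "mpow n a 0 i j = of_bool (i = j)"
| "mpow n a (Suc k) i j = (\<Sum>l<n. a i l * mpow n a k l j)"

definition ntr :: "nat \<Rightarrow> (nat \<Rightarrow> nat \<Rightarrow> real) \<Rightarrow> nat \<Rightarrow> real" where
  "ntr n a k = (\<Sum>i<n. mpow n a k i i) / real n"

lemma sum_of_bool_lessThan: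
  fixes f :: "nat \<Rightarrow> real"
  shows "i < n \<Longrightarrow> (\<Sum>l<n. of_bool (i = l) * f l) = f i"
    and "i < n \<Longrightarrow> (\<Sum>l<n. of_bool (l = i) * f l) = f i"
    and "i < n \<Longrightarrow> (\<Sum>l<n. f l * of_bool (i = l)) = f i"
    and "i < n \<Longrightarrow> (\<Sum>l<n. f l * of_bool (l = i)) = f i"
  by (simp_all add: of_bool_def if_distrib[of "\<lambda>x. x * _"] if_distrib[of "\<lambda>x. _ * x"]
      sum.delta sum.delta' cong: if_cong)

lemma mpow_add:
  assumes "i < n"
  shows "mpow n a (k + l) i j = (\<Sum>c<n. mpow n a k i c * mpow n a l c j)"
  using assms
proof (induction k arbitrary: i)
  case 0
  then show ?case by (simp add: sum_of_bool_lessThan)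
next
  case (Suc k)
  have "mpow n a (Suc k + l) i j = (\<Sum>d<n. a i d * (\<Sum>c<n. mpow n a k d c * mpow n a l c j))"
    using Suc.IH by simp
  also have "\<dots> = (\<Sum>c<n. \<Sum>d<n. a i d * mpow n a k d c * mpow n a l c j)"
    by (subst sum.swap) (simp add: sum_distrib_left mult.assoc)
  finally show ?case by (simp add: sum_distrib_right)
qed

lemma mpow_sym:
  assumes "\<And>i j. a i j = a j i" "i < n" "j < n"
  shows "mpow n a k i j = mpow n a k j i"
  using assms(2,3)
proof (induction k arbitrary: i j)
  case 0
  then show ?case by (simp add: eq_commute)
next
  case (Suc k)
  have "mpow n a (Suc k) j i = (\<Sum>l<n. mpow n a k i l * mpow n a 1 l j)"
    using Suc by (auto simp: assms(1)[of _ j] sum_of_bool_lessThan mult.commute intro!: sum.cong)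
  also have "\<dots> = mpow n a (k + 1) i j"
    using Suc.prems by (subst mpow_add) auto
  finally show ?case by simp
qed

lemma ntr_0 [simp]: "n \<ge> 1 \<Longrightarrow> ntr n a 0 = 1"
  by (simp add: ntr_def)

definition entry_mono :: "(nat \<Rightarrow> nat \<Rightarrow> real) \<Rightarrow> (nat \<times> nat) list \<Rightarrow> real" where
  "entry_mono a w = (\<Prod>(i, j)\<leftarrow>w. a i j)"

text \<open>Covariance of the entries (i, j) and (k, l). On the diagonal both indicators hold,
  whence the variance 2 s^2 / n there against s^2 / n elsewhere.\<close>

definition goe_cov :: "nat \<Rightarrow> real \<Rightarrow> nat \<Rightarrow> nat \<Rightarrow> nat \<Rightarrow> nat \<Rightarrow> real" where
  "goe_cov n s i j k l = s\<^sup>2 / real n * (of_bool (i = k \<and> j = l) + of_bool (i = l \<and> j = k))"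

text \<open>The right-hand side of Wick's formula: the gradient of the monomial paired with the
  covariances of the entry (i, j). Recursion over the word makes the product rule for one further
  letter definitional.\<close>

fun entry_mono_deriv :: "nat \<Rightarrow> real \<Rightarrow> (nat \<Rightarrow> nat \<Rightarrow> real) \<Rightarrow> nat \<Rightarrow> nat \<Rightarrow> (nat \<times> nat) list \<Rightarrow> real" where
  "entry_mono_deriv n s a i j [] = 0"
| "entry_mono_deriv n s a i j ((k, l) # w) = goe_cov n s i j k l * entry_mono a w + a k l * entry_mono_deriv n s a i j w"

lemma entry_mono_simps [simp]: "entry_mono a [] = 1" "entry_mono a ((k, l) # w) = a k l * entry_mono a w"
  by (simp_all add: entry_mono_def)

lemma entry_mono_append: "entry_mono a (v @ w) = entry_mono a v * entry_mono a w"
  by (simp add: entry_mono_def)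

text \<open>Gaussianity is recorded through integrability of monomials and Wick's formula. Matrices
  at a fixed time and increments both satisfy this, so the trace computations serve both.\<close>

locale goe = prob_space M for M :: "'w measure" +
  fixes n :: nat and s :: real and A :: "'w \<Rightarrow> nat \<Rightarrow> nat \<Rightarrow> real"
  assumes n_pos: "n \<ge> 1"
    and sym: "A z i j = A z j i"
    and integrable_entry_mono: "set w \<subseteq> {..<n} \<times> {..<n} \<Longrightarrow> integrable M (\<lambda>z. entry_mono (A z) w)"
    and wick: "i < n \<Longrightarrow> j < n \<Longrightarrow> set w \<subseteq> {..<n} \<times> {..<n} \<Longrightarrow>
      expectation (\<lambda>z. A z i j * entry_mono (A z) w) = expectation (\<lambda>z. entry_mono_deriv n s (A z) i j w)"
begin

text \<open>\<open>ibp i j G G'\<close> says that \<open>G'\<close> acts as the derivative of \<open>G\<close> in the direction dual to the entry \<open>(i, j)\<close>,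
  tested against all monomials in the entries. A \<open>deriv_pair\<close> is a multiplier that preserves this
  relation; such pairs obey the Leibniz rule by construction, so integration by parts extends from
  monomials to traces of powers without a type of polynomials.\<close>

definition ibp :: "nat \<Rightarrow> nat \<Rightarrow> ('w \<Rightarrow> real) \<Rightarrow> ('w \<Rightarrow> real) \<Rightarrow> bool" where
  "ibp i j G G' \<longleftrightarrow> i < n \<and> j < n \<and> (\<forall>w. set w \<subseteq> {..<n} \<times> {..<n} \<longrightarrow>
     integrable M (\<lambda>z. entry_mono (A z) w * G z) \<and>
     integrable M (\<lambda>z. entry_mono_deriv n s (A z) i j w * G z) \<and>
     integrable M (\<lambda>z. entry_mono (A z) w * G' z) \<and>
     expectation (\<lambda>z. A z i j * entry_mono (A z) w * G z) =
     expectation (\<lambda>z. entry_mono_deriv n s (A z) i j w * G z + entry_mono (A z) w * G' z))"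

definition deriv_pair :: "nat \<Rightarrow> nat \<Rightarrow> ('w \<Rightarrow> real) \<Rightarrow> ('w \<Rightarrow> real) \<Rightarrow> bool" where
  "deriv_pair i j F F' \<longleftrightarrow>
     (\<forall>G G'. ibp i j G G' \<longrightarrow> ibp i j (\<lambda>z. F z * G z) (\<lambda>z. F' z * G z + F z * G' z))"

lemma ibp_less: "ibp i j G G' \<Longrightarrow> i < n" "ibp i j G G' \<Longrightarrow> j < n"
  by (simp_all add: ibp_def)

lemma ibpD:
  assumes "ibp i j G G'" "set w \<subseteq> {..<n} \<times> {..<n}"
  shows "integrable M (\<lambda>z. entry_mono (A z) w * G z)"
    "integrable M (\<lambda>z. entry_mono_deriv n s (A z) i j w * G z)"
    "integrable M (\<lambda>z. entry_mono (A z) w * G' z)"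
    "expectation (\<lambda>z. A z i j * entry_mono (A z) w * G z) =
     expectation (\<lambda>z. entry_mono_deriv n s (A z) i j w * G z) + expectation (\<lambda>z. entry_mono (A z) w * G' z)"
    "integrable M (\<lambda>z. A z i j * entry_mono (A z) w * G z)"
proof -
  have "set ((i, j) # w) \<subseteq> {..<n} \<times> {..<n}"
    using assms unfolding ibp_def by auto
  then have "integrable M (\<lambda>z. entry_mono (A z) ((i, j) # w) * G z)"
    using assms unfolding ibp_def by blast
  then show "integrable M (\<lambda>z. A z i j * entry_mono (A z) w * G z)"
    by simp
  show 1: "integrable M (\<lambda>z. entry_mono (A z) w * G z)"
    and 2: "integrable M (\<lambda>z. entry_mono_deriv n s (A z) i j w * G z)"
    and 3: "integrable M (\<lambda>z. entry_mono (A z) w * G' z)"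
    using assms by (simp_all only: ibp_def)
  have "expectation (\<lambda>z. A z i j * entry_mono (A z) w * G z) =
     expectation (\<lambda>z. entry_mono_deriv n s (A z) i j w * G z + entry_mono (A z) w * G' z)"
    using assms by (simp only: ibp_def)
  then show "expectation (\<lambda>z. A z i j * entry_mono (A z) w * G z) =
     expectation (\<lambda>z. entry_mono_deriv n s (A z) i j w * G z) + expectation (\<lambda>z. entry_mono (A z) w * G' z)"
    using Bochner_Integration.integral_add[OF 2 3] by simp
qed

text \<open>The word \<open>v\<close> is generalised in the induction because the second term of the
  recursion leaves the letter (k, l) as an additional factor.\<close>

lemma integrable_entry_mono_deriv:
  assumes "set v \<subseteq> {..<n} \<times> {..<n}" "set w \<subseteq> {..<n} \<times> {..<n}"
  shows "integrable M (\<lambda>z. entry_mono (A z) v * entry_mono_deriv n s (A z) i j w)"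
  using assms
proof (induction w arbitrary: v)
  case (Cons kl w)
  obtain k l where kl: "kl = (k, l)" by force
  have 1: "integrable M (\<lambda>z. entry_mono (A z) ((k, l) # v) * entry_mono_deriv n s (A z) i j w)"
    by (rule Cons.IH) (use Cons.prems kl in auto)
  have 2: "integrable M (\<lambda>z. goe_cov n s i j k l * entry_mono (A z) (v @ w))"
    by (rule integrable_mult_right, rule integrable_entry_mono) (use Cons.prems kl in auto)
  have "integrable M (\<lambda>z. goe_cov n s i j k l * entry_mono (A z) (v @ w) +
      entry_mono (A z) ((k, l) # v) * entry_mono_deriv n s (A z) i j w)"
    by (rule Bochner_Integration.integrable_add[OF 2 1])
  then show ?case by (simp add: kl entry_mono_append algebra_simps)
qed simp

lemma ibpI:
  assumes "i < n" "j < n"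
    and "\<And>w. set w \<subseteq> {..<n} \<times> {..<n} \<Longrightarrow> integrable M (\<lambda>z. entry_mono (A z) w * G z)"
    and "\<And>w. set w \<subseteq> {..<n} \<times> {..<n} \<Longrightarrow> integrable M (\<lambda>z. entry_mono_deriv n s (A z) i j w * G z)"
    and "\<And>w. set w \<subseteq> {..<n} \<times> {..<n} \<Longrightarrow> integrable M (\<lambda>z. entry_mono (A z) w * G' z)"
    and "\<And>w. set w \<subseteq> {..<n} \<times> {..<n} \<Longrightarrow> expectation (\<lambda>z. A z i j * entry_mono (A z) w * G z) =
     expectation (\<lambda>z. entry_mono_deriv n s (A z) i j w * G z + entry_mono (A z) w * G' z)"
  shows "ibp i j G G'"
  unfolding ibp_def using assms by (intro conjI allI impI)

lemma ibp_one:
  assumes "i < n" "j < n"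
  shows "ibp i j (\<lambda>_. 1) (\<lambda>_. 0)"
proof (rule ibpI[OF assms])
  fix w assume w: "set w \<subseteq> {..<n} \<times> {..<n}"
  show "integrable M (\<lambda>z. entry_mono (A z) w * 1)"
    using integrable_entry_mono[OF w] by simp
  show "integrable M (\<lambda>z. entry_mono_deriv n s (A z) i j w * 1)"
    using integrable_entry_mono_deriv[OF _ w, of "[]"] by simp
  show "expectation (\<lambda>z. A z i j * entry_mono (A z) w * 1) =
      expectation (\<lambda>z. entry_mono_deriv n s (A z) i j w * 1 + entry_mono (A z) w * 0)"
    using wick[OF assms w] by simp
qed simp

lemma ibp_add:
  assumes 1: "ibp i j F F'" and 2: "ibp i j K K'"
  shows "ibp i j (\<lambda>z. F z + K z) (\<lambda>z. F' z + K' z)"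
proof (rule ibpI[OF ibp_less[OF 1]])
  fix w assume w: "set w \<subseteq> {..<n} \<times> {..<n}"
  note I = ibpD[OF 1 w] and J = ibpD[OF 2 w]
  show "integrable M (\<lambda>z. entry_mono (A z) w * (F z + K z))"
    using I(1) J(1) by (simp add: distrib_left)
  show "integrable M (\<lambda>z. entry_mono_deriv n s (A z) i j w * (F z + K z))"
    using I(2) J(2) by (simp add: distrib_left)
  show "integrable M (\<lambda>z. entry_mono (A z) w * (F' z + K' z))"
    using I(3) J(3) by (simp add: distrib_left)
  show "expectation (\<lambda>z. A z i j * entry_mono (A z) w * (F z + K z)) =
    expectation (\<lambda>z. entry_mono_deriv n s (A z) i j w * (F z + K z) + entry_mono (A z) w * (F' z + K' z))"
    using I J by (simp add: distrib_left)
qed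

lemma ibp_cmult:
  assumes "ibp i j G G'"
  shows "ibp i j (\<lambda>z. c * G z) (\<lambda>z. c * G' z)"
proof (rule ibpI[OF ibp_less[OF assms]])
  fix w assume w: "set w \<subseteq> {..<n} \<times> {..<n}"
  note I = ibpD[OF assms w]
  show "integrable M (\<lambda>z. entry_mono (A z) w * (c * G z))"
    using I(1) by (simp add: mult.left_commute[of _ c])
  show "integrable M (\<lambda>z. entry_mono_deriv n s (A z) i j w * (c * G z))"
    using I(2) by (simp add: mult.left_commute[of _ c])
  show "integrable M (\<lambda>z. entry_mono (A z) w * (c * G' z))"
    using I(3) by (simp add: mult.left_commute[of _ c])
  show "expectation (\<lambda>z. A z i j * entry_mono (A z) w * (c * G z)) =
    expectation (\<lambda>z. entry_mono_deriv n s (A z) i j w * (c * G z) + entry_mono (A z) w * (c * G' z))"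
    using I by (simp add: mult.left_commute[of _ c] distrib_left)
qed

lemma deriv_pair_const: "deriv_pair i j (\<lambda>_. c) (\<lambda>_. 0)"
  unfolding deriv_pair_def using ibp_cmult by simp

lemma deriv_pair_add:
  assumes "deriv_pair i j F F'" "deriv_pair i j K K'"
  shows "deriv_pair i j (\<lambda>z. F z + K z) (\<lambda>z. F' z + K' z)"
  unfolding deriv_pair_def
proof (intro allI impI)
  fix G G' assume G: "ibp i j G G'"
  have 1: "ibp i j (\<lambda>z. F z * G z) (\<lambda>z. F' z * G z + F z * G' z)"
   and 2: "ibp i j (\<lambda>z. K z * G z) (\<lambda>z. K' z * G z + K z * G' z)"
    using assms G unfolding deriv_pair_def by blast+
  show "ibp i j (\<lambda>z. (F z + K z) * G z) (\<lambda>z. (F' z + K' z) * G z + (F z + K z) * G' z)"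
    using ibp_add[OF 1 2] by (simp add: algebra_simps)
qed

lemma deriv_pair_mult:
  assumes "deriv_pair i j F F'" "deriv_pair i j K K'"
  shows "deriv_pair i j (\<lambda>z. F z * K z) (\<lambda>z. F' z * K z + F z * K' z)"
  unfolding deriv_pair_def
proof (intro allI impI)
  fix G G' assume G: "ibp i j G G'"
  have "ibp i j (\<lambda>z. K z * G z) (\<lambda>z. K' z * G z + K z * G' z)"
    using assms G unfolding deriv_pair_def by blast
  then have "ibp i j (\<lambda>z. F z * (K z * G z))
      (\<lambda>z. F' z * (K z * G z) + F z * (K' z * G z + K z * G' z))"
    using assms unfolding deriv_pair_def by blast
  then show "ibp i j (\<lambda>z. (F z * K z) * G z)
      (\<lambda>z. (F' z * K z + F z * K' z) * G z + (F z * K z) * G' z)"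
    by (simp add: algebra_simps)
qed

text \<open>Multiplying by an entry amounts to testing against a word with one more letter; the
  recursion of \<open>entry_mono_deriv\<close> at that letter produces exactly the covariance
  term.\<close>

lemma deriv_pair_coord:
  assumes "k < n" "l < n"
  shows "deriv_pair i j (\<lambda>z. A z k l) (\<lambda>_. goe_cov n s i j k l)"
  unfolding deriv_pair_def
proof (intro allI impI)
  fix G G' assume G: "ibp i j G G'"
  show "ibp i j (\<lambda>z. A z k l * G z) (\<lambda>z. goe_cov n s i j k l * G z + A z k l * G' z)"
  proof (rule ibpI[OF ibp_less[OF G]])
    fix w assume w: "set w \<subseteq> {..<n} \<times> {..<n}"
    have w': "set ((k, l) # w) \<subseteq> {..<n} \<times> {..<n}"
      using assms w by simp
    note I = ibpD[OF G w] and I' = ibpD[OF G w']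
    show 1: "integrable M (\<lambda>z. entry_mono (A z) w * (A z k l * G z))"
      using I'(1) by (simp add: mult_ac)
    have "integrable M (\<lambda>z. entry_mono_deriv n s (A z) i j ((k, l) # w) * G z - goe_cov n s i j k l * (entry_mono (A z) w * G z))"
      using I'(2) I(1) by auto
    then show 2: "integrable M (\<lambda>z. entry_mono_deriv n s (A z) i j w * (A z k l * G z))"
      by (simp add: algebra_simps)
    have "integrable M (\<lambda>z. entry_mono (A z) ((k, l) # w) * G' z + goe_cov n s i j k l * (entry_mono (A z) w * G z))"
      using I'(3) I(1) by auto
    then show 3: "integrable M (\<lambda>z. entry_mono (A z) w * (goe_cov n s i j k l * G z + A z k l * G' z))"
      by (simp add: algebra_simps)
    have "expectation (\<lambda>z. A z i j * entry_mono (A z) w * (A z k l * G z)) =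
        expectation (\<lambda>z. entry_mono_deriv n s (A z) i j ((k, l) # w) * G z) +
        expectation (\<lambda>z. entry_mono (A z) ((k, l) # w) * G' z)"
      using I'(4) by (simp add: mult_ac)
    also have "\<dots> = expectation (\<lambda>z. entry_mono_deriv n s (A z) i j ((k, l) # w) * G z + entry_mono (A z) ((k, l) # w) * G' z)"
      using I' by simp
    also have "\<dots> = expectation (\<lambda>z. entry_mono_deriv n s (A z) i j w * (A z k l * G z) +
        entry_mono (A z) w * (goe_cov n s i j k l * G z + A z k l * G' z))"
      by (intro Bochner_Integration.integral_cong) (auto simp: algebra_simps)
    finally show "expectation (\<lambda>z. A z i j * entry_mono (A z) w * (A z k l * G z)) =
        expectation (\<lambda>z. entry_mono_deriv n s (A z) i j w * (A z k l * G z) +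
        entry_mono (A z) w * (goe_cov n s i j k l * G z + A z k l * G' z))" .
  qed
qed

lemma deriv_pair_sum:
  assumes "finite I" "\<And>x. x \<in> I \<Longrightarrow> deriv_pair i j (F x) (F' x)"
  shows "deriv_pair i j (\<lambda>z. \<Sum>x\<in>I. F x z) (\<lambda>z. \<Sum>x\<in>I. F' x z)"
  using assms
proof (induction I)
  case empty
  then show ?case using deriv_pair_const[of i j 0] by simp
next
  case (insert x I)
  then show ?case using deriv_pair_add[of i j "F x" "F' x"] by simp
qed

text \<open>The constant 1 with derivative 0 satisfies \<open>ibp\<close> by Wick's formula.
  Applying the multiplier to it and testing against the empty word gives plain integration by
  parts.\<close>

lemma deriv_pairD:
  assumes "deriv_pair i j F F'" "i < n" "j < n"
  shows "integrable M F" "integrable M F'" "integrable M (\<lambda>z. A z i j * F z)"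
    "expectation (\<lambda>z. A z i j * F z) = expectation F'"
proof -
  have "ibp i j (\<lambda>z. F z * 1) (\<lambda>z. F' z * 1 + F z * 0)"
    using assms(1) ibp_one[OF assms(2,3)] unfolding deriv_pair_def by blast
  then have F: "ibp i j F F'" by simp
  show "integrable M F" "integrable M F'" "integrable M (\<lambda>z. A z i j * F z)"
    "expectation (\<lambda>z. A z i j * F z) = expectation F'"
    using ibpD[OF F, of "[]"] by simp_all
qed

text \<open>Product rule for a power: the factor after the first l ones is differentiated, and by
  symmetry of the matrix the direction has weight s^2 / n at both (i, j) and (j, i). For i = j the
  two terms coincide, in accordance with the doubled diagonal variance.\<close>

lemma deriv_pair_mpow:
  assumes "i < n" "j < n" "p < n"
  shows "deriv_pair i j (\<lambda>z. mpow n (A z) k p q) (\<lambda>z. s\<^sup>2 / real n * (\<Sum>l<k.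
    mpow n (A z) l p i * mpow n (A z) (k - 1 - l) j q + mpow n (A z) l p j * mpow n (A z) (k - 1 - l) i q))"
    (is "deriv_pair i j _ (\<lambda>z. ?D z k p)")
  using assms(3)
proof (induction k arbitrary: p)
  case 0
  then show ?case using deriv_pair_const[of i j "of_bool (p = q)"] by simp
next
  case (Suc k)
  have 1: "deriv_pair i j (\<lambda>z. \<Sum>c<n. A z p c * mpow n (A z) k c q)
      (\<lambda>z. \<Sum>c<n. goe_cov n s i j p c * mpow n (A z) k c q + A z p c * ?D z k c)"
    using Suc by (intro deriv_pair_sum deriv_pair_mult deriv_pair_coord) auto
  have 2: "(\<Sum>c<n. goe_cov n s i j p c * mpow n (A z) k c q + A z p c * ?D z k c) = ?D z (Suc k) p" for z
  proof -
    have a: "(\<Sum>c<n. goe_cov n s i j p c * mpow n (A z) k c q) =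
        s\<^sup>2 / real n * (of_bool (p = i) * mpow n (A z) k j q + of_bool (p = j) * mpow n (A z) k i q)"
    proof -
      have "(\<Sum>c<n. goe_cov n s i j p c * mpow n (A z) k c q) =
        (\<Sum>c<n. s\<^sup>2 / real n * (of_bool (p = i) * (of_bool (j = c) * mpow n (A z) k c q)
          + of_bool (p = j) * (of_bool (i = c) * mpow n (A z) k c q)))"
        unfolding goe_cov_def by (intro sum.cong) (auto simp: algebra_simps)
      also have "\<dots> = s\<^sup>2 / real n * (of_bool (p = i) * (\<Sum>c<n. of_bool (j = c) * mpow n (A z) k c q)
          + of_bool (p = j) * (\<Sum>c<n. of_bool (i = c) * mpow n (A z) k c q))"
        by (simp only: sum_distrib_left[symmetric] sum.distrib)
      finally show ?thesis using assms by (simp only: sum_of_bool_lessThan)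
    qed
    have b: "(\<Sum>c<n. A z p c * ?D z k c) = s\<^sup>2 / real n * (\<Sum>l<k.
        mpow n (A z) (Suc l) p i * mpow n (A z) (k - 1 - l) j q
        + mpow n (A z) (Suc l) p j * mpow n (A z) (k - 1 - l) i q)"
    proof -
      have "(\<Sum>c<n. A z p c * ?D z k c) = s\<^sup>2 / real n * (\<Sum>c<n. \<Sum>l<k. A z p c * (
        mpow n (A z) l c i * mpow n (A z) (k - 1 - l) j q + mpow n (A z) l c j * mpow n (A z) (k - 1 - l) i q))"
        by (simp add: sum_distrib_left mult.left_commute)
      also have "\<dots> = s\<^sup>2 / real n * (\<Sum>l<k. \<Sum>c<n. A z p c * (
        mpow n (A z) l c i * mpow n (A z) (k - 1 - l) j q + mpow n (A z) l c j * mpow n (A z) (k - 1 - l) i q))"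
        by (subst sum.swap) simp
      finally show ?thesis
        by (simp add: sum_distrib_right distrib_left sum.distrib mult.assoc)
    qed
    \<comment> \<open>\<open>f 0\<close> stems from differentiating the leftmost factor,
      \<open>f (Suc l)\<close> from the remaining power, whose summands are shifted by one when the
      entry is multiplied from the left.\<close>
    define f where "f l = mpow n (A z) l p i * mpow n (A z) (k - l) j q
      + mpow n (A z) l p j * mpow n (A z) (k - l) i q" for l
    have "(\<Sum>c<n. goe_cov n s i j p c * mpow n (A z) k c q + A z p c * ?D z k c) =
        s\<^sup>2 / real n * f 0 + s\<^sup>2 / real n * (\<Sum>l<k. f (Suc l))"
      by (subst sum.distrib, subst a, subst b) (simp only: f_def mpow.simps(1) diff_zero diff_Suc_eq_diff_pred diff_commute[of k 1])
    also have "\<dots> = s\<^sup>2 / real n * (\<Sum>l<Suc k. f l)"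
      by (simp only: sum.lessThan_Suc_shift distrib_left)
    finally show ?thesis
      by (simp only: f_def diff_Suc_1)
  qed
  show ?case using 1 unfolding 2 mpow.simps(2) .
qed

end

section \<open>The loop equation\<close>

definition ntr_prod :: "nat \<Rightarrow> (nat \<Rightarrow> nat \<Rightarrow> real) \<Rightarrow> nat list \<Rightarrow> real" where
  "ntr_prod n a ks = (\<Prod>k\<leftarrow>ks. ntr n a k)"

lemma ntr_prod_simps [simp]: "ntr_prod n a [] = 1" "ntr_prod n a (k # ks) = ntr n a k * ntr_prod n a ks"
  by (simp_all add: ntr_prod_def)

lemma ntr_mult:
  assumes "n \<ge> 1"
  shows "(\<Sum>i<n. \<Sum>j<n. mpow n a k i j * mpow n a l j i) = real n * ntr n a (k + l)"
  using assms by (simp add: ntr_def mpow_add)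

lemma sum_mpow_prod:
  assumes "n \<ge> 1"
  shows "(\<Sum>i<n. \<Sum>j<n. mpow n a k i i * mpow n a l j j) = (real n)\<^sup>2 * (ntr n a k * ntr n a l)"
  using assms by (simp add: ntr_def sum_product[symmetric] power2_eq_square)

lemma integral_double_sum:
  fixes f :: "nat \<Rightarrow> nat \<Rightarrow> 'b \<Rightarrow> real"
  assumes "\<And>i j. i < n \<Longrightarrow> j < n \<Longrightarrow> integrable M (f i j)"
  shows "(\<integral>z. (\<Sum>i<n. \<Sum>j<n. f i j z) \<partial>M) = (\<Sum>i<n. \<Sum>j<n. \<integral>z. f i j z \<partial>M)"
proof -
  have "(\<integral>z. (\<Sum>i<n. \<Sum>j<n. f i j z) \<partial>M) = (\<Sum>i<n. \<integral>z. (\<Sum>j<n. f i j z) \<partial>M)"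
    using assms by (intro Bochner_Integration.integral_sum Bochner_Integration.integrable_sum) simp
  also have "\<dots> = (\<Sum>i<n. \<Sum>j<n. \<integral>z. f i j z \<partial>M)"
    using assms by (intro sum.cong refl Bochner_Integration.integral_sum) simp
  finally show ?thesis .
qed

context goe
begin

lemma mpow_entry_sym: "i < n \<Longrightarrow> j < n \<Longrightarrow> mpow n (A z) k i j = mpow n (A z) k j i"
  by (rule mpow_sym) (rule sym)

lemma deriv_pair_cmult:
  assumes "deriv_pair i j F F'"
  shows "deriv_pair i j (\<lambda>z. c * F z) (\<lambda>z. c * F' z)"
  using deriv_pair_mult[OF deriv_pair_const[of i j c] assms] by simp

text \<open>By cyclicity of the trace each of the k places contributes the same entry of the (k -
  1)-st power, and symmetry of that power merges the two terms; hence the factor 2 k.\<close>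

lemma deriv_pair_ntr:
  assumes "i < n" "j < n"
  shows "deriv_pair i j (\<lambda>z. ntr n (A z) k) (\<lambda>z. 2 * real k * s\<^sup>2 / (real n)\<^sup>2 * mpow n (A z) (k - 1) i j)"
proof -
  let ?D = "\<lambda>z p. s\<^sup>2 / real n * (\<Sum>l<k.
    mpow n (A z) l p i * mpow n (A z) (k - 1 - l) j p + mpow n (A z) l p j * mpow n (A z) (k - 1 - l) i p)"
  have "deriv_pair i j (\<lambda>z. 1 / real n * (\<Sum>p<n. mpow n (A z) k p p)) (\<lambda>z. 1 / real n * (\<Sum>p<n. ?D z p))"
    using assms by (intro deriv_pair_cmult deriv_pair_sum deriv_pair_mpow) auto
  moreover have "1 / real n * (\<Sum>p<n. ?D z p) = 2 * real k * s\<^sup>2 / (real n)\<^sup>2 * mpow n (A z) (k - 1) i j" for z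
  proof -
    have 1: "(\<Sum>p<n. mpow n (A z) l p i * mpow n (A z) (k - 1 - l) j p +
        mpow n (A z) l p j * mpow n (A z) (k - 1 - l) i p) = 2 * mpow n (A z) (k - 1) i j" if "l < k" for l
    proof -
      have "(\<Sum>p<n. mpow n (A z) l p i * mpow n (A z) (k - 1 - l) j p) = mpow n (A z) (k - 1) j i"
        using that assms mpow_add[of j n "A z" "k - 1 - l" l i] by (simp add: mult.commute)
      moreover have "(\<Sum>p<n. mpow n (A z) l p j * mpow n (A z) (k - 1 - l) i p) = mpow n (A z) (k - 1) i j"
        using that assms mpow_add[of i n "A z" "k - 1 - l" l j] by (simp add: mult.commute)
      ultimately show ?thesis
        using mpow_entry_sym[OF assms] by (simp add: sum.distrib)
    qed
    have "(\<Sum>p<n. ?D z p) = s\<^sup>2 / real n * (\<Sum>l<k. \<Sum>p<n. mpow n (A z) l p i * mpow n (A z) (k - 1 - l) j p +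
        mpow n (A z) l p j * mpow n (A z) (k - 1 - l) i p)"
      by (subst sum.swap) (simp add: sum_distrib_left)
    also have "\<dots> = s\<^sup>2 / real n * (\<Sum>l<k. 2 * mpow n (A z) (k - 1) i j)"
      using 1 by (intro arg_cong2[where f = "(*)"] sum.cong refl) simp
    finally show ?thesis
      by (simp add: power2_eq_square)
  qed
  ultimately show ?thesis
    by (simp add: ntr_def)
qed

lemma deriv_pair_ntr_prod:
  assumes "i < n" "j < n"
  shows "deriv_pair i j (\<lambda>z. ntr_prod n (A z) ks) (\<lambda>z. \<Sum>p<length ks.
    2 * real (ks ! p) * s\<^sup>2 / (real n)\<^sup>2 * mpow n (A z) (ks ! p - 1) i j *
      ntr_prod n (A z) (take p ks @ drop (Suc p) ks))"
proof (induction ks)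
  case Nil
  then show ?case using deriv_pair_const[of i j 1] by simp
next
  case (Cons k ks)
  show ?case
    using deriv_pair_mult[OF deriv_pair_ntr[OF assms, of k] Cons.IH]
    by (simp add: sum.lessThan_Suc_shift sum_distrib_left mult.left_commute[of "ntr n _ _"] del: sum.lessThan_Suc)
qed

lemma integrable_ntr_prod: "integrable M (\<lambda>z. ntr_prod n (A z) ks)"
  using deriv_pairD(1)[OF deriv_pair_ntr_prod] n_pos by auto

text \<open>For \<open>ks ! p = 0\<close> the last summand vanishes, whatever the truncated \<open>ks ! p - 1\<close> is.\<close>

lemma loop_equation:
  "expectation (\<lambda>z. ntr_prod n (A z) (Suc k # ks)) =
     s\<^sup>2 * (\<Sum>l<k. expectation (\<lambda>z. ntr_prod n (A z) (l # (k - 1 - l) # ks))) +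
     s\<^sup>2 * real k / real n * expectation (\<lambda>z. ntr_prod n (A z) ((k - 1) # ks)) +
     2 * s\<^sup>2 / (real n)\<^sup>2 * (\<Sum>p<length ks. real (ks ! p) *
       expectation (\<lambda>z. ntr_prod n (A z) ((k + (ks ! p - 1)) # take p ks @ drop (Suc p) ks)))"
proof -
  \<comment> \<open>\<open>D\<close> and \<open>E\<close> are the derivatives, in direction (i, j),
    of the entry (j, i) of the k-th power and of the trace product.\<close>
  define D where "D z i j = s\<^sup>2 / real n * (\<Sum>l<k. mpow n (A z) l j i * mpow n (A z) (k - 1 - l) j i
      + mpow n (A z) l j j * mpow n (A z) (k - 1 - l) i i)" for z i j
  define E where "E z i j = (\<Sum>p<length ks. 2 * real (ks ! p) * s\<^sup>2 / (real n)\<^sup>2 *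
      mpow n (A z) (ks ! p - 1) i j * ntr_prod n (A z) (take p ks @ drop (Suc p) ks))" for z i j
  define F where "F i j z = mpow n (A z) k j i * ntr_prod n (A z) ks" for i j z
  define F' where "F' i j z = D z i j * ntr_prod n (A z) ks + mpow n (A z) k j i * E z i j" for i j z
  have dp: "deriv_pair i j (F i j) (F' i j)" if "i < n" "j < n" for i j
    unfolding F_def F'_def D_def E_def by (intro deriv_pair_mult deriv_pair_mpow deriv_pair_ntr_prod that)
  have "ntr_prod n (A z) (Suc k # ks) = 1 / real n * (\<Sum>i<n. \<Sum>j<n. A z i j * F i j z)" for z
    by (simp add: ntr_def F_def sum_distrib_right mult.assoc)
  then have "expectation (\<lambda>z. ntr_prod n (A z) (Suc k # ks)) =
      1 / real n * (\<Sum>i<n. \<Sum>j<n. expectation (\<lambda>z. A z i j * F i j z))"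
    using integral_double_sum[OF deriv_pairD(3)[OF dp]] by simp
  also have "\<dots> = 1 / real n * (\<Sum>i<n. \<Sum>j<n. expectation (F' i j))"
    using deriv_pairD(4)[OF dp] by simp
  also have "\<dots> = expectation (\<lambda>z. 1 / real n * (\<Sum>i<n. \<Sum>j<n. F' i j z))"
    using integral_double_sum[OF deriv_pairD(2)[OF dp]] by simp
  also have "(\<lambda>z. 1 / real n * (\<Sum>i<n. \<Sum>j<n. F' i j z)) = (\<lambda>z.
      s\<^sup>2 * (\<Sum>l<k. ntr_prod n (A z) (l # (k - 1 - l) # ks)) +
      s\<^sup>2 * real k / real n * ntr_prod n (A z) ((k - 1) # ks) +
      2 * s\<^sup>2 / (real n)\<^sup>2 * (\<Sum>p<length ks. real (ks ! p) *
        ntr_prod n (A z) ((k + (ks ! p - 1)) # take p ks @ drop (Suc p) ks)))" (is "_ = (\<lambda>z. ?R z)")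
  proof
    fix z
    have n0: "real n \<noteq> 0" using n_pos by simp
    have sw: "(\<Sum>i<n. \<Sum>j<n. mpow n (A z) l j i * mpow n (A z) m i j) = real n * ntr n (A z) (l + m)" for l m
      using ntr_mult[OF n_pos, of "A z" l m] by (subst sum.swap) simp
    \<comment> \<open>The two terms of \<open>D\<close> differ under summation over i and j: the
      crossed one closes up to a single trace and so loses a factor n, the other one splits into two
      traces. The former is the source of the correction of order 1/n.\<close>
    have tr1: "(\<Sum>i<n. \<Sum>j<n. mpow n (A z) l j i * mpow n (A z) (k - 1 - l) j i) = real n * ntr n (A z) (k - 1)"
      if "l < k" for l
    proof -
      have "(\<Sum>i<n. \<Sum>j<n. mpow n (A z) l j i * mpow n (A z) (k - 1 - l) j i) =
         (\<Sum>i<n. \<Sum>j<n. mpow n (A z) l j i * mpow n (A z) (k - 1 - l) i j)"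
        using mpow_entry_sym by (intro sum.cong) auto
      then show ?thesis using sw[of l "k - 1 - l"] that by simp
    qed
    have tr2: "(\<Sum>i<n. \<Sum>j<n. mpow n (A z) l j j * mpow n (A z) m i i) = (real n)\<^sup>2 * (ntr n (A z) l * ntr n (A z) m)" for l m
      using sum_mpow_prod[OF n_pos, of "A z" l m] by (subst sum.swap) simp
    have "(\<Sum>i<n. \<Sum>j<n. D z i j) = s\<^sup>2 / real n * (\<Sum>l<k. \<Sum>i<n. \<Sum>j<n.
        mpow n (A z) l j i * mpow n (A z) (k - 1 - l) j i + mpow n (A z) l j j * mpow n (A z) (k - 1 - l) i i)"
      unfolding D_def sum_distrib_left[symmetric]
      by (subst sum.swap[of _ "{..<n}" "{..<k}"], subst sum.swap[of _ "{..<n}" "{..<k}"]) simp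
    also have "\<dots> = s\<^sup>2 / real n * (\<Sum>l<k. real n * ntr n (A z) (k - 1) + (real n)\<^sup>2 * (ntr n (A z) l * ntr n (A z) (k - 1 - l)))"
      using tr1 tr2 by (intro arg_cong2[where f = "(*)"] sum.cong refl) (simp add: sum.distrib)
    also have "\<dots> = s\<^sup>2 * (real k * ntr n (A z) (k - 1)) + s\<^sup>2 * real n * (\<Sum>l<k. ntr n (A z) l * ntr n (A z) (k - 1 - l))"
      using n0 by (simp add: sum.distrib distrib_left sum_distrib_left[symmetric] power2_eq_square)
    finally have D: "(\<Sum>i<n. \<Sum>j<n. D z i j) = s\<^sup>2 * (real k * ntr n (A z) (k - 1)) +
        s\<^sup>2 * real n * (\<Sum>l<k. ntr n (A z) l * ntr n (A z) (k - 1 - l))" .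
    let ?c = "\<lambda>p. 2 * real (ks ! p) * s\<^sup>2 / (real n)\<^sup>2 * ntr_prod n (A z) (take p ks @ drop (Suc p) ks)"
    have "(\<Sum>i<n. \<Sum>j<n. mpow n (A z) k j i * E z i j) =
        (\<Sum>i<n. \<Sum>j<n. \<Sum>p<length ks. ?c p * (mpow n (A z) k j i * mpow n (A z) (ks ! p - 1) i j))"
      unfolding E_def by (simp add: sum_distrib_left mult_ac)
    also have "\<dots> = (\<Sum>p<length ks. \<Sum>i<n. \<Sum>j<n. ?c p * (mpow n (A z) k j i * mpow n (A z) (ks ! p - 1) i j))"
      by (subst sum.swap[of _ "{..<n}" "{..<length ks}"], subst sum.swap[of _ "{..<n}" "{..<length ks}"]) simp
    also have "\<dots> = (\<Sum>p<length ks. ?c p * (real n * ntr n (A z) (k + (ks ! p - 1))))"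
      by (simp only: sum_distrib_left[symmetric] sw)
    finally have E: "(\<Sum>i<n. \<Sum>j<n. mpow n (A z) k j i * E z i j) =
        (\<Sum>p<length ks. ?c p * (real n * ntr n (A z) (k + (ks ! p - 1))))" .
    have "1 / real n * (\<Sum>i<n. \<Sum>j<n. F' i j z) = 1 / real n * ((\<Sum>i<n. \<Sum>j<n. D z i j) * ntr_prod n (A z) ks) +
        1 / real n * (\<Sum>i<n. \<Sum>j<n. mpow n (A z) k j i * E z i j)"
      unfolding F'_def by (simp only: sum.distrib sum_distrib_right distrib_left)
    also have "1 / real n * ((\<Sum>i<n. \<Sum>j<n. D z i j) * ntr_prod n (A z) ks) =
        s\<^sup>2 * (\<Sum>l<k. ntr_prod n (A z) (l # (k - 1 - l) # ks)) + s\<^sup>2 * real k / real n * ntr_prod n (A z) ((k - 1) # ks)"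
    proof -
      have "(\<Sum>l<k. ntr_prod n (A z) (l # (k - 1 - l) # ks)) = (\<Sum>l<k. ntr n (A z) l * ntr n (A z) (k - 1 - l)) * ntr_prod n (A z) ks"
        by (simp only: ntr_prod_simps sum_distrib_right mult.assoc)
      then show ?thesis
        unfolding D using n0 by (simp add: field_simps)
    qed
    also have "1 / real n * (\<Sum>i<n. \<Sum>j<n. mpow n (A z) k j i * E z i j) =
        2 * s\<^sup>2 / (real n)\<^sup>2 * (\<Sum>p<length ks. real (ks ! p) *
        ntr_prod n (A z) ((k + (ks ! p - 1)) # take p ks @ drop (Suc p) ks))"
      unfolding E sum_distrib_left using n0 by (intro sum.cong) (auto simp: field_simps)
    finally show "1 / real n * (\<Sum>i<n. \<Sum>j<n. F' i j z) = ?R z" .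
  qed
  also have "expectation (\<lambda>z. ?R z) = s\<^sup>2 * (\<Sum>l<k. expectation (\<lambda>z. ntr_prod n (A z) (l # (k - 1 - l) # ks))) +
     s\<^sup>2 * real k / real n * expectation (\<lambda>z. ntr_prod n (A z) ((k - 1) # ks)) +
     2 * s\<^sup>2 / (real n)\<^sup>2 * (\<Sum>p<length ks. real (ks ! p) *
       expectation (\<lambda>z. ntr_prod n (A z) ((k + (ks ! p - 1)) # take p ks @ drop (Suc p) ks)))"
    using integrable_ntr_prod by (simp del: ntr_prod_simps)
  finally show ?thesis .
qed

end

section \<open>Large-n asymptotics of trace products\<close>

fun sc_moment :: "nat \<Rightarrow> real" where
  "sc_moment 0 = 1"
| "sc_moment (Suc k) = (\<Sum>l<k. sc_moment l * sc_moment (k - 1 - l))"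

text \<open>For s = 1 this solves the loop equation without its terms in 1/n and 1/n^2: the
  recursion of \<open>sc_moment\<close> is the surviving sum over l.\<close>

definition sc_prod :: "nat list \<Rightarrow> real" where
  "sc_prod ks = (\<Prod>k\<leftarrow>ks. sc_moment k)"

lemma sc_prod_simps [simp]: "sc_prod [] = 1" "sc_prod (k # ks) = sc_moment k * sc_prod ks"
  by (simp_all add: sc_prod_def)

text \<open>The constant depends neither on \<open>n\<close>, nor on \<open>s\<close>, nor on the probability space; the type argument
  only fixes the type of sample points.\<close>

definition ntr_prod_bound :: "'w itself \<Rightarrow> nat list \<Rightarrow> real \<Rightarrow> bool" where
  "ntr_prod_bound _ ks C \<longleftrightarrow> 0 \<le> C \<and> (\<forall>(M :: 'w measure) n s A. goe M n s A \<and> 0 \<le> s \<longrightarrow>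
     \<bar>(\<integral>z. ntr_prod n (A z) ks \<partial>M) - s ^ sum_list ks * sc_prod ks\<bar> \<le> C * s ^ sum_list ks / real n)"

text \<open>Every trace product on the right of the loop equation has degree lower by two, matching
  the factor s^2. The first sum must be known up to 1/n; the other terms carry 1/n already, so
  boundedness suffices for them. Their premises are restricted to k > 0 and to
  \<open>0 < ks ! p\<close>, since otherwise the coefficient vanishes and truncated subtraction
  would spoil the degree count.\<close>

lemma ntr_prod_bound_Suc:
  fixes T :: "'w itself"
  assumes C1: "\<And>l. l < k \<Longrightarrow> ntr_prod_bound T (l # (k - 1 - l) # ks) (C1 l)"
    and C2: "0 < k \<Longrightarrow> ntr_prod_bound T ((k - 1) # ks) C2"
    and C3: "\<And>p. p < length ks \<Longrightarrow> 0 < ks ! p \<Longrightarrow>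
      ntr_prod_bound T ((k + (ks ! p - 1)) # take p ks @ drop (Suc p) ks) (C3 p)"
  shows "\<exists>C. ntr_prod_bound T (Suc k # ks) C"
proof -
  define S where "S = sum_list (Suc k # ks)"
  define Q where "Q p = (k + (ks ! p - 1)) # take p ks @ drop (Suc p) ks" for p
  \<comment> \<open>Absolute values, because \<open>C2\<close> and \<open>C3 p\<close> are arbitrary
    reals where their premises do not apply.\<close>
  define D2 where "D2 = real k * (\<bar>C2\<bar> + \<bar>sc_prod ((k - 1) # ks)\<bar>)"
  define D3 where "D3 = (\<Sum>p<length ks. real (ks ! p) * (\<bar>C3 p\<bar> + \<bar>sc_prod (Q p)\<bar>))"
  define C where "C = (\<Sum>l<k. C1 l) + D2 + 2 * D3"
  have D23: "D2 \<ge> 0" "D3 \<ge> 0"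
    unfolding D2_def D3_def by (auto intro!: sum_nonneg)
  have C1_pos: "(\<Sum>l<k. C1 l) \<ge> 0"
    using C1 by (intro sum_nonneg) (auto simp: ntr_prod_bound_def)
  have "\<bar>(\<integral>z. ntr_prod n (A z) (Suc k # ks) \<partial>M) - s ^ S * sc_prod (Suc k # ks)\<bar> \<le> C * s ^ S / real n"
    if "goe M n s A" "0 \<le> s" for M :: "'w measure" and n s A
  proof -
    interpret goe M n s A by fact
    define E where "E ks = expectation (\<lambda>z. ntr_prod n (A z) ks)" for ks
    have n1: "real n \<ge> 1" using n_pos by simp
    have E: "\<bar>E xs - s ^ sum_list xs * sc_prod xs\<bar> \<le> c * s ^ sum_list xs / real n" if "ntr_prod_bound T xs c" for xs c
      using that \<open>goe M n s A\<close> \<open>0 \<le> s\<close> unfolding ntr_prod_bound_def E_def by blast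
    have E': "\<bar>E xs\<bar> \<le> (\<bar>c\<bar> + \<bar>sc_prod xs\<bar>) * s ^ sum_list xs" if "ntr_prod_bound T xs c" for xs c
    proof -
      have "c \<ge> 0" using that by (simp add: ntr_prod_bound_def)
      then have "c * s ^ sum_list xs / real n \<le> c * s ^ sum_list xs / 1"
        using n1 \<open>0 \<le> s\<close> by (intro divide_left_mono) auto
      then have "\<bar>E xs\<bar> \<le> c * s ^ sum_list xs + \<bar>s ^ sum_list xs * sc_prod xs\<bar>"
        using E[OF that] by linarith
      also have "\<bar>s ^ sum_list xs * sc_prod xs\<bar> = s ^ sum_list xs * \<bar>sc_prod xs\<bar>"
        using \<open>0 \<le> s\<close> by (simp add: abs_mult)
      finally show ?thesis using \<open>c \<ge> 0\<close> by (simp add: algebra_simps)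
    qed
    have t1: "\<bar>s\<^sup>2 * E (l # (k - 1 - l) # ks) - s ^ S * (sc_moment l * sc_moment (k - 1 - l) * sc_prod ks)\<bar>
        \<le> C1 l * s ^ S / real n" if "l < k" for l
    proof -
      have S: "S = 2 + sum_list (l # (k - 1 - l) # ks)" using that by (simp add: S_def)
      have "s\<^sup>2 * E (l # (k - 1 - l) # ks) - s ^ S * (sc_moment l * sc_moment (k - 1 - l) * sc_prod ks) =
          s\<^sup>2 * (E (l # (k - 1 - l) # ks) - s ^ sum_list (l # (k - 1 - l) # ks) * sc_prod (l # (k - 1 - l) # ks))"
        unfolding S power_add by (simp add: algebra_simps)
      then show ?thesis
        using mult_left_mono[OF E[OF C1[OF that]], of "s\<^sup>2"]
        unfolding S power_add by (simp add: abs_mult mult_ac)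
    qed
    have t2: "\<bar>s\<^sup>2 * real k / real n * E ((k - 1) # ks)\<bar> \<le> D2 * s ^ S / real n"
    proof (cases "k = 0")
      case False
      then have S: "S = 2 + sum_list ((k - 1) # ks)" by (simp add: S_def)
      have "s\<^sup>2 * real k / real n * \<bar>E ((k - 1) # ks)\<bar> \<le>
          s\<^sup>2 * real k / real n * ((\<bar>C2\<bar> + \<bar>sc_prod ((k - 1) # ks)\<bar>) * s ^ sum_list ((k - 1) # ks))"
        using False C2 by (intro mult_left_mono E') auto
      then show ?thesis
        unfolding S power_add D2_def by (simp add: abs_mult mult_ac)
    qed (simp add: D2_def)
    have t3: "\<bar>2 * s\<^sup>2 / (real n)\<^sup>2 * (\<Sum>p<length ks. real (ks ! p) * E (Q p))\<bar> \<le> 2 * D3 * s ^ S / real n"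
    proof -
      have "s\<^sup>2 * (real (ks ! p) * \<bar>E (Q p)\<bar>) \<le> real (ks ! p) * (\<bar>C3 p\<bar> + \<bar>sc_prod (Q p)\<bar>) * s ^ S" if p: "p < length ks" for p
      proof (cases "ks ! p = 0")
        case False
        have "sum_list ks = sum_list (take p ks) + ks ! p + sum_list (drop (Suc p) ks)"
          using id_take_nth_drop[OF p] by (metis add.assoc sum_list.Cons sum_list_append)
        then have S: "S = 2 + sum_list (Q p)" using False by (simp add: S_def Q_def)
        have "\<bar>E (Q p)\<bar> \<le> (\<bar>C3 p\<bar> + \<bar>sc_prod (Q p)\<bar>) * s ^ sum_list (Q p)"
          using False C3[OF p] unfolding Q_def by (intro E') auto
        from mult_left_mono[OF this, of "s\<^sup>2 * real (ks ! p)"] show ?thesis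
          unfolding S power_add by (simp add: mult_ac)
      qed simp
      then have "s\<^sup>2 * (\<Sum>p<length ks. real (ks ! p) * \<bar>E (Q p)\<bar>) \<le> D3 * s ^ S"
        unfolding D3_def sum_distrib_left sum_distrib_right by (intro sum_mono) auto
      moreover have "\<bar>\<Sum>p<length ks. real (ks ! p) * E (Q p)\<bar> \<le> (\<Sum>p<length ks. real (ks ! p) * \<bar>E (Q p)\<bar>)"
        by (rule order_trans[OF sum_abs]) (simp add: abs_mult)
      ultimately have "s\<^sup>2 * \<bar>\<Sum>p<length ks. real (ks ! p) * E (Q p)\<bar> \<le> D3 * s ^ S"
        by (meson mult_left_mono order_trans zero_le_power2)
      then have "2 / (real n)\<^sup>2 * (s\<^sup>2 * \<bar>\<Sum>p<length ks. real (ks ! p) * E (Q p)\<bar>) \<le> 2 / (real n)\<^sup>2 * (D3 * s ^ S)"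
        by (intro mult_left_mono) auto
      \<comment> \<open>One factor 1/n is given away here, since the preceding terms are of order
        1/n anyway.\<close>
      also have "\<dots> \<le> 2 / real n * (D3 * s ^ S)"
        using n1 D23 \<open>0 \<le> s\<close> by (intro mult_right_mono divide_left_mono) (auto simp: self_le_power)
      finally show ?thesis by (simp add: abs_mult mult_ac)
    qed
    have "E (Suc k # ks) - s ^ S * sc_prod (Suc k # ks) =
        (\<Sum>l<k. s\<^sup>2 * E (l # (k - 1 - l) # ks) - s ^ S * (sc_moment l * sc_moment (k - 1 - l) * sc_prod ks)) +
        s\<^sup>2 * real k / real n * E ((k - 1) # ks) +
        2 * s\<^sup>2 / (real n)\<^sup>2 * (\<Sum>p<length ks. real (ks ! p) * E (Q p))"
      unfolding E_def loop_equation Q_def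
      by (simp add: sum_subtractf sum_distrib_left sum_distrib_right del: ntr_prod_simps)
    moreover have "\<bar>\<Sum>l<k. s\<^sup>2 * E (l # (k - 1 - l) # ks) - s ^ S * (sc_moment l * sc_moment (k - 1 - l) * sc_prod ks)\<bar>
        \<le> (\<Sum>l<k. C1 l) * s ^ S / real n"
      unfolding sum_distrib_right sum_divide_distrib
      by (rule order_trans[OF sum_abs]) (intro sum_mono t1, simp)
    moreover have "\<bar>x + y + z\<bar> \<le> x' + y' + z'" if "\<bar>x\<bar> \<le> x'" "\<bar>y\<bar> \<le> y'" "\<bar>z\<bar> \<le> z'" for x y z x' y' z' :: real
      using that by linarith
    ultimately have "\<bar>E (Suc k # ks) - s ^ S * sc_prod (Suc k # ks)\<bar> \<le>
      (\<Sum>l<k. C1 l) * s ^ S / real n + D2 * s ^ S / real n + 2 * D3 * s ^ S / real n"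
      using t2 t3 by presburger
    then show ?thesis
      unfolding E_def C_def by (simp add: add_divide_distrib distrib_right)
  qed
  then have "ntr_prod_bound T (Suc k # ks) C"
    using D23 C1_pos unfolding ntr_prod_bound_def S_def C_def by auto
  then show ?thesis ..
qed

text \<open>The degree alone does not decrease: discarding a leading 0 keeps it and only shortens
  the list. Splitting a trace in two lengthens the list by one but lowers the degree by two, so the
  sum of degree and length decreases in all cases.\<close>

lemma ex_ntr_prod_bound: "\<exists>C. ntr_prod_bound T ks C"
proof (induction "sum_list ks + length ks" arbitrary: ks rule: less_induct)
  case less
  show ?case
  proof (cases ks)
    case Nil
    have "(\<integral>z. 1 \<partial>M) = (1 :: real)" if "goe M n s A" for M :: "'a measure" and n s A
    proof -
      interpret goe M n s A by fact
      show ?thesis by (simp add: prob_space)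
    qed
    then have "ntr_prod_bound T ks 0"
      unfolding ntr_prod_bound_def Nil by auto
    then show ?thesis ..
  next
    case (Cons k' ks')
    show ?thesis
    proof (cases k')
      case 0
      then obtain C where "ntr_prod_bound T ks' C"
        using less[of ks'] Cons by auto
      then have "ntr_prod_bound T ks C"
        unfolding ntr_prod_bound_def Cons 0 using goe.n_pos by fastforce
      then show ?thesis ..
    next
      case (Suc k)
      have "\<exists>C. \<forall>l<k. ntr_prod_bound T (l # (k - 1 - l) # ks') (C l)"
        using less Cons Suc by (intro choice_iff'[THEN iffD1] allI impI) auto
      moreover have "\<exists>C. 0 < k \<longrightarrow> ntr_prod_bound T ((k - 1) # ks') C"
        using less[of "(k - 1) # ks'"] Cons Suc by auto
      moreover have "\<exists>C. \<forall>p. p < length ks' \<and> 0 < ks' ! p \<longrightarrow>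
          ntr_prod_bound T ((k + (ks' ! p - 1)) # take p ks' @ drop (Suc p) ks') (C p)"
      proof (intro choice_iff'[THEN iffD1] allI impI, elim conjE)
        fix p assume p: "p < length ks'" "0 < ks' ! p"
        have "sum_list ks' = sum_list (take p ks') + ks' ! p + sum_list (drop (Suc p) ks')"
          using id_take_nth_drop[OF p(1)] by (metis add.assoc sum_list.Cons sum_list_append)
        then show "\<exists>C. ntr_prod_bound T ((k + (ks' ! p - 1)) # take p ks' @ drop (Suc p) ks') C"
          using p Cons Suc by (intro less) auto
      qed
      ultimately show ?thesis
        unfolding Cons Suc using ntr_prod_bound_Suc[of k T ks'] by metis
    qed
  qed
qed

lemma goe_second_moment:
  "\<exists>C\<ge>0. \<forall>(M :: 'w measure) n s A. goe M n s A \<and> 0 \<le> s \<longrightarrow>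
     integrable M (\<lambda>z. (ntr n (A z) k)\<^sup>2) \<and> (\<integral>z. (ntr n (A z) k)\<^sup>2 \<partial>M) \<le> C * s ^ (2 * k)"
proof -
  obtain C where C: "ntr_prod_bound TYPE('w) [k, k] C"
    using ex_ntr_prod_bound by blast
  then have "C \<ge> 0" by (simp add: ntr_prod_bound_def)
  have "integrable M (\<lambda>z. (ntr n (A z) k)\<^sup>2) \<and>
      (\<integral>z. (ntr n (A z) k)\<^sup>2 \<partial>M) \<le> (C + \<bar>sc_prod [k, k]\<bar>) * s ^ (2 * k)"
    if "goe M n s A" "0 \<le> s" for M :: "'w measure" and n s A
  proof -
    interpret goe M n s A by fact
    have "C * s ^ (2 * k) / real n \<le> C * s ^ (2 * k) / 1"
      using n_pos \<open>C \<ge> 0\<close> \<open>0 \<le> s\<close> by (intro divide_left_mono) auto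
    moreover have "\<bar>expectation (\<lambda>z. ntr_prod n (A z) [k, k]) - s ^ (2 * k) * sc_prod [k, k]\<bar> \<le> C * s ^ (2 * k) / real n"
      using C that unfolding ntr_prod_bound_def by (auto simp: mult_2)
    moreover have "s ^ (2 * k) * sc_prod [k, k] \<le> s ^ (2 * k) * \<bar>sc_prod [k, k]\<bar>"
      using \<open>0 \<le> s\<close> by (intro mult_left_mono) auto
    moreover have "x \<le> c + z" if "y \<le> c / 1" "\<bar>x - w\<bar> \<le> y" "w \<le> z" for x y z w c :: real
      using that by linarith
    ultimately have "expectation (\<lambda>z. ntr_prod n (A z) [k, k]) \<le> C * s ^ (2 * k) + s ^ (2 * k) * \<bar>sc_prod [k, k]\<bar>"
      by blast
    also have "\<dots> = (C + \<bar>sc_prod [k, k]\<bar>) * s ^ (2 * k)"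
      by (simp only: distrib_right mult.commute[of "s ^ _"])
    finally have "expectation (\<lambda>z. ntr_prod n (A z) [k, k]) \<le> (C + \<bar>sc_prod [k, k]\<bar>) * s ^ (2 * k)" .
    then show ?thesis
      using integrable_ntr_prod[of "[k, k]"] by (simp add: power2_eq_square)
  qed
  then show ?thesis
    using \<open>C \<ge> 0\<close> by (intro exI[of _ "C + \<bar>sc_prod [k, k]\<bar>"]) auto
qed

text \<open>When the square is expanded, the limits cancel and only the errors of the trace products
  \<open>[k, k]\<close> and \<open>[k]\<close> remain, both of order 1/n.\<close>

lemma goe_variance:
  "\<exists>C\<ge>0. \<forall>(M :: 'w measure) n s A. goe M n s A \<and> 0 \<le> s \<longrightarrow>
     (\<integral>z. (ntr n (A z) k - s ^ k * sc_moment k)\<^sup>2 \<partial>M) \<le> C * s ^ (2 * k) / real n"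
proof -
  obtain C1 C2 where C: "ntr_prod_bound TYPE('w) [k, k] C1" "ntr_prod_bound TYPE('w) [k] C2"
    using ex_ntr_prod_bound by meson
  then have C_nonneg: "C1 \<ge> 0" "C2 \<ge> 0" by (auto simp: ntr_prod_bound_def)
  define m where "m = sc_moment k"
  have "(\<integral>z. (ntr n (A z) k - s ^ k * m)\<^sup>2 \<partial>M) \<le> (C1 + 2 * \<bar>m\<bar> * C2) * s ^ (2 * k) / real n"
    if "goe M n s A" "0 \<le> s" for M :: "'w measure" and n s A
  proof -
    interpret goe M n s A by fact
    let ?t = "\<lambda>z. ntr n (A z) k"
    have s2: "s ^ (2 * k) = s ^ k * s ^ k"
      by (simp add: mult_2 power_add)
    define e1 where "e1 = expectation (\<lambda>z. ntr_prod n (A z) [k, k]) - s ^ (2 * k) * m\<^sup>2"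
    define e2 where "e2 = expectation (\<lambda>z. ntr_prod n (A z) [k]) - s ^ k * m"
    have e1: "\<bar>e1\<bar> \<le> C1 * s ^ (2 * k) / real n"
      using C(1) that unfolding ntr_prod_bound_def e1_def m_def by (auto simp: mult_2 power2_eq_square)
    have e2: "\<bar>e2\<bar> \<le> C2 * s ^ k / real n"
      using C(2) that unfolding ntr_prod_bound_def e2_def m_def by auto
    have "expectation (\<lambda>z. (?t z - s ^ k * m)\<^sup>2) =
        expectation (\<lambda>z. ntr_prod n (A z) [k, k] - 2 * (s ^ k * m) * ntr_prod n (A z) [k] + (s ^ k * m)\<^sup>2)"
      by (intro Bochner_Integration.integral_cong) (auto simp: power2_eq_square algebra_simps)
    also have "\<dots> = expectation (\<lambda>z. ntr_prod n (A z) [k, k]) - 2 * (s ^ k * m) * expectation (\<lambda>z. ntr_prod n (A z) [k]) + (s ^ k * m)\<^sup>2"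
      using integrable_ntr_prod by (simp add: prob_space del: ntr_prod_simps)
    also have "\<dots> = e1 - 2 * (s ^ k * m) * e2"
      unfolding e1_def e2_def s2 by (simp add: power2_eq_square algebra_simps del: ntr_prod_simps)
    also have "\<dots> \<le> \<bar>e1\<bar> + 2 * (s ^ k * \<bar>m\<bar>) * \<bar>e2\<bar>"
    proof -
      have "\<bar>2 * (s ^ k * m) * e2\<bar> = 2 * (s ^ k * \<bar>m\<bar>) * \<bar>e2\<bar>"
        using \<open>0 \<le> s\<close> by (simp add: abs_mult)
      then show ?thesis by linarith
    qed
    also have "\<dots> \<le> C1 * s ^ (2 * k) / real n + 2 * (s ^ k * \<bar>m\<bar>) * (C2 * s ^ k / real n)"
      using e1 e2 \<open>0 \<le> s\<close> by (intro add_mono mult_left_mono) auto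
    also have "\<dots> = (C1 + 2 * \<bar>m\<bar> * C2) * s ^ (2 * k) / real n"
      unfolding s2 by (simp add: algebra_simps add_divide_distrib)
    finally show ?thesis .
  qed
  then show ?thesis
    using C_nonneg unfolding m_def by (intro exI[of _ "C1 + 2 * \<bar>sc_moment k\<bar> * C2"]) auto
qed

section \<open>Comparison of the traces of two symmetric matrices\<close>

lemma sum_rotate3:
  "(\<Sum>a\<in>A. \<Sum>b\<in>B. \<Sum>c\<in>C. f a b c) = (\<Sum>b\<in>B. \<Sum>c\<in>C. \<Sum>a\<in>A. f a b c)"
  by (subst sum.swap) (rule sum.cong[OF refl], rule sum.swap)

lemma sum_rotate4:
  "(\<Sum>a\<in>A. \<Sum>b\<in>B. \<Sum>c\<in>C. \<Sum>d\<in>D. f a b c d) = (\<Sum>b\<in>B. \<Sum>c\<in>C. \<Sum>d\<in>D. \<Sum>a\<in>A. f a b c d)"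
  by (subst sum.swap) (rule sum.cong[OF refl], rule sum_rotate3)

text \<open>Telescoping along the words a^l b^(k - l), of which consecutive ones differ in a single
  factor.\<close>

lemma mpow_diff:
  assumes "i < n"
  shows "mpow n a k i j - mpow n b k i j =
    (\<Sum>l<k. \<Sum>p<n. \<Sum>q<n. mpow n a l i p * ((a p q - b p q) * mpow n b (k - 1 - l) q j))"
  using assms
proof (induction k arbitrary: i)
  case (Suc k)
  define f where "f l = (\<Sum>p<n. \<Sum>q<n. mpow n a l i p * ((a p q - b p q) * mpow n b (k - l) q j))" for l
  have "mpow n a (Suc k) i j - mpow n b (Suc k) i j =
      (\<Sum>q<n. (a i q - b i q) * mpow n b k q j) + (\<Sum>c<n. a i c * (mpow n a k c j - mpow n b k c j))"
    by (simp add: sum.distrib[symmetric] sum_subtractf[symmetric] algebra_simps)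
  also have "(\<Sum>q<n. (a i q - b i q) * mpow n b k q j) = f 0"
    unfolding f_def mpow.simps(1) sum_distrib_left[symmetric] using Suc.prems
    by (simp add: sum_of_bool_lessThan)
  also have "(\<Sum>c<n. a i c * (mpow n a k c j - mpow n b k c j)) = (\<Sum>c<n. \<Sum>l<k. \<Sum>p<n.
      a i c * mpow n a l c p * (\<Sum>q<n. (a p q - b p q) * mpow n b (k - 1 - l) q j))"
    using Suc.IH by (simp add: sum_distrib_left mult.assoc)
  also have "\<dots> = (\<Sum>l<k. \<Sum>p<n. \<Sum>c<n.
      a i c * mpow n a l c p * (\<Sum>q<n. (a p q - b p q) * mpow n b (k - 1 - l) q j))"
    by (rule sum_rotate3)
  also have "\<dots> = (\<Sum>l<k. f (Suc l))"
    unfolding f_def sum_distrib_right[symmetric] sum_distrib_left[symmetric] mpow.simps(2)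
    by (simp only: diff_Suc_eq_diff_pred)
  finally show ?case
    unfolding f_def sum.lessThan_Suc_shift[symmetric] diff_Suc_1
    by (simp add: sum.lessThan_Suc_shift del: sum.lessThan_Suc mpow.simps(2))
qed simp

text \<open>This turns squared Hilbert-Schmidt norms into even traces, which is how bounds by
  Cauchy-Schwarz lead back to moments.\<close>

lemma sum_mpow_squares:
  assumes "\<And>i j. a i j = a j i" "n \<ge> 1"
  shows "(\<Sum>i<n. \<Sum>j<n. (mpow n a k i j)\<^sup>2) = real n * ntr n a (2 * k)"
proof -
  have "(\<Sum>i<n. \<Sum>j<n. (mpow n a k i j)\<^sup>2) = (\<Sum>i<n. \<Sum>j<n. mpow n a k i j * mpow n a k j i)"
    using mpow_sym[of a, OF assms(1)] by (intro sum.cong) (auto simp: power2_eq_square)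
  then show ?thesis
    using ntr_mult[OF assms(2), of a k k] by (simp add: mult_2)
qed

lemma ntr_even_nonneg:
  assumes "\<And>i j. a i j = a j i" "n \<ge> 1"
  shows "0 \<le> ntr n a (2 * k)"
proof -
  have "0 \<le> real n * ntr n a (2 * k)"
    unfolding sum_mpow_squares[OF assms, symmetric] by (intro sum_nonneg) auto
  then show ?thesis using assms(2) by (simp add: zero_le_mult_iff)
qed

lemma double_sum_Cauchy_Schwarz:
  fixes f g :: "nat \<Rightarrow> nat \<Rightarrow> real"
  shows "(\<Sum>p<n. \<Sum>q<n. f p q * g p q)\<^sup>2 \<le> (\<Sum>p<n. \<Sum>q<n. (f p q)\<^sup>2) * (\<Sum>p<n. \<Sum>q<n. (g p q)\<^sup>2)"
  using Cauchy_Schwarz_ineq_sum[of "\<lambda>(p, q). f p q" "\<lambda>(p, q). g p q" "{..<n} \<times> {..<n}"]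
  by (simp add: sum.cartesian_product case_prod_unfold)

text \<open>The trace of the l-th telescoping term is the Hilbert-Schmidt inner product of a - b
  with \<open>W l\<close>, the transpose of b^(k - 1 - l) a^l. Cauchy-Schwarz splits off the norm of
  a - b, and the squared norm of \<open>W l\<close> is the trace of a^(2 l) b^(2 (k - 1 - l)),
  bounded by the mean of two traces of fourth powers. Cauchy-Schwarz over l costs the factor
  k.\<close>

lemma ntr_diff_le:
  assumes a: "\<And>i j. a i j = a j i" and b: "\<And>i j. b i j = b j i" and n: "n \<ge> 1"
  shows "(ntr n a k - ntr n b k)\<^sup>2 \<le> real k * (\<Sum>l<k. ntr n (\<lambda>i j. a i j - b i j) 2 *
    (ntr n a (4 * l) + ntr n b (4 * (k - 1 - l))) / 2)"
proof -
  define d where "d i j = a i j - b i j" for i j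
  define W where "W l p q = (\<Sum>i<n. mpow n b (k - 1 - l) q i * mpow n a l i p)" for l p q
  define X where "X l = (\<Sum>p<n. \<Sum>q<n. d p q * W l p q)" for l
  have d: "d i j = d j i" for i j using a b by (simp add: d_def)
  have d2: "(\<Sum>p<n. \<Sum>q<n. (d p q)\<^sup>2) = real n * ntr n d 2"
    using sum_mpow_squares[of d n 1, OF d n] by (simp add: sum_of_bool_lessThan)
  have "real n * ntr n a k - real n * ntr n b k = (\<Sum>i<n. mpow n a k i i - mpow n b k i i)"
    using n by (simp add: ntr_def sum_subtractf)
  also have "\<dots> = (\<Sum>i<n. \<Sum>l<k. \<Sum>p<n. \<Sum>q<n. mpow n a l i p * (d p q * mpow n b (k - 1 - l) q i))"
    unfolding d_def by (intro sum.cong refl mpow_diff) simp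
  also have "\<dots> = (\<Sum>l<k. X l)"
    unfolding X_def W_def sum_distrib_left
    by (subst sum_rotate4) (simp only: mult_ac)
  finally have diff: "ntr n a k - ntr n b k = (\<Sum>l<k. X l / real n)"
    using n by (simp add: sum_divide_distrib[symmetric] field_simps)
  have W2: "(\<Sum>p<n. \<Sum>q<n. (W l p q)\<^sup>2) \<le> real n * ((ntr n a (4 * l) + ntr n b (4 * (k - 1 - l))) / 2)" for l
  proof -
    define j where "j = k - 1 - l"
    have "(\<Sum>p<n. \<Sum>q<n. (W l p q)\<^sup>2) = (\<Sum>p<n. \<Sum>q<n. \<Sum>i<n. \<Sum>i'<n.
        (mpow n b j q i * mpow n a l i p) * (mpow n b j q i' * mpow n a l i' p))"
      unfolding W_def j_def power2_eq_square sum_product ..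
    also have "\<dots> = (\<Sum>i<n. \<Sum>i'<n. \<Sum>p<n. \<Sum>q<n.
        (mpow n a l i p * mpow n a l i' p) * (mpow n b j q i * mpow n b j q i'))"
      by (subst sum_rotate4, subst sum_rotate4) (simp only: mult_ac)
    also have "\<dots> = (\<Sum>i<n. \<Sum>i'<n. (\<Sum>p<n. mpow n a l i p * mpow n a l p i') * (\<Sum>q<n. mpow n b j i q * mpow n b j q i'))"
      unfolding sum_product
      by (intro sum.cong refl) (simp add: mpow_sym[of a, OF a] mpow_sym[of b, OF b])
    also have "\<dots> = (\<Sum>i<n. \<Sum>i'<n. mpow n a (2 * l) i i' * mpow n b (2 * j) i i')"
      by (intro sum.cong refl) (simp add: mult_2 mpow_add)
    also have "\<dots> \<le> (\<Sum>i<n. \<Sum>i'<n. ((mpow n a (2 * l) i i')\<^sup>2 + (mpow n b (2 * j) i i')\<^sup>2) / 2)"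
    proof (intro sum_mono)
      fix i i'
      have "x * y \<le> (x\<^sup>2 + y\<^sup>2) / 2" for x y :: real
        using sum_squares_bound[of x y] by (simp add: field_simps)
      then show "mpow n a (2 * l) i i' * mpow n b (2 * j) i i' \<le> ((mpow n a (2 * l) i i')\<^sup>2 + (mpow n b (2 * j) i i')\<^sup>2) / 2" .
    qed
    also have "\<dots> = ((\<Sum>i<n. \<Sum>i'<n. (mpow n a (2 * l) i i')\<^sup>2) + (\<Sum>i<n. \<Sum>i'<n. (mpow n b (2 * j) i i')\<^sup>2)) / 2"
      by (simp only: sum.distrib sum_divide_distrib[symmetric])
    also have "\<dots> = real n * ((ntr n a (4 * l) + ntr n b (4 * j)) / 2)"
      using sum_mpow_squares[of a n "2 * l", OF a n] sum_mpow_squares[of b n "2 * j", OF b n] by (simp add: algebra_simps)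
    finally show ?thesis by (simp only: j_def)
  qed
  have X: "(X l / real n)\<^sup>2 \<le> ntr n d 2 * (ntr n a (4 * l) + ntr n b (4 * (k - 1 - l))) / 2" for l
  proof -
    have "(X l)\<^sup>2 \<le> (real n * ntr n d 2) * (\<Sum>p<n. \<Sum>q<n. (W l p q)\<^sup>2)"
      unfolding X_def d2[symmetric] by (rule double_sum_Cauchy_Schwarz)
    also have "\<dots> \<le> (real n * ntr n d 2) * (real n * ((ntr n a (4 * l) + ntr n b (4 * (k - 1 - l))) / 2))"
      using ntr_even_nonneg[of d n 1, OF d n] by (intro mult_left_mono W2) auto
    finally have "(X l)\<^sup>2 / (real n)\<^sup>2 \<le> ntr n d 2 * (ntr n a (4 * l) + ntr n b (4 * (k - 1 - l))) / 2"
      using n by (simp add: divide_le_eq power2_eq_square mult_ac)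
    then show ?thesis by (simp add: power_divide)
  qed
  have "(\<Sum>l<k. X l / real n)\<^sup>2 \<le> (\<Sum>l<k. (X l / real n)\<^sup>2) * (\<Sum>l<k. 1\<^sup>2)"
    using Cauchy_Schwarz_ineq_sum[of "\<lambda>l. X l / real n" "\<lambda>_. 1" "{..<k}"] by simp
  also have "\<dots> = real k * (\<Sum>l<k. (X l / real n)\<^sup>2)"
    by simp
  also have "\<dots> \<le> real k * (\<Sum>l<k. ntr n d 2 * (ntr n a (4 * l) + ntr n b (4 * (k - 1 - l))) / 2)"
    by (intro mult_left_mono sum_mono X) simp
  finally show ?thesis
    unfolding diff d_def[abs_def] .
qed

section \<open>Gaussian matrices with independent entries\<close>

text \<open>Stein's recursion. For m = 0 the factor \<open>real m\<close> absorbs the truncated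
  exponent m - 1. The degenerate law belongs here because the variance vanishes at time 0.\<close>

lemma centered_normal_moments:
  fixes X :: "'w \<Rightarrow> real"
  assumes [measurable]: "X \<in> borel_measurable M" and d: "distr M borel X = centered_normal \<sigma>" and \<sigma>: "0 \<le> \<sigma>"
  shows "integrable M (\<lambda>z. X z ^ m)"
    and "(\<integral>z. X z ^ Suc m \<partial>M) = real m * \<sigma>\<^sup>2 * (\<integral>z. X z ^ (m - 1) \<partial>M)"
proof -
  have I: "integrable M (\<lambda>z. X z ^ m) \<longleftrightarrow> integrable (centered_normal \<sigma>) (\<lambda>x. x ^ m)" for m
    unfolding d[symmetric] by (rule integrable_distr_eq[symmetric]) auto
  have E: "(\<integral>z. X z ^ m \<partial>M) = (\<integral>x. x ^ m \<partial>centered_normal \<sigma>)" for m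
    unfolding d[symmetric] by (rule integral_distr[symmetric]) auto
  have "integrable M (\<lambda>z. X z ^ m) \<and>
    (\<integral>z. X z ^ Suc m \<partial>M) = real m * \<sigma>\<^sup>2 * (\<integral>z. X z ^ (m - 1) \<partial>M)"
  proof (cases "\<sigma> = 0")
    case True
    have "integrable (return borel (0::real)) (\<lambda>x. x ^ m)"
      by (simp add: integrable_iff_bounded nn_integral_return)
    moreover have "(\<integral>x. x ^ Suc m \<partial>return borel (0::real)) = 0"
      by (subst integral_return) auto
    ultimately show ?thesis
      unfolding I E by (simp add: centered_normal_def True)
  next
    case False
    then have pos: "\<sigma> > 0" using \<sigma> by simp
    have cn: "centered_normal \<sigma> = density lborel (\<lambda>x. ennreal (normal_density 0 \<sigma> x))"
      using False by (simp add: centered_normal_def)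
    have nn: "AE x in lborel. 0 \<le> normal_density 0 \<sigma> x" by simp
    have I': "integrable (centered_normal \<sigma>) (\<lambda>x. x ^ m)" for m
      unfolding cn using integrable_normal_moment[OF pos, of 0 m]
      by (subst integrable_density) auto
    have E': "(\<integral>x. x ^ m \<partial>centered_normal \<sigma>) = (\<integral>x. normal_density 0 \<sigma> x * x ^ m \<partial>lborel)" for m
      unfolding cn by (subst integral_density) auto
    have even_m: "(\<integral>x. x ^ (2 * k) \<partial>centered_normal \<sigma>) = fact (2 * k) / ((2 / \<sigma>\<^sup>2) ^ k * fact k)" for k
      unfolding E' using integral_normal_moment_even[OF pos, of 0 k] by simp
    have odd_m: "(\<integral>x. x ^ (2 * k + 1) \<partial>centered_normal \<sigma>) = 0" for k
      unfolding E' using integral_normal_moment_odd[OF pos, of 0 k] by simp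
    have "(\<integral>x. x ^ Suc m \<partial>centered_normal \<sigma>) = real m * \<sigma>\<^sup>2 * (\<integral>x. x ^ (m - 1) \<partial>centered_normal \<sigma>)"
    proof (cases "even m")
      case True
      then obtain k where k: "m = 2 * k" by (rule evenE)
      show ?thesis
      proof (cases k)
        case 0
        then show ?thesis using odd_m[of 0] k by simp
      next
        case (Suc l)
        then have "Suc m = 2 * k + 1" "m - 1 = 2 * l + 1" using k by auto
        then show ?thesis using odd_m by (simp only: mult_zero_right)
      qed
    next
      case False
      then obtain k where k: "m = 2 * k + 1" by (rule oddE)
      then have 1: "Suc m = 2 * Suc k" "m - 1 = 2 * k" by auto
      define K c f F where "K = real k + 1" and "c = (2 / \<sigma>\<^sup>2) ^ k" and "f = (fact k :: real)" and "F = (fact (2 * k) :: real)"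
      have nz: "K \<noteq> 0" "c \<noteq> 0" "f \<noteq> 0" using pos by (auto simp: K_def c_def f_def)
      have f1: "fact (2 * Suc k) = 2 * K * real m * F"
        unfolding F_def K_def k by (simp add: algebra_simps)
      have f2: "(2 / \<sigma>\<^sup>2) ^ Suc k * fact (Suc k) = 2 / \<sigma>\<^sup>2 * c * (K * f)"
        unfolding c_def K_def f_def by (simp add: algebra_simps)
      show ?thesis
        unfolding 1(1) 1(2) even_m f1 f2 c_def[symmetric] f_def[symmetric] F_def[symmetric]
        using pos nz by (simp add: field_simps)
    qed
    then show ?thesis unfolding I E using I' by simp
  qed
  then show "integrable M (\<lambda>z. X z ^ m)"
    and "(\<integral>z. X z ^ Suc m \<partial>M) = real m * \<sigma>\<^sup>2 * (\<integral>z. X z ^ (m - 1) \<partial>M)"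
    by auto
qed

text \<open>Counterpart of \<open>entry_mono_deriv\<close> for independent variables of common
  variance v, where only equal letters are correlated.\<close>

fun monomial_deriv :: "real \<Rightarrow> ('i \<Rightarrow> real) \<Rightarrow> 'i \<Rightarrow> 'i list \<Rightarrow> real" where
  "monomial_deriv v g a [] = 0"
| "monomial_deriv v g a (b # w) = v * of_bool (a = b) * (\<Prod>c\<leftarrow>w. g c) + g b * monomial_deriv v g a w"

lemma prod_list_remove1:
  fixes g :: "'i \<Rightarrow> real"
  shows "a \<in> set w \<Longrightarrow> g a * (\<Prod>c\<leftarrow>remove1 a w. g c) = (\<Prod>c\<leftarrow>w. g c)"
  by (induction w) auto

lemma monomial_deriv_eq: "monomial_deriv v g a w = v * real (count_list w a) * (\<Prod>c\<leftarrow>remove1 a w. g c)"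
proof (induction w)
  case (Cons b w)
  show ?case
  proof (cases "a = b")
    case True
    have "real (count_list w a) * (g a * (\<Prod>c\<leftarrow>remove1 a w. g c)) = real (count_list w a) * (\<Prod>c\<leftarrow>w. g c)"
      using prod_list_remove1[of a w g] by (cases "a \<in> set w") (auto simp: count_list_0_iff)
    then show ?thesis using Cons True by (simp add: algebra_simps)
  qed (use Cons in auto)
qed simp

lemma prod_list_as_prod_count:
  fixes g :: "'i \<Rightarrow> real"
  assumes "finite I" "set w \<subseteq> I"
  shows "(\<Prod>c\<leftarrow>w. g c) = (\<Prod>i\<in>I. g i ^ count_list w i)"
  using assms(2)
proof (induction w)
  case (Cons b w)
  have "(\<Prod>i\<in>I. g i ^ count_list (b # w) i) = (\<Prod>i\<in>I. (if b = i then g i else 1) * g i ^ count_list w i)"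
    by (intro prod.cong) auto
  also have "\<dots> = g b * (\<Prod>i\<in>I. g i ^ count_list w i)"
    using Cons.prems assms(1) by (simp add: prod.distrib prod.delta')
  finally show ?case using Cons by simp
qed simp

text \<open>Independence turns the expectation of a monomial into a product of moments, one per
  variable, and Stein's recursion acts on the power of \<open>g a\<close> alone. Its coefficient
  counts the occurrences of a, which are the letters that Wick's formula pairs with
  \<open>g a\<close>.\<close>

lemma (in prob_space) indep_normal_wick:
  fixes g :: "'i \<Rightarrow> 'a \<Rightarrow> real"
  assumes I: "finite I" and indep: "indep_vars (\<lambda>_. borel) g I"
    and d: "\<And>i. i \<in> I \<Longrightarrow> distr M borel (g i) = centered_normal \<sigma>" and \<sigma>: "0 \<le> \<sigma>"
    and w: "set w \<subseteq> I"
  shows "integrable M (\<lambda>z. \<Prod>c\<leftarrow>w. g c z)"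
    and "a \<in> I \<Longrightarrow> expectation (\<lambda>z. g a z * (\<Prod>c\<leftarrow>w. g c z)) = expectation (\<lambda>z. monomial_deriv (\<sigma>\<^sup>2) (\<lambda>i. g i z) a w)"
proof -
  have gm: "g i \<in> borel_measurable M" if "i \<in> I" for i
    using indep that by (auto simp: indep_vars_def)
  note mom = centered_normal_moments[OF gm d \<sigma>]
  have ind: "indep_vars (\<lambda>_. borel) (\<lambda>i z. g i z ^ k i) I" for k
    by (rule indep_vars_compose2[OF indep]) auto
  have int: "integrable M (\<lambda>z. \<Prod>c\<leftarrow>w. g c z)"
    and ex: "expectation (\<lambda>z. \<Prod>c\<leftarrow>w. g c z) = (\<Prod>i\<in>I. expectation (\<lambda>z. g i z ^ count_list w i))"
    if "set w \<subseteq> I" for w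
  proof -
    show "integrable M (\<lambda>z. \<Prod>c\<leftarrow>w. g c z)"
      unfolding prod_list_as_prod_count[OF I that]
      by (rule indep_vars_integrable[OF I ind]) (use mom in auto)
    show "expectation (\<lambda>z. \<Prod>c\<leftarrow>w. g c z) = (\<Prod>i\<in>I. expectation (\<lambda>z. g i z ^ count_list w i))"
      unfolding prod_list_as_prod_count[OF I that]
      by (rule indep_vars_lebesgue_integral[OF I ind]) (use mom in auto)
  qed
  show "integrable M (\<lambda>z. \<Prod>c\<leftarrow>w. g c z)" by (rule int[OF w])
  assume a: "a \<in> I"
  have "expectation (\<lambda>z. g a z * (\<Prod>c\<leftarrow>w. g c z)) = (\<Prod>i\<in>I. expectation (\<lambda>z. g i z ^ count_list (a # w) i))"
    using ex[of "a # w"] a w by simp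
  also have "\<dots> = expectation (\<lambda>z. g a z ^ Suc (count_list w a)) * (\<Prod>i\<in>I - {a}. expectation (\<lambda>z. g i z ^ count_list w i))"
    unfolding prod.remove[OF I a] by (intro arg_cong2[where f = "(*)"] prod.cong) auto
  also have "\<dots> = real (count_list w a) * \<sigma>\<^sup>2 * (expectation (\<lambda>z. g a z ^ (count_list w a - 1)) * (\<Prod>i\<in>I - {a}. expectation (\<lambda>z. g i z ^ count_list w i)))"
    unfolding mom(2)[OF a a] by simp
  also have "expectation (\<lambda>z. g a z ^ (count_list w a - 1)) * (\<Prod>i\<in>I - {a}. expectation (\<lambda>z. g i z ^ count_list w i)) =
      (\<Prod>i\<in>I. expectation (\<lambda>z. g i z ^ count_list (remove1 a w) i))"
  proof -
    have "count_list (remove1 a w) i = (if i = a then count_list w a - 1 else count_list w i)" for i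
      by (induction w) (auto simp: count_list_0_iff Suc_diff_1 gr0_conv_Suc)
    then show ?thesis
      unfolding prod.remove[OF I a, of "\<lambda>i. expectation (\<lambda>z. g i z ^ count_list (remove1 a w) i)"]
      by (intro arg_cong2[where f = "(*)"] prod.cong) auto
  qed
  also have "\<dots> = expectation (\<lambda>z. \<Prod>c\<leftarrow>remove1 a w. g c z)"
    using ex[of "remove1 a w"] w set_remove1_subset[of a w] by simp
  also have "real (count_list w a) * \<sigma>\<^sup>2 * expectation (\<lambda>z. \<Prod>c\<leftarrow>remove1 a w. g c z) =
      expectation (\<lambda>z. monomial_deriv (\<sigma>\<^sup>2) (\<lambda>i. g i z) a w)"
    unfolding monomial_deriv_eq by (simp add: mult.commute)
  finally show "expectation (\<lambda>z. g a z * (\<Prod>c\<leftarrow>w. g c z)) = expectation (\<lambda>z. monomial_deriv (\<sigma>\<^sup>2) (\<lambda>i. g i z) a w)" .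
qed

section \<open>GOE matrices from independent normal variables\<close>

definition sym_entry :: "nat \<Rightarrow> (nat \<Rightarrow> nat \<Rightarrow> real) \<Rightarrow> nat \<Rightarrow> nat \<Rightarrow> real" where
  "sym_entry n g i j = (if i = j then sqrt 2 * g i i else g (min i j) (max i j)) / sqrt (real n)"

definition entry_weight :: "nat \<Rightarrow> nat \<times> nat \<Rightarrow> real" where
  "entry_weight n = (\<lambda>(i, j). (if i = j then sqrt 2 else 1) / sqrt (real n))"

definition upper_pair :: "nat \<times> nat \<Rightarrow> nat \<times> nat" where
  "upper_pair = (\<lambda>(i, j). (min i j, max i j))"

lemma sym_entry_eq: "sym_entry n g i j = entry_weight n (i, j) * case_prod g (upper_pair (i, j))"
  by (simp add: sym_entry_def entry_weight_def upper_pair_def)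

lemma entry_mono_sym_entry:
  "entry_mono (sym_entry n g) w = (\<Prod>e\<leftarrow>w. entry_weight n e) * (\<Prod>c\<leftarrow>map upper_pair w. case_prod g c)"
  by (induction w) (auto simp: sym_entry_eq mult_ac)

lemma entry_mono_deriv_sym_entry:
  assumes "n \<ge> 1"
  shows "entry_mono_deriv n s (sym_entry n g) i j w =
    entry_weight n (i, j) * (\<Prod>e\<leftarrow>w. entry_weight n e) * monomial_deriv (s\<^sup>2) (case_prod g) (upper_pair (i, j)) (map upper_pair w)"
proof (induction w)
  case (Cons e w)
  obtain k l where e: "e = (k, l)" by force
  \<comment> \<open>On the diagonal the weight sqrt 2 enters twice and yields the 2 that both
    indicators of \<open>goe_cov\<close> add up to.\<close>
  have cov: "goe_cov n s i j k l = entry_weight n (i, j) * entry_weight n (k, l) * (s\<^sup>2 * of_bool (upper_pair (i, j) = upper_pair (k, l)))"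
    using assms by (auto simp: goe_cov_def entry_weight_def upper_pair_def min_def max_def)
  show ?case
    unfolding e entry_mono_deriv.simps Cons cov entry_mono_sym_entry list.map monomial_deriv.simps sym_entry_eq[of n g k l]
    by (simp add: algebra_simps)
qed simp

lemma goe_of_indep_normal:
  fixes g :: "nat \<Rightarrow> nat \<Rightarrow> 'w \<Rightarrow> real"
  assumes "prob_space M" "n \<ge> 1" "0 \<le> s"
    and indep: "prob_space.indep_vars M (\<lambda>_. borel) (\<lambda>(i, j). g i j) {(i, j). i \<le> j \<and> j < n}"
    and d: "\<And>i j. i \<le> j \<Longrightarrow> j < n \<Longrightarrow> distr M borel (g i j) = centered_normal s"
  shows "goe M n s (\<lambda>z. sym_entry n (\<lambda>i j. g i j z))"
proof -
  interpret prob_space M by fact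
  define I where "I = {(i, j). i \<le> j \<and> j < n}"
  have "I \<subseteq> {..<n} \<times> {..<n}" by (auto simp: I_def)
  then have fin: "finite I" using finite_subset by blast
  have up: "upper_pair (i, j) \<in> I" if "i < n" "j < n" for i j
    using that by (auto simp: I_def upper_pair_def)
  have upw: "set (map upper_pair w) \<subseteq> I" if "set w \<subseteq> {..<n} \<times> {..<n}" for w
    using that up by auto
  have cp: "(case c of (i, j) \<Rightarrow> g i j) z = (case c of (i, j) \<Rightarrow> g i j z)" for c z
    by (cases c) simp
  note wick = indep_normal_wick[OF fin indep[folded I_def] _ assms(3)]
  have d': "distr M borel (case c of (i, j) \<Rightarrow> g i j) = centered_normal s" if "c \<in> I" for c
    using that d by (auto simp: I_def)
  show ?thesis
  proof
    show "1 \<le> n" by fact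
    show "sym_entry n (\<lambda>i j. g i j z) i j = sym_entry n (\<lambda>i j. g i j z) j i" for z i j
      by (simp add: sym_entry_def min.commute max.commute)
    fix w :: "(nat \<times> nat) list" assume w: "set w \<subseteq> {..<n} \<times> {..<n}"
    show "integrable M (\<lambda>z. entry_mono (sym_entry n (\<lambda>i j. g i j z)) w)"
      unfolding entry_mono_sym_entry using wick(1)[OF d' upw[OF w]]
      unfolding cp by (intro integrable_mult_right)
    fix i j assume ij: "i < n" "j < n"
    have "expectation (\<lambda>z. sym_entry n (\<lambda>i j. g i j z) i j * entry_mono (sym_entry n (\<lambda>i j. g i j z)) w) =
      entry_weight n (i, j) * (\<Prod>e\<leftarrow>w. entry_weight n e) *
      expectation (\<lambda>z. (case upper_pair (i, j) of (i, j) \<Rightarrow> g i j) z * (\<Prod>c\<leftarrow>map upper_pair w. (case c of (i, j) \<Rightarrow> g i j) z))"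
      unfolding entry_mono_sym_entry sym_entry_eq
      unfolding cp by (subst integral_mult_right_zero[symmetric]) (simp only: mult_ac)
    also have "\<dots> = entry_weight n (i, j) * (\<Prod>e\<leftarrow>w. entry_weight n e) *
      expectation (\<lambda>z. monomial_deriv (s\<^sup>2) (\<lambda>(i, j). g i j z) (upper_pair (i, j)) (map upper_pair w))"
      using wick(2)[OF d' upw[OF w] up[OF ij]] unfolding cp by simp
    also have "\<dots> = expectation (\<lambda>z. entry_mono_deriv n s (sym_entry n (\<lambda>i j. g i j z)) i j w)"
      unfolding entry_mono_deriv_sym_entry[OF \<open>1 \<le> n\<close>] by simp
    finally show "expectation (\<lambda>z. sym_entry n (\<lambda>i j. g i j z) i j * entry_mono (sym_entry n (\<lambda>i j. g i j z)) w) =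
      expectation (\<lambda>z. entry_mono_deriv n s (sym_entry n (\<lambda>i j. g i j z)) i j w)" .
  qed
qed

section \<open>Dyadic chaining\<close>

text \<open>A point of level k + 1 with odd index has a left neighbour of level k, so the chain from
  0 to a dyadic point uses at most one increment per level.\<close>

lemma dyadic_chain_bound:
  fixes f :: "real \<Rightarrow> real"
  assumes T: "0 \<le> T" and f0: "\<bar>f 0\<bar> \<le> e0"
    and inc: "\<And>k j. j < 2 ^ k \<Longrightarrow> \<bar>f (real (Suc j) * T / 2 ^ k) - f (real j * T / 2 ^ k)\<bar> \<le> e k"
    and e: "\<And>k. 0 \<le> e k"
    and j: "j \<le> 2 ^ k"
  shows "\<bar>f (real j * T / 2 ^ k)\<bar> \<le> e0 + (\<Sum>i\<le>k. e i)"
  using j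
proof (induction k arbitrary: j)
  case 0
  then have "j = 0 \<or> j = 1" by auto
  then show ?case
    using f0 inc[of 0 0] e[of 0] by auto
next
  case (Suc k)
  have half: "real (2 * i) * T / 2 ^ Suc k = real i * T / 2 ^ k" for i
    by simp
  show ?case
  proof (cases "even j")
    case True
    then obtain i where i: "j = 2 * i" by (rule evenE)
    then have "\<bar>f (real i * T / 2 ^ k)\<bar> \<le> e0 + (\<Sum>i\<le>k. e i)"
      using Suc by auto
    then show ?thesis
      using e[of "Suc k"] unfolding i half by simp
  next
    case False
    then obtain i where i: "j = Suc (2 * i)" using oddE by (metis Suc_eq_plus1)
    then have "i \<le> 2 ^ k" "2 * i < 2 ^ Suc k" using Suc.prems by auto
    then have "\<bar>f (real i * T / 2 ^ k)\<bar> \<le> e0 + (\<Sum>i\<le>k. e i)"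
      "\<bar>f (real (Suc (2 * i)) * T / 2 ^ Suc k) - f (real (2 * i) * T / 2 ^ Suc k)\<bar> \<le> e (Suc k)"
      using Suc.IH inc by blast+
    then show ?thesis
      unfolding half i by simp
  qed
qed

lemma dyadic_dense:
  fixes t T :: real
  assumes "0 \<le> t" "t \<le> T"
  shows "(\<lambda>k. real (nat \<lfloor>t * 2 ^ k / T\<rfloor>) * T / 2 ^ k) \<longlonglongrightarrow> t"
    and "nat \<lfloor>t * 2 ^ k / T\<rfloor> \<le> 2 ^ k"
proof -
  \<comment> \<open>Division by 0 yields 0, so for T = 0 all approximating points are 0.\<close>
  show "nat \<lfloor>t * 2 ^ k / T\<rfloor> \<le> 2 ^ k"
  proof (cases "T = 0")
    case False
    then have "t * 2 ^ k / T \<le> 2 ^ k"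
      using assms by (simp add: divide_le_eq mult.commute)
    then have "\<lfloor>t * 2 ^ k / T\<rfloor> \<le> 2 ^ k"
      using floor_mono by fastforce
    then show ?thesis by (simp add: nat_le_iff)
  qed simp
  show "(\<lambda>k. real (nat \<lfloor>t * 2 ^ k / T\<rfloor>) * T / 2 ^ k) \<longlonglongrightarrow> t"
  proof (cases "T = 0")
    case False
    then have T: "T > 0" using assms by simp
    have 1: "real (nat \<lfloor>t * 2 ^ k / T\<rfloor>) \<le> t * 2 ^ k / T" "t * 2 ^ k / T - 1 \<le> real (nat \<lfloor>t * 2 ^ k / T\<rfloor>)" for k
    proof -
      have "0 \<le> t * 2 ^ k / T" using assms T by simp
      then show "real (nat \<lfloor>t * 2 ^ k / T\<rfloor>) \<le> t * 2 ^ k / T" "t * 2 ^ k / T - 1 \<le> real (nat \<lfloor>t * 2 ^ k / T\<rfloor>)"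
        by (simp, linarith)
    qed
    show ?thesis
    proof (rule tendsto_sandwich[of "\<lambda>k. t - T / 2 ^ k" _ _ "\<lambda>_. t"])
      have "(t * 2 ^ k / T - 1) * T / 2 ^ k = t - T / 2 ^ k" for k
        using T by (simp add: field_simps)
      then show "\<forall>\<^sub>F k in sequentially. t - T / 2 ^ k \<le> real (nat \<lfloor>t * 2 ^ k / T\<rfloor>) * T / 2 ^ k"
        using 1(2) T by (intro always_eventually allI) (metis divide_right_mono mult_right_mono less_imp_le zero_le_numeral zero_le_power)
      have "(t * 2 ^ k / T) * T / 2 ^ k = t" for k
        using T by (simp add: field_simps)
      then show "\<forall>\<^sub>F k in sequentially. real (nat \<lfloor>t * 2 ^ k / T\<rfloor>) * T / 2 ^ k \<le> t"
        using 1(1) T by (intro always_eventually allI) (metis divide_right_mono mult_right_mono less_imp_le zero_le_numeral zero_le_power)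
      have "(\<lambda>k. T * (1 / 2) ^ k) \<longlonglongrightarrow> T * 0"
        by (intro tendsto_mult tendsto_const LIMSEQ_realpow_zero) auto
      then have "(\<lambda>k. T / 2 ^ k) \<longlonglongrightarrow> 0"
        by (simp add: power_divide)
      then show "(\<lambda>k. t - T / 2 ^ k) \<longlonglongrightarrow> t"
        using tendsto_diff[OF tendsto_const[of t]] by fastforce
    qed simp
  qed (use assms in auto)
qed

lemma (in prob_space) Chebyshev_square:
  fixes X :: "'a \<Rightarrow> real"
  assumes [measurable]: "X \<in> borel_measurable M" and "integrable M (\<lambda>z. (X z)\<^sup>2)" "e > 0"
  shows "prob {z \<in> space M. \<bar>X z\<bar> > e} \<le> expectation (\<lambda>z. (X z)\<^sup>2) / e\<^sup>2"
proof -
  have "prob {z \<in> space M. \<bar>X z\<bar> > e} \<le> prob {z \<in> space M. (X z)\<^sup>2 \<ge> e\<^sup>2}"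
  proof (rule finite_measure_mono)
    show "{z \<in> space M. \<bar>X z\<bar> > e} \<subseteq> {z \<in> space M. (X z)\<^sup>2 \<ge> e\<^sup>2}"
      using assms(3) by (auto simp: abs_le_square_iff[symmetric])
  qed measurable
  also have "\<dots> \<le> expectation (\<lambda>z. (X z)\<^sup>2) / e\<^sup>2"
    using assms by (intro integral_Markov_inequality_measure[where A = "{}"]) auto
  finally show ?thesis .
qed

text \<open>A single constant K bounds both the start and the increments, so that the estimate by
  chaining is linear in K and a factor tending to 0 with n carries over to the probability of the
  exceptional set.\<close>

definition mean_square_hoelder ::
  "'w measure \<Rightarrow> real \<Rightarrow> real \<Rightarrow> real \<Rightarrow> (real \<Rightarrow> 'w \<Rightarrow> real) \<Rightarrow> bool" where
  "mean_square_hoelder M T K a Z \<longleftrightarrow> prob_space M \<and> (\<forall>t\<ge>0. Z t \<in> borel_measurable M) \<and>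
     (\<forall>t\<ge>0. integrable M (\<lambda>z. (Z t z)\<^sup>2)) \<and>
     (\<forall>z\<in>space M. continuous_on {0..} (\<lambda>t. Z t z)) \<and>
     (\<integral>z. (Z 0 z)\<^sup>2 \<partial>M) \<le> K \<and>
     (\<forall>s t. 0 \<le> s \<and> s \<le> t \<and> t \<le> T \<longrightarrow> (\<integral>z. (Z t z - Z s z)\<^sup>2 \<partial>M) \<le> K * (t - s) powr a)"

text \<open>Off the exceptional set the start is at most \<epsilon>/2 and every increment of level k
  at most \<open>e k\<close>, where these thresholds sum to at most \<epsilon>/2. Level k has 2^k
  increments of second moment at most K (T / 2^k)^a, so Chebyshev's inequality and a union bound
  give K times a convergent series, provided the thresholds decay slowly; a > 1 leaves room for
  that.\<close>

lemma chaining: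
  fixes T a \<epsilon> :: real
  assumes T: "0 \<le> T" and a: "1 < a" and \<epsilon>: "0 < \<epsilon>"
  shows "\<exists>C\<ge>0. \<forall>(M :: 'w measure) Z K. mean_square_hoelder M T K a Z \<longrightarrow>
     (\<exists>E\<in>sets M. measure M E \<le> C * K \<and> (\<forall>z\<in>space M - E. \<forall>t\<in>{0..T}. \<bar>Z t z\<bar> \<le> \<epsilon>))"
proof -
  \<comment> \<open>Up to constants the union bound at level k is 2^(-k (a - 1)) / r^(2 k). This r
    spends half of the exponent a - 1 on the thresholds and leaves 2^(-k (a - 1) / 2), whose ratio
    is \<open>q\<close> below.\<close>
  define r where "r = 2 powr (- (a - 1) / 4)"
  have r: "0 < r" "r < 1"
    using a by (auto simp: r_def powr_less_one)
  define e where "e k = \<epsilon> / 2 * (1 - r) * r ^ k" for k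
  have e: "0 < e k" for k using r \<epsilon> by (simp add: e_def)
  have e_sum: "(\<Sum>i\<le>k. e i) \<le> \<epsilon> / 2" for k
  proof -
    have "(\<Sum>i\<le>k. e i) = \<epsilon> / 2 * ((1 - r) * (\<Sum>i\<le>k. r ^ i))"
      by (simp add: e_def sum_distrib_left mult.assoc)
    also have "(1 - r) * (\<Sum>i\<le>k. r ^ i) = 1 - r ^ Suc k"
      using sum_gp_basic by blast
    also have "\<epsilon> / 2 * (1 - r ^ Suc k) \<le> \<epsilon> / 2 * 1"
      using \<epsilon> r by (intro mult_left_mono) auto
    finally show ?thesis by simp
  qed
  define q where "q = 2 powr (- (a - 1) / 2)"
  have q: "0 < q" "q < 1"
    using a by (auto simp: q_def powr_less_one)
  have rq: "2 ^ k * (1 / 2 ^ k) powr a / (r ^ k)\<^sup>2 = q ^ k" for k :: nat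
  proof -
    have "2 ^ k * (1 / 2 ^ k) powr a / (r ^ k)\<^sup>2 = 2 powr k * 2 powr (- k * a) / 2 powr (- (a - 1) / 4 * k * 2)"
      unfolding r_def by (simp add: powr_realpow[symmetric] powr_powr powr_minus_divide[symmetric] powr_divide)
    also have "\<dots> = 2 powr (k + - k * a - (- (a - 1) / 4 * k * 2))"
      by (simp only: powr_diff[symmetric] powr_add[symmetric])
    also have "k + - k * a - (- (a - 1) / 4 * k * 2) = - (a - 1) / 2 * k"
      by (simp add: field_simps)
    also have "2 powr (- (a - 1) / 2 * k) = q ^ k"
      unfolding q_def by (simp add: powr_realpow[symmetric] powr_powr)
    finally show ?thesis .
  qed
  \<comment> \<open>The first term comes from Chebyshev's inequality at time 0, the second from the
    geometric series over the levels.\<close>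
  define C where "C = 1 / (\<epsilon> / 2)\<^sup>2 + T powr a / (\<epsilon> / 2 * (1 - r))\<^sup>2 * (1 / (1 - q))"
  have C: "C \<ge> 0" using q by (simp add: C_def)
  show ?thesis
  proof (intro exI[of _ C] conjI C allI impI)
    fix M :: "'w measure" and Z K
    assume "mean_square_hoelder M T K a Z"
    then have "prob_space M" and Zm: "\<forall>t\<ge>0. Z t \<in> borel_measurable M"
      and Zi: "\<forall>t\<ge>0. integrable M (\<lambda>z. (Z t z)\<^sup>2)"
      and Zc: "\<forall>z\<in>space M. continuous_on {0..} (\<lambda>t. Z t z)"
      and Z0: "(\<integral>z. (Z 0 z)\<^sup>2 \<partial>M) \<le> K"
      and Zinc: "\<forall>s t. 0 \<le> s \<and> s \<le> t \<and> t \<le> T \<longrightarrow> (\<integral>z. (Z t z - Z s z)\<^sup>2 \<partial>M) \<le> K * (t - s) powr a"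
      by (simp_all add: mean_square_hoelder_def)
    interpret prob_space M by fact
    have K: "K \<ge> 0" by (rule order_trans[OF _ Z0]) simp
    define D where "D k j z = Z (real (Suc j) * T / 2 ^ k) z - Z (real j * T / 2 ^ k) z" for k j z
    have pt: "0 \<le> real j * T / 2 ^ k" for j k using T by simp
    have Dm [measurable]: "D k j \<in> borel_measurable M" for k j
      unfolding D_def using Zm pt[of j k] pt[of "Suc j" k] by (intro borel_measurable_diff) auto
    define E0 where "E0 = {z \<in> space M. \<bar>Z 0 z\<bar> > \<epsilon> / 2}"
    define Ek where "Ek k = (\<Union>j<2 ^ k. {z \<in> space M. \<bar>D k j z\<bar> > e k})" for k :: nat
    have [measurable]: "Z 0 \<in> borel_measurable M" using Zm by simp
    have m0: "E0 \<in> sets M" unfolding E0_def by measurable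
    have mk: "Ek k \<in> sets M" for k unfolding Ek_def by measurable
    have P0: "prob E0 \<le> K / (\<epsilon> / 2)\<^sup>2"
    proof -
      have "prob E0 \<le> expectation (\<lambda>z. (Z 0 z)\<^sup>2) / (\<epsilon> / 2)\<^sup>2"
        unfolding E0_def using Zi \<epsilon> by (intro Chebyshev_square) auto
      also have "\<dots> \<le> K / (\<epsilon> / 2)\<^sup>2" using Z0 by (intro divide_right_mono) auto
      finally show ?thesis .
    qed
    have int_sq: "integrable M (\<lambda>z. (D k j z)\<^sup>2)" for k j
    proof (rule Bochner_Integration.integrable_bound)
      show "integrable M (\<lambda>z. 2 * (Z (real (Suc j) * T / 2 ^ k) z)\<^sup>2 + 2 * (Z (real j * T / 2 ^ k) z)\<^sup>2)"
        using Zi pt[of j k] pt[of "Suc j" k] by (intro Bochner_Integration.integrable_add integrable_mult_right) auto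
      have "(x - y)\<^sup>2 \<le> 2 * x\<^sup>2 + 2 * y\<^sup>2" for x y :: real
        using zero_le_power2[of "x + y"] by (simp add: power2_eq_square algebra_simps)
      then show "AE z in M. norm ((D k j z)\<^sup>2) \<le> norm (2 * (Z (real (Suc j) * T / 2 ^ k) z)\<^sup>2 + 2 * (Z (real j * T / 2 ^ k) z)\<^sup>2)"
        unfolding D_def by simp
    qed measurable
    have Pk: "prob (Ek k) \<le> K * T powr a / (\<epsilon> / 2 * (1 - r))\<^sup>2 * q ^ k" for k
    proof -
      have "prob (Ek k) \<le> (\<Sum>j<2 ^ k. prob {z \<in> space M. \<bar>D k j z\<bar> > e k})"
        unfolding Ek_def by (intro finite_measure_subadditive_finite) auto
      also have "\<dots> \<le> (\<Sum>j<(2::nat) ^ k. K * (T / 2 ^ k) powr a / (e k)\<^sup>2)"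
      proof (intro sum_mono)
        fix j :: nat assume j: "j \<in> {..<2 ^ k}"
        have "prob {z \<in> space M. \<bar>D k j z\<bar> > e k} \<le> expectation (\<lambda>z. (D k j z)\<^sup>2) / (e k)\<^sup>2"
          by (intro Chebyshev_square int_sq e Dm)
        also have "\<dots> \<le> K * (real (Suc j) * T / 2 ^ k - real j * T / 2 ^ k) powr a / (e k)\<^sup>2"
        proof (intro divide_right_mono)
          have "real (Suc j) \<le> 2 ^ k"
            using j by (metis Suc_leI lessThan_iff of_nat_le_iff of_nat_numeral of_nat_power)
          then have "real (Suc j) * T / 2 ^ k \<le> T"
            using T by (simp add: divide_le_eq mult.commute mult_left_mono)
          moreover have "real j * T / 2 ^ k \<le> real (Suc j) * T / 2 ^ k"
            using T by (intro divide_right_mono mult_right_mono) auto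
          ultimately show "expectation (\<lambda>z. (D k j z)\<^sup>2) \<le> K * (real (Suc j) * T / 2 ^ k - real j * T / 2 ^ k) powr a"
            unfolding D_def using Zinc pt by blast
        qed simp
        also have "real (Suc j) * T / 2 ^ k - real j * T / 2 ^ k = T / 2 ^ k"
          by (simp add: diff_divide_distrib[symmetric] algebra_simps)
        finally show "prob {z \<in> space M. \<bar>D k j z\<bar> > e k} \<le> K * (T / 2 ^ k) powr a / (e k)\<^sup>2" .
      qed
      also have "\<dots> = K * T powr a / (\<epsilon> / 2 * (1 - r))\<^sup>2 * (2 ^ k * (1 / 2 ^ k) powr a / (r ^ k)\<^sup>2)"
      proof -
        have "(e k)\<^sup>2 = (\<epsilon> / 2 * (1 - r))\<^sup>2 * (r ^ k)\<^sup>2"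
          by (simp only: e_def power_mult_distrib)
        then show ?thesis using T by (simp add: powr_divide mult_ac)
      qed
      finally show ?thesis unfolding rq .
    qed
    define c where "c = K * T powr a / (\<epsilon> / 2 * (1 - r))\<^sup>2"
    have sq: "(\<lambda>k. c * q ^ k) sums (c * (1 / (1 - q)))"
      using q by (intro sums_mult geometric_sums) auto
    have sumP: "summable (\<lambda>k. prob (Ek k))"
      using Pk sq unfolding c_def by (intro summable_comparison_test_ev[OF _ sums_summable[OF sq]]) (auto simp: c_def)
    have PE: "prob (\<Union>k. Ek k) \<le> c * (1 / (1 - q))"
    proof -
      have "prob (\<Union>k. Ek k) \<le> (\<Sum>k. prob (Ek k))"
        using mk by (intro finite_measure_subadditive_countably sumP) auto
      also have "\<dots> \<le> (\<Sum>k. c * q ^ k)"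
        using Pk unfolding c_def[symmetric] by (intro suminf_le sumP sums_summable[OF sq])
      finally show ?thesis using sums_unique[OF sq] by simp
    qed
    show "\<exists>E\<in>sets M. prob E \<le> C * K \<and> (\<forall>z\<in>space M - E. \<forall>t\<in>{0..T}. \<bar>Z t z\<bar> \<le> \<epsilon>)"
    proof (intro bexI[of _ "E0 \<union> (\<Union>k. Ek k)"] conjI ballI)
      have "prob (E0 \<union> (\<Union>k. Ek k)) \<le> prob E0 + prob (\<Union>k. Ek k)"
        using m0 mk by (intro measure_Un_le) auto
      also have "\<dots> \<le> K / (\<epsilon> / 2)\<^sup>2 + c * (1 / (1 - q))"
        using P0 PE by simp
      also have "\<dots> = C * K"
        by (simp add: C_def c_def algebra_simps)
      finally show "prob (E0 \<union> (\<Union>k. Ek k)) \<le> C * K" .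
      show "E0 \<union> (\<Union>k. Ek k) \<in> sets M"
        using m0 mk by auto
      fix z t assume z: "z \<in> space M - (E0 \<union> (\<Union>k. Ek k))" and t: "t \<in> {0..T}"
      have z0: "\<bar>Z 0 z\<bar> \<le> \<epsilon> / 2"
        using z by (auto simp: E0_def)
      have zi: "\<bar>Z (real (Suc j) * T / 2 ^ k) z - Z (real j * T / 2 ^ k) z\<bar> \<le> e k" if "j < 2 ^ k" for j k
        using z that by (force simp: Ek_def D_def)
      have dy: "\<bar>Z (real j * T / 2 ^ k) z\<bar> \<le> \<epsilon>" if "j \<le> 2 ^ k" for j k
        using dyadic_chain_bound[of T "\<lambda>t. Z t z", OF T z0 zi less_imp_le[OF e] that] e_sum[of k] by simp
      let ?x = "\<lambda>k. real (nat \<lfloor>t * 2 ^ k / T\<rfloor>) * T / 2 ^ k"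
      have "(\<lambda>k. Z (?x k) z) \<longlonglongrightarrow> Z t z"
        by (rule continuous_on_tendsto_compose[OF Zc[rule_format] dyadic_dense(1)]) (use z t T in auto)
      then have "(\<lambda>k. \<bar>Z (?x k) z\<bar>) \<longlonglongrightarrow> \<bar>Z t z\<bar>" by (rule tendsto_rabs)
      moreover have "\<bar>Z (?x k) z\<bar> \<le> \<epsilon>" for k
        using t by (intro dy dyadic_dense(2)) auto
      ultimately show "\<bar>Z t z\<bar> \<le> \<epsilon>"
        by (intro LIMSEQ_le_const2) blast+
    qed
  qed
qed

section \<open>Measurability in the space of continuous paths\<close>

lemma uniform_grid:
  fixes y :: "nat \<Rightarrow> real \<Rightarrow> real" and T e :: real
  assumes c: "\<And>k. continuous_on {0..T} (y k)" and e: "0 < e"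
  shows "\<exists>N::nat. N \<ge> 1 \<and> (\<forall>k\<le>K. \<forall>s\<in>{0..T}. \<forall>t\<in>{0..T}. \<bar>s - t\<bar> \<le> 1 / real N \<longrightarrow> \<bar>y k s - y k t\<bar> < e)"
proof -
  have "\<exists>d>0. \<forall>s\<in>{0..T}. \<forall>t\<in>{0..T}. \<bar>s - t\<bar> < d \<longrightarrow> \<bar>y k s - y k t\<bar> < e" for k
    using compact_uniformly_continuous[OF c compact_Icc, of k] e
    unfolding uniformly_continuous_on_def dist_real_def by (metis abs_minus_commute)
  then obtain d where d: "\<And>k. d k > 0"
    "\<And>k s t. s \<in> {0..T} \<Longrightarrow> t \<in> {0..T} \<Longrightarrow> \<bar>s - t\<bar> < d k \<Longrightarrow> \<bar>y k s - y k t\<bar> < e"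
    by metis
  define D where "D = Min (d ` {..K})"
  have D: "D > 0" "\<And>k. k \<le> K \<Longrightarrow> D \<le> d k"
    unfolding D_def using d(1) by auto
  obtain N :: nat where N: "1 / real (Suc N) < D"
    using D(1) nat_approx_posE by blast
  then show ?thesis
    using D(2) d(2) by (intro exI[of _ "Suc N"]) force
qed

text \<open>The Borel sets of \<open>C_Pr_topology\<close> are not given by coordinates. The path space of countably many
  continuous real processes is however a Lindelof space: the sets \<open>V\<close> in the proof are the neighbourhoods of
  step functions with rational values.\<close>

lemma sets_of_path_neighbourhoods:
  fixes Y :: "nat \<Rightarrow> real \<Rightarrow> 'w \<Rightarrow> real"
  assumes Ym: "\<And>k t. 0 \<le> t \<Longrightarrow> Y k t \<in> borel_measurable M"
    and Yc: "\<And>k z. z \<in> space M \<Longrightarrow> continuous_on {0..} (\<lambda>t. Y k t z)"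
    and S: "S \<subseteq> space M"
    and nb: "\<And>z. z \<in> S \<Longrightarrow> \<exists>T K. \<exists>\<delta>>0.
      {z' \<in> space M. \<forall>k\<le>K. \<forall>t\<in>{0..T}. \<bar>Y k t z' - Y k t z\<bar> < \<delta>} \<subseteq> S"
  shows "S \<in> sets M"
proof -
  \<comment> \<open>T is the time horizon, K the last process considered, 1/(m + 1) the unit of
    precision, 1/N the mesh, and L the table of values in that unit. Such indices are countable in
    number, and testing at dyadic times only makes each \<open>V p\<close> measurable.\<close>
  define V :: "nat \<times> nat \<times> nat \<times> nat \<times> int list list \<Rightarrow> 'w set" where
    "V = (\<lambda>(T, K, m, N, L). {z \<in> space M. \<forall>k\<in>{..K}. \<forall>i. \<forall>j\<in>{..(2::nat) ^ i}.
      \<bar>Y k (real j * real T / 2 ^ i) z - real_of_int (L ! k ! nat \<lfloor>real j * real T / 2 ^ i * real N\<rfloor>) / real (Suc m)\<bar>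
        \<le> 2 / real (Suc m)})"
  have "V p \<in> sets M" for p
  proof -
    obtain T K m N L where p: "p = (T, K, m, N, L)" by (cases p)
    have base: "{z \<in> space M. \<bar>Y k t z - c\<bar> \<le> d} \<in> sets M" if "0 \<le> t" for k t c d
    proof -
      have [measurable]: "Y k t \<in> borel_measurable M" by (rule Ym[OF that])
      show ?thesis by measurable
    qed
    show ?thesis
      unfolding V_def p prod.case
      by (intro sets.sets_Collect_finite_All sets.sets_Collect_countable_All base) auto
  qed
  then have "(\<Union>p\<in>{p. V p \<subseteq> S}. V p) \<in> sets M"
    by (intro sets.countable_UN'') auto
  moreover have "(\<Union>p\<in>{p. V p \<subseteq> S}. V p) = S"
  proof (intro equalityI subsetI)
    fix z assume z: "z \<in> S"
    then have zM: "z \<in> space M" using S by blast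
    obtain T' K \<delta> where \<delta>: "\<delta> > 0"
      "{z' \<in> space M. \<forall>k\<le>K. \<forall>t\<in>{0..T'}. \<bar>Y k t z' - Y k t z\<bar> < \<delta>} \<subseteq> S"
      using nb[OF z] by blast
    obtain T :: nat where T: "T' \<le> real T" using real_arch_simple by blast
    \<comment> \<open>Two members of the same \<open>V p\<close> are both within 2/(m + 1) of the
      step function, hence within 4/(m + 1) of each other.\<close>
    obtain m :: nat where m: "1 / real (Suc m) < \<delta> / 4"
      using nat_approx_posE[of "\<delta> / 4"] \<delta>(1) by auto
    have cont: "continuous_on {0..real T} (\<lambda>t. Y k t z)" for k
      by (rule continuous_on_subset[OF Yc[OF zM]]) auto
    obtain N :: nat where N: "N \<ge> 1"
      "\<And>k s t. k \<le> K \<Longrightarrow> s \<in> {0..real T} \<Longrightarrow> t \<in> {0..real T} \<Longrightarrow> \<bar>s - t\<bar> \<le> 1 / real N \<Longrightarrow>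
        \<bar>Y k s z - Y k t z\<bar> < 1 / real (Suc m)"
      using uniform_grid[of "real T" "\<lambda>k t. Y k t z" "1 / real (Suc m)" K, OF cont] by fastforce
    \<comment> \<open>Rounding down costs at most 1/(m + 1), the oscillation over a mesh cell
      another 1/(m + 1); together they make up the tolerance in \<open>V\<close>.\<close>
    define L where "L = map (\<lambda>k. map (\<lambda>l. \<lfloor>Y k (real l / real N) z * real (Suc m)\<rfloor>) [0..<Suc (T * N)]) [0..<Suc K]"
    let ?V = "V (T, K, m, N, L)"
    have pt: "real j * real T / 2 ^ i \<in> {0..real T}" if "j \<le> 2 ^ i" for i j
    proof -
      have "real j \<le> 2 ^ i" using that by (metis of_nat_le_iff of_nat_numeral of_nat_power)
      then show ?thesis by (simp add: divide_le_eq mult.commute mult_left_mono)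
    qed
    have "z \<in> ?V"
      unfolding V_def prod.case
    proof (intro CollectI conjI zM ballI allI)
      fix k i j assume k: "k \<in> {..K}" and "j \<in> {..(2::nat) ^ i}"
      define q where "q = real j * real T / 2 ^ i"
      have q: "0 \<le> q" "q \<le> real T" using pt[of j i] \<open>j \<in> _\<close> by (auto simp: q_def)
      define l where "l = nat \<lfloor>q * real N\<rfloor>"
      have l1: "real l \<le> q * real N" "q * real N < real l + 1"
        using q by (auto simp: l_def)
      have "real l \<le> real T * real N" using l1(1) q N(1) by (meson mult_right_mono of_nat_0_le_iff order_trans)
      then have l2: "l < Suc (T * N)" by (metis le_imp_less_Suc of_nat_le_iff of_nat_mult)
      have l0: "real l \<le> real N * real T" using l2 by (metis less_Suc_eq_le mult.commute of_nat_le_iff of_nat_mult)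
      have l3: "real l / real N \<in> {0..real T}" "\<bar>q - real l / real N\<bar> \<le> 1 / real N"
        using l0 l1 q N(1) by (auto simp: divide_le_eq field_simps abs_le_iff)
      have Lk: "L ! k ! l = \<lfloor>Y k (real l / real N) z * real (Suc m)\<rfloor>"
        unfolding L_def using k l2 by (simp del: upt_Suc)
      have "\<bar>Y k (real l / real N) z - real_of_int (L ! k ! l) / real (Suc m)\<bar> \<le> 1 / real (Suc m)"
      proof -
        let ?x = "Y k (real l / real N) z"
        have "?x - real_of_int \<lfloor>?x * real (Suc m)\<rfloor> / real (Suc m) = (?x * real (Suc m) - real_of_int \<lfloor>?x * real (Suc m)\<rfloor>) / real (Suc m)"
          by (simp add: diff_divide_distrib)
        moreover have "\<bar>?x * real (Suc m) - real_of_int \<lfloor>?x * real (Suc m)\<rfloor>\<bar> \<le> 1"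
          by linarith
        ultimately show ?thesis
          unfolding Lk by (simp add: abs_divide divide_right_mono del: of_nat_Suc)
      qed
      moreover have "\<bar>Y k q z - Y k (real l / real N) z\<bar> < 1 / real (Suc m)"
        using k q l3 by (intro N(2)) auto
      ultimately have "\<bar>Y k q z - real_of_int (L ! k ! l) / real (Suc m)\<bar> \<le> 1 / real (Suc m) + 1 / real (Suc m)"
        by linarith
      then show "\<bar>Y k (real j * real T / 2 ^ i) z - real_of_int (L ! k ! nat \<lfloor>real j * real T / 2 ^ i * real N\<rfloor>) / real (Suc m)\<bar> \<le> 2 / real (Suc m)"
        unfolding q_def[symmetric] l_def[symmetric] by simp
    qed
    moreover have "?V \<subseteq> S"
    proof
      fix z' assume z': "z' \<in> ?V"
      then have z'M: "z' \<in> space M" by (simp add: V_def)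
      have "\<bar>Y k t z' - Y k t z\<bar> < \<delta>" if k: "k \<le> K" and t: "t \<in> {0..T'}" for k t
      proof -
        \<comment> \<open>Membership in \<open>V\<close> constrains dyadic times; continuity of both
          paths extends the bound to every t.\<close>
        let ?x = "\<lambda>i. real (nat \<lfloor>t * 2 ^ i / real T\<rfloor>) * real T / 2 ^ i"
        have t': "0 \<le> t" "t \<le> real T" using t T by auto
        have "\<bar>Y k (?x i) z' - Y k (?x i) z\<bar> \<le> 4 * (1 / real (Suc m))" for i
        proof -
          have j: "nat \<lfloor>t * 2 ^ i / real T\<rfloor> \<in> {..2 ^ i}" using dyadic_dense(2)[OF t'] by simp
          define v where "v = real_of_int (L ! k ! nat \<lfloor>?x i * real N\<rfloor>) / real (Suc m)"
          have A: "\<bar>Y k (?x i) z' - v\<bar> \<le> 2 / real (Suc m)" and B: "\<bar>Y k (?x i) z - v\<bar> \<le> 2 / real (Suc m)"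
            using z' \<open>z \<in> ?V\<close> k j unfolding v_def V_def prod.case by blast+
          have "\<bar>x - y\<bar> \<le> c + c" if "\<bar>x - v\<bar> \<le> c" "\<bar>y - v\<bar> \<le> c" for x y c :: real
            using that by linarith
          from this[OF A B] show ?thesis by simp
        qed
        moreover have "(\<lambda>i. Y k (?x i) z'') \<longlonglongrightarrow> Y k t z''" if "z'' \<in> space M" for z''
          by (rule continuous_on_tendsto_compose[OF Yc[OF that] dyadic_dense(1)[OF t']]) (use t' in auto)
        then have "(\<lambda>i. \<bar>Y k (?x i) z' - Y k (?x i) z\<bar>) \<longlonglongrightarrow> \<bar>Y k t z' - Y k t z\<bar>"
          using zM z'M by (intro tendsto_rabs tendsto_diff) auto
        ultimately have "\<bar>Y k t z' - Y k t z\<bar> \<le> 4 * (1 / real (Suc m))"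
          by (intro LIMSEQ_le_const2) auto
        then show ?thesis using m by linarith
      qed
      then show "z' \<in> S" using \<delta>(2) z'M by blast
    qed
    ultimately show "z \<in> (\<Union>p\<in>{p. V p \<subseteq> S}. V p)" by blast
  qed auto
  ultimately show ?thesis by simp
qed

section \<open>Weak closeness from closeness of moments\<close>

lemma polynomial_growth_bound:
  fixes c :: "nat \<Rightarrow> real" and B :: real
  assumes "1 \<le> R" "R \<le> \<bar>x\<bar>" "d \<le> 2 * q"
  shows "B + (\<Sum>k\<le>d. \<bar>c k\<bar> * \<bar>x\<bar> ^ k) \<le> (\<bar>B\<bar> + (\<Sum>k\<le>d. \<bar>c k\<bar>)) * R ^ d * (x / R) ^ (2 * q)"
proof -
  have y: "1 \<le> \<bar>x\<bar> / R" using assms by simp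
  have key: "\<bar>x\<bar> ^ k \<le> R ^ d * (x / R) ^ (2 * q)" if "k \<le> d" for k
  proof -
    have "\<bar>x\<bar> ^ k \<le> \<bar>x\<bar> ^ d"
      using that assms by (intro power_increasing) auto
    also have "\<dots> = R ^ d * (\<bar>x\<bar> / R) ^ d"
      using assms by (simp add: power_divide)
    also have "\<dots> \<le> R ^ d * (\<bar>x\<bar> / R) ^ (2 * q)"
      using assms y by (intro mult_left_mono power_increasing) auto
    also have "(\<bar>x\<bar> / R) ^ (2 * q) = (x / R) ^ (2 * q)"
      by (simp add: power_divide power_even_abs)
    finally show ?thesis .
  qed
  have "B * 1 \<le> \<bar>B\<bar> * (R ^ d * (x / R) ^ (2 * q))"
    using key[of 0] by (intro mult_mono) auto
  moreover have "(\<Sum>k\<le>d. \<bar>c k\<bar> * \<bar>x\<bar> ^ k) \<le> (\<Sum>k\<le>d. \<bar>c k\<bar> * (R ^ d * (x / R) ^ (2 * q)))"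
    using key by (intro sum_mono mult_left_mono) auto
  ultimately show ?thesis
    by (simp add: sum_distrib_right distrib_right mult.assoc)
qed

lemma Weierstrass_interval:
  fixes f :: "real \<Rightarrow> real"
  assumes "continuous_on {-R..R} f" "0 < e"
  obtains c d where "\<And>x. x \<in> {-R..R} \<Longrightarrow> \<bar>f x - (\<Sum>k\<le>d. c k * x ^ k)\<bar> < e"
proof -
  obtain g where g: "real_polynomial_function g" "\<And>x. x \<in> {-R..R} \<Longrightarrow> \<bar>f x - g x\<bar> < e"
    using Stone_Weierstrass_real_polynomial_function[OF _ assms] by auto
  obtain c d where "g = (\<lambda>x. \<Sum>k\<le>d. c k * x ^ k)"
    using g(1) real_polynomial_function_iff_sum by blast
  with g(2) show thesis by (intro that[of c d]) simp
qed

text \<open>The relation is deliberately not symmetric. Growth is prescribed for the moments of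
  \<nu>, where it says that \<nu> lives on [-R, R]; mass of \<mu> far out is controlled by the
  closeness of one high even moment.\<close>

definition moments_close :: "nat \<Rightarrow> real \<Rightarrow> real \<Rightarrow> real measure \<Rightarrow> real measure \<Rightarrow> bool" where
  "moments_close N \<delta> R \<mu> \<nu> \<longleftrightarrow> real_distribution \<mu> \<and> real_distribution \<nu> \<and>
    (\<forall>k. integrable \<mu> (\<lambda>x. x ^ k)) \<and> (\<forall>k. integrable \<nu> (\<lambda>x. x ^ k)) \<and>
    (\<forall>q. (\<integral>x. x ^ (2 * q) \<partial>\<nu>) \<le> R ^ (2 * q)) \<and>
    (\<forall>k\<le>N. \<bar>(\<integral>x. x ^ k \<partial>\<mu>) - (\<integral>x. x ^ k \<partial>\<nu>)\<bar> < \<delta>)"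

text \<open>Outside \<open>[-2R, 2R]\<close> a polynomial is dominated by \<open>C (x / 2R)\<^sup>2\<^sup>q\<close>, whose integral is at most
  \<open>C 4\<^sup>-\<^sup>q\<close>, with \<open>q\<close> chosen after the polynomial.\<close>

lemma integral_close_if_moments_close:
  fixes f :: "real \<Rightarrow> real" and R :: real
  assumes f: "f \<in> bounded_continuous" and e: "0 < e" and R: "1 \<le> R"
  shows "\<exists>N. \<exists>\<delta>>0. \<forall>\<mu> \<nu>. moments_close N \<delta> R \<mu> \<nu> \<longrightarrow>
    \<bar>(\<integral>x. f x \<partial>\<mu>) - (\<integral>x. f x \<partial>\<nu>)\<bar> < e"
proof -
  define S where "S = 2 * R"
  have S: "1 \<le> S" using R by (simp add: S_def)
  obtain B where B: "\<And>x. \<bar>f x\<bar> \<le> B"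
    using f unfolding bounded_continuous_def bounded_iff by auto
  have cont: "continuous_on UNIV f" using f by (simp add: bounded_continuous_def)
  obtain c d where poly: "\<And>x. x \<in> {-S..S} \<Longrightarrow> \<bar>f x - (\<Sum>k\<le>d. c k * x ^ k)\<bar> < e / 8"
    using Weierstrass_interval[of S f "e / 8"] e continuous_on_subset[OF cont] by auto
  define p where "p x = (\<Sum>k\<le>d. c k * x ^ k)" for x
  define C where "C = (\<bar>B\<bar> + (\<Sum>k\<le>d. \<bar>c k\<bar>)) * S ^ d"
  have C: "0 \<le> C" unfolding C_def using S by (intro mult_nonneg_nonneg add_nonneg_nonneg sum_nonneg) auto
  have "(\<lambda>q. C * (1 / 4) ^ q) \<longlonglongrightarrow> C * 0"
    by (intro tendsto_mult tendsto_const LIMSEQ_realpow_zero) auto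
  then have "\<forall>\<^sub>F q in sequentially. C * (1 / 4) ^ q < e / 16"
    using e by (intro order_tendstoD(2)[of _ 0]) auto
  then obtain q0 where q0: "\<And>q. q \<ge> q0 \<Longrightarrow> C * (1 / 4) ^ q < e / 16"
    unfolding eventually_sequentially by blast
  define q where "q = max q0 d"
  have q: "C * (1 / 4) ^ q < e / 16" "d \<le> 2 * q" using q0[of q] by (auto simp: q_def)
  have pw: "\<bar>f x - p x\<bar> \<le> e / 8 + C * (x / S) ^ (2 * q)" for x
  proof (cases "x \<in> {-S..S}")
    case True
    have "0 \<le> C * (x / S) ^ (2 * q)" using C by (simp add: power_mult)
    then show ?thesis using poly[OF True] unfolding p_def by linarith
  next
    case False
    then have "S \<le> \<bar>x\<bar>" by auto
    have "\<bar>p x\<bar> \<le> (\<Sum>k\<le>d. \<bar>c k\<bar> * \<bar>x\<bar> ^ k)"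
      unfolding p_def by (rule order_trans[OF sum_abs]) (simp add: abs_mult power_abs)
    then have "\<bar>f x - p x\<bar> \<le> B + (\<Sum>k\<le>d. \<bar>c k\<bar> * \<bar>x\<bar> ^ k)"
      using B[of x] by linarith
    also have "\<dots> \<le> C * (x / S) ^ (2 * q)"
      unfolding C_def by (rule polynomial_growth_bound[OF S \<open>S \<le> \<bar>x\<bar>\<close> q(2)])
    finally show ?thesis using e by linarith
  qed
  define A where "A = 1 + (\<Sum>k\<le>d. \<bar>c k\<bar>)"
  have A: "1 \<le> A" unfolding A_def by (simp add: sum_nonneg)
  \<comment> \<open>The first bound keeps the integrals of the polynomial within e/4 of each other,
    the second keeps the moment of order 2 q of \<mu> below twice the bound for \<nu>. Replacing f
    by the polynomial costs e/4 under each measure, so the total is 3 e / 4.\<close>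
  define \<delta> where "\<delta> = min (e / (4 * A)) (S ^ (2 * q) * (1 / 4) ^ q)"
  have \<delta>: "0 < \<delta>" using A e S by (simp add: \<delta>_def)
  show ?thesis
  proof (intro exI[of _ "max d (2 * q)"] exI[of _ \<delta>] conjI \<delta> allI impI)
    fix \<mu> \<nu> :: "real measure"
    assume mc: "moments_close (max d (2 * q)) \<delta> R \<mu> \<nu>"
    then have rd: "real_distribution \<mu>" "real_distribution \<nu>"
      and i\<mu>: "\<forall>k. integrable \<mu> (\<lambda>x. x ^ k)" and i\<nu>: "\<forall>k. integrable \<nu> (\<lambda>x. x ^ k)"
      and m\<nu>: "\<forall>q. (\<integral>x. x ^ (2 * q) \<partial>\<nu>) \<le> R ^ (2 * q)"
      and close: "\<forall>k\<le>max d (2 * q). \<bar>(\<integral>x. x ^ k \<partial>\<mu>) - (\<integral>x. x ^ k \<partial>\<nu>)\<bar> < \<delta>"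
      by (simp_all add: moments_close_def)
    have bd: "\<bar>(\<integral>x. f x \<partial>\<rho>) - (\<integral>x. p x \<partial>\<rho>)\<bar> \<le> e / 8 + C / S ^ (2 * q) * (\<integral>x. x ^ (2 * q) \<partial>\<rho>)"
      and ip: "(\<integral>x. p x \<partial>\<rho>) = (\<Sum>k\<le>d. c k * (\<integral>x. x ^ k \<partial>\<rho>))"
      if "real_distribution \<rho>" and i: "\<forall>k. integrable \<rho> (\<lambda>x. x ^ k)" for \<rho>
    proof -
      interpret real_distribution \<rho> by fact
      have fi: "integrable \<rho> f"
        using B cont borel_measurable_continuous_onI[OF cont]
        by (intro integrable_const_bound[of _ B]) auto
      have pi: "integrable \<rho> p"
        unfolding p_def[abs_def] using i by (intro Bochner_Integration.integrable_sum integrable_mult_right) auto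
      have "\<bar>(\<integral>x. f x \<partial>\<rho>) - (\<integral>x. p x \<partial>\<rho>)\<bar> = \<bar>\<integral>x. f x - p x \<partial>\<rho>\<bar>"
        using fi pi by simp
      also have "\<dots> \<le> (\<integral>x. \<bar>f x - p x\<bar> \<partial>\<rho>)"
        by (rule integral_abs_bound)
      also have "\<dots> \<le> (\<integral>x. e / 8 + C / S ^ (2 * q) * x ^ (2 * q) \<partial>\<rho>)"
        using fi pi i pw by (intro integral_mono) (auto simp: power_divide)
      also have "\<dots> = e / 8 + C / S ^ (2 * q) * (\<integral>x. x ^ (2 * q) \<partial>\<rho>)"
        using i prob_space by (subst Bochner_Integration.integral_add) auto
      finally show "\<bar>(\<integral>x. f x \<partial>\<rho>) - (\<integral>x. p x \<partial>\<rho>)\<bar> \<le> e / 8 + C / S ^ (2 * q) * (\<integral>x. x ^ (2 * q) \<partial>\<rho>)" .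
      show "(\<integral>x. p x \<partial>\<rho>) = (\<Sum>k\<le>d. c k * (\<integral>x. x ^ k \<partial>\<rho>))"
        unfolding p_def using i by (subst Bochner_Integration.integral_sum) auto
    qed
    have S0: "0 < S ^ (2 * q)" using S by simp
    have "R ^ (2 * q) = S ^ (2 * q) * (1 / 4) ^ q"
      unfolding S_def power_mult by (simp add: power_mult_distrib power_divide)
    then have m1: "(\<integral>x. x ^ (2 * q) \<partial>\<nu>) \<le> S ^ (2 * q) * (1 / 4) ^ q"
      using m\<nu> by metis
    have "\<bar>(\<integral>x. x ^ (2 * q) \<partial>\<mu>) - (\<integral>x. x ^ (2 * q) \<partial>\<nu>)\<bar> < S ^ (2 * q) * (1 / 4) ^ q"
      using close[rule_format, of "2 * q"] by (simp add: \<delta>_def)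
    with m1 have m2: "(\<integral>x. x ^ (2 * q) \<partial>\<mu>) \<le> S ^ (2 * q) * (2 * (1 / 4) ^ q)"
      by simp
    have small: "C / S ^ (2 * q) * m \<le> e / 8" if "m \<le> S ^ (2 * q) * (2 * (1 / 4) ^ q)" for m
    proof -
      have "C / S ^ (2 * q) * m \<le> C / S ^ (2 * q) * (S ^ (2 * q) * (2 * (1 / 4) ^ q))"
        using that C S0 by (intro mult_left_mono) auto
      also have "\<dots> = 2 * (C * (1 / 4) ^ q)" using S by simp
      finally show ?thesis using q(1) by linarith
    qed
    have "(1 / 4 :: real) ^ q \<ge> 0" by simp
    then have "S ^ (2 * q) * (1 / 4) ^ q \<le> S ^ (2 * q) * (2 * (1 / 4) ^ q)"
      using S0 by (intro mult_left_mono) auto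
    with m1 have m1': "(\<integral>x. x ^ (2 * q) \<partial>\<nu>) \<le> S ^ (2 * q) * (2 * (1 / 4) ^ q)" by linarith
    have "\<bar>(\<integral>x. p x \<partial>\<mu>) - (\<integral>x. p x \<partial>\<nu>)\<bar> \<le> e / 4"
    proof -
      have "\<bar>(\<integral>x. p x \<partial>\<mu>) - (\<integral>x. p x \<partial>\<nu>)\<bar> = \<bar>\<Sum>k\<le>d. c k * ((\<integral>x. x ^ k \<partial>\<mu>) - (\<integral>x. x ^ k \<partial>\<nu>))\<bar>"
        using ip rd i\<mu> i\<nu> by (simp add: sum_subtractf right_diff_distrib)
      also have "\<dots> \<le> (\<Sum>k\<le>d. \<bar>c k\<bar> * \<bar>(\<integral>x. x ^ k \<partial>\<mu>) - (\<integral>x. x ^ k \<partial>\<nu>)\<bar>)"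
        by (rule order_trans[OF sum_abs]) (simp add: abs_mult)
      also have "\<dots> \<le> (\<Sum>k\<le>d. \<bar>c k\<bar> * \<delta>)"
        using close by (intro sum_mono mult_left_mono) (auto intro: less_imp_le)
      also have "\<dots> = (\<Sum>k\<le>d. \<bar>c k\<bar>) * \<delta>" by (simp add: sum_distrib_right)
      also have "\<dots> \<le> A * (e / (4 * A))"
        unfolding \<delta>_def using A e S by (intro mult_mono) (auto simp: A_def)
      finally show ?thesis using A by simp
    qed
    moreover have "\<bar>(\<integral>x. f x \<partial>\<mu>) - (\<integral>x. p x \<partial>\<mu>)\<bar> \<le> e / 8 + e / 8"
      using bd[OF rd(1) i\<mu>] small[OF m2] by linarith
    moreover have "\<bar>(\<integral>x. f x \<partial>\<nu>) - (\<integral>x. p x \<partial>\<nu>)\<bar> \<le> e / 8 + e / 8"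
      using bd[OF rd(2) i\<nu>] small[OF m1'] by linarith
    ultimately show "\<bar>(\<integral>x. f x \<partial>\<mu>) - (\<integral>x. f x \<partial>\<nu>)\<bar> < e"
      using e by linarith
  qed
qed

lemma integrals_close_if_moments_close:
  fixes R :: real
  assumes "finite F" "F \<subseteq> bounded_continuous" and e: "0 < e" and R: "1 \<le> R"
  shows "\<exists>N. \<exists>\<delta>>0. \<forall>\<mu> \<nu>. moments_close N \<delta> R \<mu> \<nu> \<longrightarrow>
    (\<forall>f\<in>F. \<bar>(\<integral>x. f x \<partial>\<mu>) - (\<integral>x. f x \<partial>\<nu>)\<bar> < e)"
  using assms(1,2)
proof (induction F)
  case empty
  show ?case by (intro exI[of _ 0] exI[of _ 1]) auto
next
  case (insert f F)
  then obtain N1 \<delta>1 where 1: "\<delta>1 > 0"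
    "\<And>\<mu> \<nu>. moments_close N1 \<delta>1 R \<mu> \<nu> \<Longrightarrow> \<forall>f\<in>F. \<bar>(\<integral>x. f x \<partial>\<mu>) - (\<integral>x. f x \<partial>\<nu>)\<bar> < e"
    by auto
  obtain N2 \<delta>2 where 2: "\<delta>2 > 0"
    "\<And>\<mu> \<nu>. moments_close N2 \<delta>2 R \<mu> \<nu> \<Longrightarrow> \<bar>(\<integral>x. f x \<partial>\<mu>) - (\<integral>x. f x \<partial>\<nu>)\<bar> < e"
    using integral_close_if_moments_close[of f e R] e R insert.prems by auto
  have "moments_close N1 \<delta>1 R \<mu> \<nu> \<and> moments_close N2 \<delta>2 R \<mu> \<nu>"
    if "moments_close (max N1 N2) (min \<delta>1 \<delta>2) R \<mu> \<nu>" for \<mu> \<nu>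
    using that unfolding moments_close_def by auto
  with 1 2 show ?case
    by (intro exI[of _ "max N1 N2"] exI[of _ "min \<delta>1 \<delta>2"]) auto
qed

section \<open>Paths of measures controlled by their moments\<close>

definition has_moments :: "(real \<Rightarrow> real measure) \<Rightarrow> bool" where
  "has_moments m \<longleftrightarrow> (\<forall>t\<ge>0. real_distribution (m t) \<and> (\<forall>k. integrable (m t) (\<lambda>x. x ^ k)))"

definition moments_locally_bounded :: "(real \<Rightarrow> real measure) \<Rightarrow> bool" where
  "moments_locally_bounded m \<longleftrightarrow>
     (\<forall>T. \<exists>R\<ge>1. \<forall>t\<in>{0..T}. \<forall>q. (\<integral>x. x ^ (2 * q) \<partial>m t) \<le> R ^ (2 * q))"

text \<open>At a time t0 the measure \<open>m t0\<close> takes the part of \<nu>; closeness of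
  finitely many moments, granted by their continuity, then carries over to integrals of bounded
  continuous functions.\<close>

lemma C_Pr_if_moments_continuous:
  assumes ext: "m \<in> extensional {0..}"
    and mom: "has_moments m"
    and cont: "\<And>k. continuous_on {0..} (\<lambda>t. \<integral>x. x ^ k \<partial>m t)"
    and bdd: "moments_locally_bounded m"
  shows "m \<in> C_Pr"
proof -
  have cf: "continuous_on {0..} (\<lambda>t. \<integral>x. f x \<partial>m t)" if f: "f \<in> bounded_continuous" for f
    unfolding continuous_on_iff
  proof (intro ballI allI impI)
    fix t0 e :: real assume t0: "t0 \<in> {0..}" and e: "0 < e"
    obtain R where R: "R \<ge> 1" "\<forall>t\<in>{0..t0}. \<forall>q. (\<integral>x. x ^ (2 * q) \<partial>m t) \<le> R ^ (2 * q)"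
      using bdd unfolding moments_locally_bounded_def by blast
    then have Rt0: "\<forall>q. (\<integral>x. x ^ (2 * q) \<partial>m t0) \<le> R ^ (2 * q)" using t0 by simp
    obtain N \<delta> where N: "\<delta> > 0" "\<forall>\<mu> \<nu>. moments_close N \<delta> R \<mu> \<nu> \<longrightarrow>
      \<bar>(\<integral>x. f x \<partial>\<mu>) - (\<integral>x. f x \<partial>\<nu>)\<bar> < e"
      using integral_close_if_moments_close[OF f e R(1)] by blast
    have "\<exists>d>0. \<forall>t\<in>{0..}. dist t t0 < d \<longrightarrow> \<bar>(\<integral>x. x ^ k \<partial>m t) - (\<integral>x. x ^ k \<partial>m t0)\<bar> < \<delta>" for k
      using cont[of k, unfolded continuous_on_iff, rule_format, OF t0 N(1)] by (simp add: dist_real_def)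
    then obtain d where d: "\<And>k. d k > 0"
      "\<And>k t. t \<in> {0..} \<Longrightarrow> dist t t0 < d k \<Longrightarrow> \<bar>(\<integral>x. x ^ k \<partial>m t) - (\<integral>x. x ^ k \<partial>m t0)\<bar> < \<delta>"
      by metis
    define D where "D = Min (d ` {..N})"
    have D: "D > 0" "\<And>k. k \<le> N \<Longrightarrow> D \<le> d k"
      unfolding D_def using d(1) by auto
    show "\<exists>d>0. \<forall>t\<in>{0..}. dist t t0 < d \<longrightarrow> dist (\<integral>x. f x \<partial>m t) (\<integral>x. f x \<partial>m t0) < e"
    proof (intro exI[of _ D] conjI D(1) ballI impI)
      fix t :: real assume t: "t \<in> {0..}" "dist t t0 < D"
      have "\<forall>k\<le>N. \<bar>(\<integral>x. x ^ k \<partial>m t) - (\<integral>x. x ^ k \<partial>m t0)\<bar> < \<delta>"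
        using d(2) D(2) t by (meson less_le_trans)
      then show "dist (\<integral>x. f x \<partial>m t) (\<integral>x. f x \<partial>m t0) < e"
        unfolding dist_real_def using N(2) mom Rt0 t t0 by (auto simp: has_moments_def moments_close_def)
    qed
  qed
  have "continuous_map (top_of_set {0..}) Pr_topology m"
    unfolding Pr_topology_def continuous_on_generated_topo_iff
  proof (intro conjI allI impI)
    fix U assume "U \<in> {{\<mu>. real_distribution \<mu> \<and> (\<integral>x. f x \<partial>\<mu>) \<in> U} | f U. f \<in> bounded_continuous \<and> open U}"
    then obtain f V where U: "U = {\<mu>. real_distribution \<mu> \<and> (\<integral>x. f x \<partial>\<mu>) \<in> V}" "f \<in> bounded_continuous" "open V"
      by blast
    have "m -` U \<inter> topspace (top_of_set {0..}) = {0..} \<inter> (\<lambda>t. \<integral>x. f x \<partial>m t) -` V"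
      unfolding U(1) using mom by (auto simp: has_moments_def)
    then show "openin (top_of_set {0..}) (m -` U \<inter> topspace (top_of_set {0..}))"
      using continuous_openin_preimage_gen[OF cf[OF U(2)] U(3)] by simp
  next
    have "\<Union> {{\<mu>. real_distribution \<mu> \<and> (\<integral>x. f x \<partial>\<mu>) \<in> U} | f U. f \<in> bounded_continuous \<and> open U} = {\<mu>. real_distribution \<mu>}"
      using topspace_Pr_topology unfolding Pr_topology_def topology_generated_by_topspace .
    then show "m ` topspace (top_of_set {0..}) \<subseteq>
        \<Union> {{\<mu>. real_distribution \<mu> \<and> (\<integral>x. f x \<partial>\<mu>) \<in> U} | f U. f \<in> bounded_continuous \<and> open U}"
      using mom by (auto simp: has_moments_def)
  qed
  then show ?thesis using ext by (simp add: C_Pr_def)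
qed

text \<open>The moment bound concerns the centre m alone, so \<open>N\<close> and \<delta> serve all
  m' at once. The centre is the limit path in the proof of convergence and a sample path in the
  proof of measurability.\<close>

lemma C_Pr_nbhd_if_moments_close:
  assumes F: "finite F" "F \<subseteq> bounded_continuous" and e: "0 < e"
    and mom: "has_moments m"
    and bdd: "moments_locally_bounded m"
  shows "\<exists>N. \<exists>\<delta>>0. \<forall>m'\<in>C_Pr. has_moments m' \<and>
    (\<forall>k\<le>N. \<forall>t\<in>{0..T}. \<bar>(\<integral>x. x ^ k \<partial>m' t) - (\<integral>x. x ^ k \<partial>m t)\<bar> < \<delta>) \<longrightarrow> m' \<in> C_Pr_nbhd m T F e"
proof -
  obtain R where R: "R \<ge> 1" "\<forall>t\<in>{0..T}. \<forall>q. (\<integral>x. x ^ (2 * q) \<partial>m t) \<le> R ^ (2 * q)"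
    using bdd unfolding moments_locally_bounded_def by blast
  obtain N \<delta> where N: "\<delta> > 0" "\<And>\<mu> \<nu>. moments_close N \<delta> R \<mu> \<nu> \<Longrightarrow>
      (\<forall>f\<in>F. \<bar>(\<integral>x. f x \<partial>\<mu>) - (\<integral>x. f x \<partial>\<nu>)\<bar> < e)"
    using integrals_close_if_moments_close[OF F e R(1)] by blast
  show ?thesis
  proof (intro exI[of _ N] exI[of _ \<delta>] conjI N(1) ballI impI)
    fix m' assume m': "m' \<in> C_Pr" and a: "has_moments m' \<and>
      (\<forall>k\<le>N. \<forall>t\<in>{0..T}. \<bar>(\<integral>x. x ^ k \<partial>m' t) - (\<integral>x. x ^ k \<partial>m t)\<bar> < \<delta>)"
    have "\<forall>f\<in>F. \<bar>(\<integral>x. f x \<partial>m' t) - (\<integral>x. f x \<partial>m t)\<bar> < e" if "t \<in> {0..T}" for t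
      using a R(2) mom that by (intro N(2)) (auto simp: has_moments_def moments_close_def)
    then show "m' \<in> C_Pr_nbhd m T F e"
      using m' by (simp add: C_Pr_nbhd_def)
  qed
qed

section \<open>Integrals against the empirical measure\<close>

lemma empirical_measure_eq_distr:
  assumes "n \<ge> 1"
  shows "empirical_measure n x = distr (uniform_count_measure {..<n}) borel x"
proof (rule measure_eqI)
  fix A assume "A \<in> sets (empirical_measure n x)"
  then have A: "A \<in> sets borel" by simp
  have "(\<Sum>j<n. emeasure (return borel (x j)) A) = ennreal (real (card {j \<in> {..<n}. x j \<in> A}))"
  proof -
    have "(\<Sum>j<n. emeasure (return borel (x j)) A) = (\<Sum>j<n. ennreal (indicator A (x j)))"
      using A by (intro sum.cong) (auto simp: indicator_def)
    also have "\<dots> = ennreal (\<Sum>j<n. indicator A (x j))"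
      by (rule sum_ennreal) simp
    also have "(\<Sum>j<n. indicator A (x j)) = real (card {j \<in> {..<n}. x j \<in> A})"
      by (simp add: indicator_def if_distrib sum.If_cases Int_def conj_commute)
    finally show ?thesis .
  qed
  then have "emeasure (empirical_measure n x) A = ennreal (real (card {j \<in> {..<n}. x j \<in> A}) / real n)"
    unfolding emeasure_empirical_measure[OF A] by (simp flip: ennreal_mult'')
  also have "\<dots> = emeasure (uniform_count_measure {..<n}) {j \<in> {..<n}. x j \<in> A}"
    by (subst emeasure_uniform_count_measure) auto
  also have "{j \<in> {..<n}. x j \<in> A} = x -` A \<inter> space (uniform_count_measure {..<n})"
    by (auto simp: space_uniform_count_measure)
  also have "emeasure (uniform_count_measure {..<n}) \<dots> = emeasure (distr (uniform_count_measure {..<n}) borel x) A"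
    using A by (intro emeasure_distr[symmetric])
      (auto simp: measurable_def space_uniform_count_measure sets_uniform_count_measure)
  finally show "emeasure (empirical_measure n x) A = emeasure (distr (uniform_count_measure {..<n}) borel x) A" .
qed simp

lemma integral_empirical_measure:
  fixes f :: "real \<Rightarrow> real"
  assumes "n \<ge> 1" and [measurable]: "f \<in> borel_measurable borel"
  shows "integrable (empirical_measure n x) f"
    and "(\<integral>y. f y \<partial>empirical_measure n x) = (\<Sum>j<n. f (x j)) / real n"
proof -
  have x: "x \<in> uniform_count_measure {..<n} \<rightarrow>\<^sub>M borel"
    by (auto simp: measurable_def space_uniform_count_measure sets_uniform_count_measure)
  show "integrable (empirical_measure n x) f"
    unfolding empirical_measure_eq_distr[OF assms(1)] using x
    by (subst integrable_distr_eq) (auto simp: uniform_count_measure_def integrable_point_measure_finite)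
  show "(\<integral>y. f y \<partial>empirical_measure n x) = (\<Sum>j<n. f (x j)) / real n"
    unfolding empirical_measure_eq_distr[OF assms(1)] using x
    by (subst integral_distr) (auto simp: integral_uniform_count_measure)
qed

section \<open>Eigenvalues of real symmetric matrices\<close>

text \<open>The Hermitian form \<open>Q\<close> at an eigenvector is z times the squared norm, and
  symmetry makes it equal to its own conjugate.\<close>

lemma eigenvalue_real_symmetric:
  fixes a :: "nat \<Rightarrow> nat \<Rightarrow> real"
  assumes sym: "\<And>i j. a i j = a j i"
    and ev: "eigenvalue (map_mat complex_of_real (mat n n (\<lambda>(i, j). a i j))) z"
  shows "z \<in> \<real>"
proof -
  let ?A = "map_mat complex_of_real (mat n n (\<lambda>(i, j). a i j))"
  obtain v where v: "v \<in> carrier_vec n" "v \<noteq> 0\<^sub>v n" "?A *\<^sub>v v = z \<cdot>\<^sub>v v"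
    using ev unfolding eigenvalue_def eigenvector_def by auto
  have row: "(\<Sum>j<n. complex_of_real (a i j) * v $ j) = z * v $ i" if "i < n" for i
  proof -
    have "(?A *\<^sub>v v) $ i = (\<Sum>j<n. complex_of_real (a i j) * v $ j)"
      using that v(1) by (simp add: scalar_prod_def atLeast0LessThan)
    with v(3) that v(1) show ?thesis by simp
  qed
  define N where "N = (\<Sum>i<n. (cmod (v $ i))\<^sup>2)"
  have "N \<noteq> 0"
  proof
    assume "N = 0"
    then have "\<forall>i<n. v $ i = 0"
      unfolding N_def by (subst (asm) sum_nonneg_eq_0_iff) auto
    then have "v = 0\<^sub>v n" using v(1) by (intro eq_vecI) auto
    with v(2) show False by simp
  qed
  define Q where "Q = (\<Sum>i<n. \<Sum>j<n. cnj (v $ i) * (complex_of_real (a i j) * v $ j))"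
  have Q: "Q = z * complex_of_real N"
  proof -
    have "Q = (\<Sum>i<n. cnj (v $ i) * (z * v $ i))"
      unfolding Q_def sum_distrib_left[symmetric] using row by (intro sum.cong) auto
    also have "\<dots> = z * complex_of_real N"
      unfolding N_def of_real_sum sum_distrib_left
      by (intro sum.cong refl) (simp add: mult_ac flip: complex_norm_square)
    finally show ?thesis .
  qed
  have "cnj Q = (\<Sum>i<n. \<Sum>j<n. v $ i * (complex_of_real (a j i) * cnj (v $ j)))"
    unfolding Q_def by (simp add: sym)
  also have "\<dots> = Q"
    unfolding Q_def by (subst sum.swap) (simp add: mult_ac)
  finally have "cnj z * complex_of_real N = z * complex_of_real N"
    using Q by simp
  then have "cnj z = z" using \<open>N \<noteq> 0\<close> by simp
  then show ?thesis by (simp add: Reals_cnj_iff)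
qed

text \<open>The polynomial splits over the complex numbers, its roots are real, and the embedding of
  real into complex polynomials is injective.\<close>

lemma real_symmetric_char_poly_factorized:
  fixes a :: "nat \<Rightarrow> nat \<Rightarrow> real"
  assumes sym: "\<And>i j. a i j = a j i"
  obtains rs where "char_poly (mat n n (\<lambda>(i, j). a i j)) = (\<Prod>r\<leftarrow>rs. [:- r, 1:])" "length rs = n"
proof -
  let ?A = "mat n n (\<lambda>(i, j). a i j)"
  let ?B = "map_mat complex_of_real ?A"
  have B: "?B \<in> carrier_mat n n" by simp
  obtain zs where zs: "char_poly ?B = (\<Prod>z\<leftarrow>zs. [:- z, 1:])" "length zs = n"
    using char_poly_factorized[OF B] by blast
  have real: "z \<in> \<real>" if "z \<in> set zs" for z
  proof (rule eigenvalue_real_symmetric[OF sym])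
    have "poly (char_poly ?B) z = 0"
      unfolding zs(1) poly_prod_list using that by (auto simp: prod_list_zero_iff image_iff intro!: bexI[of _ z])
    then show "eigenvalue ?B z" using eigenvalue_root_char_poly[OF B] by simp
  qed
  define rs where "rs = map Re zs"
  have zs_rs: "zs = map complex_of_real rs"
    unfolding rs_def using real by (auto simp: map_idI)
  interpret h: map_poly_inj_idom_hom complex_of_real ..
  have "char_poly ?B = map_poly complex_of_real (char_poly ?A)"
    by (rule of_real_hom.char_poly_hom[where n = n]) simp
  then have "map_poly complex_of_real (char_poly ?A) = (\<Prod>z\<leftarrow>zs. [:- z, 1:])"
    using zs(1) by simp
  also have "\<dots> = map_poly complex_of_real (\<Prod>r\<leftarrow>rs. [:- r, 1:])"
    unfolding zs_rs by (simp add: h.hom_prod_list o_def)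
  finally have "char_poly ?A = (\<Prod>r\<leftarrow>rs. [:- r, 1:])"
    by simp
  moreover have "length rs = n" using zs(2) by (simp add: rs_def)
  ultimately show thesis by (rule that)
qed

text \<open>Powers of index functions spare the moment computations all carrier conditions. They are
  linked here with matrix powers, which multiply on the right where \<open>mpow\<close> multiplies
  on the left.\<close>

lemma mat_pow_mpow:
  "(mat n n (\<lambda>(i, j). a i j)) ^\<^sub>m k = mat n n (\<lambda>(i, j). mpow n a k i j)"
proof (induction k)
  case 0
  show ?case by (intro eq_matI) auto
next
  case (Suc k)
  have "mpow n a (Suc k) i j = (\<Sum>l<n. mpow n a k i l * a l j)" if "i < n" "j < n" for i j
    using mpow_add[OF that(1), of a k 1 j] that by (simp add: sum_of_bool_lessThan)
  then show ?case
    unfolding pow_mat.simps Suc by (intro eq_matI) (auto simp: scalar_prod_def atLeast0LessThan)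
qed

definition mat_trace :: "'a :: comm_ring_1 mat \<Rightarrow> 'a" where
  "mat_trace A = (\<Sum>i<dim_row A. A $$ (i, i))"

lemma mat_trace_mult_commute:
  assumes "A \<in> carrier_mat n n" "B \<in> carrier_mat n n"
  shows "mat_trace (A * B) = mat_trace (B * A)"
proof -
  have "mat_trace (A * B) = (\<Sum>i<n. \<Sum>j<n. A $$ (i, j) * B $$ (j, i))"
    using assms by (auto simp: mat_trace_def scalar_prod_def atLeast0LessThan intro!: sum.cong)
  also have "\<dots> = (\<Sum>j<n. \<Sum>i<n. B $$ (j, i) * A $$ (i, j))"
    by (subst sum.swap) (simp add: mult.commute)
  also have "\<dots> = mat_trace (B * A)"
    using assms by (auto simp: mat_trace_def scalar_prod_def atLeast0LessThan intro!: sum.cong)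
  finally show ?thesis .
qed

lemma upper_triangular_pow:
  fixes A :: "real mat"
  assumes A: "A \<in> carrier_mat n n" and ut: "upper_triangular A"
  shows "upper_triangular (A ^\<^sub>m k) \<and> (\<forall>i<n. (A ^\<^sub>m k) $$ (i, i) = (A $$ (i, i)) ^ k)"
proof (induction k)
  case (Suc k)
  have P: "A ^\<^sub>m k \<in> carrier_mat n n" using A by simp
  have Ak: "(A ^\<^sub>m k) $$ (i, l) = 0" if "l < i" "i < n" for i l
    using Suc that P unfolding upper_triangular_def by auto
  have A0: "A $$ (i, l) = 0" if "l < i" "i < n" for i l
    using ut that A unfolding upper_triangular_def by auto
  have entry: "(A ^\<^sub>m Suc k) $$ (i, j) = (\<Sum>l<n. (A ^\<^sub>m k) $$ (i, l) * A $$ (l, j))" if "i < n" "j < n" for i j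
    using that A P by (simp add: scalar_prod_def atLeast0LessThan)
  have "(A ^\<^sub>m Suc k) $$ (i, j) = 0" if "j < i" "i < n" for i j
  proof -
    have "(A ^\<^sub>m k) $$ (i, l) * A $$ (l, j) = 0" if "l < n" for l
      using Ak[of l i] A0[of j l] \<open>j < i\<close> \<open>i < n\<close> that by (cases "l < i") auto
    then have "(\<Sum>l<n. (A ^\<^sub>m k) $$ (i, l) * A $$ (l, j)) = 0"
      by (intro sum.neutral) simp
    then show ?thesis using that by (subst entry) auto
  qed
  moreover have "(A ^\<^sub>m Suc k) $$ (i, i) = (A $$ (i, i)) ^ Suc k" if "i < n" for i
  proof -
    have "(A ^\<^sub>m k) $$ (i, l) * A $$ (l, i) = (if l = i then (A $$ (i, i)) ^ Suc k else 0)" if "l < n" for l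
      using Ak[of l i] A0[of i l] Suc \<open>i < n\<close> that by (cases l i rule: linorder_cases) auto
    then show ?thesis using that by (subst entry) auto
  qed
  ultimately show ?case
    using A by (auto simp: upper_triangular_def)
qed (use A in auto)

text \<open>Schur's triangular form has the prescribed roots on its diagonal, similarity preserves
  the trace of a power, and the diagonal of a power of a triangular matrix consists of powers. Roots
  are thus counted with their multiplicity in the characteristic polynomial.\<close>

lemma sum_root_powers:
  fixes A :: "real mat"
  assumes A: "A \<in> carrier_mat n n" and rs: "char_poly A = (\<Prod>r\<leftarrow>rs. [:- r, 1:])"
  shows "mat_trace (A ^\<^sub>m k) = (\<Sum>r\<leftarrow>rs. r ^ k)"
proof -
  obtain B P Q where "schur_decomposition A rs = (B, P, Q)"
    by (cases "schur_decomposition A rs") auto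
  from schur_decomposition[OF A rs this]
  have sim: "similar_mat_wit A B P Q" and ut: "upper_triangular B" and diag: "diag_mat B = rs"
    by auto
  note car = similar_mat_witD2[OF A sim]
  have Bk: "B ^\<^sub>m k \<in> carrier_mat n n" using car by simp
  have "mat_trace (A ^\<^sub>m k) = mat_trace (P * B ^\<^sub>m k * Q)"
    using similar_mat_wit_pow_id[OF sim] by simp
  also have "\<dots> = mat_trace (Q * (P * B ^\<^sub>m k))"
    using car Bk by (intro mat_trace_mult_commute[of _ n]) auto
  also have "Q * (P * B ^\<^sub>m k) = (Q * P) * B ^\<^sub>m k"
    using car Bk by (subst assoc_mult_mat[of _ n n _ n _ n]) auto
  also have "\<dots> = B ^\<^sub>m k"
    using car Bk by simp
  also have "mat_trace (B ^\<^sub>m k) = (\<Sum>i<n. (B $$ (i, i)) ^ k)"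
    using upper_triangular_pow[OF _ ut, of n k] car Bk by (auto simp: mat_trace_def)
  also have "\<dots> = (\<Sum>r\<leftarrow>diag_mat B. r ^ k)"
    using car by (simp add: diag_mat_def o_def interv_sum_list_conv_sum_set_nat atLeast0LessThan)
  finally show ?thesis by (simp add: diag)
qed

lemma proots_linear_factors:
  "proots (\<Prod>r\<leftarrow>rs. [:- r, 1:]) = mset (rs :: real list)"
proof (induction rs)
  case (Cons r rs)
  have "(\<Prod>r\<leftarrow>rs. [:- r, 1:]) \<noteq> 0"
    by (auto simp: prod_list_zero_iff)
  with Cons show ?case by (simp add: proots_mult del: mult_pCons_left)
qed simp

text \<open>A power sum depends only on the multiset of roots, so sorting does no harm. This turns
  spectral moments into polynomials in the entries.\<close>

lemma sum_ordered_eigenvalue_power: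
  fixes a :: "nat \<Rightarrow> nat \<Rightarrow> real"
  assumes sym: "\<And>i j. a i j = a j i"
  shows "(\<Sum>j<n. ordered_eigenvalue (mat n n (\<lambda>(i, j). a i j)) j ^ k) = (\<Sum>i<n. mpow n a k i i)"
proof -
  let ?A = "mat n n (\<lambda>(i, j). a i j)"
  obtain rs where rs: "char_poly ?A = (\<Prod>r\<leftarrow>rs. [:- r, 1:])" "length rs = n"
    using real_symmetric_char_poly_factorized[OF sym] .
  have ord: "ordered_eigenvalue ?A j = sort rs ! j" for j
    unfolding ordered_eigenvalue_def rs(1) proots_linear_factors by (simp only: sorted_list_of_multiset_mset)
  have "(\<Sum>j<n. ordered_eigenvalue ?A j ^ k) = (\<Sum>r\<leftarrow>sort rs. r ^ k)"
    unfolding ord using rs(2) by (simp add: sum_list_sum_nth atLeast0LessThan)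
  also have "\<dots> = (\<Sum>r\<leftarrow>rs. r ^ k)"
    by (metis mset_map mset_sort sum_mset_sum_list)
  also have "\<dots> = mat_trace (?A ^\<^sub>m k)"
    by (rule sum_root_powers[OF _ rs(1), where n = n, symmetric]) simp
  also have "\<dots> = (\<Sum>i<n. mpow n a k i i)"
    unfolding mat_pow_mpow by (simp add: mat_trace_def)
  finally show ?thesis .
qed

section \<open>Moments of the semicircle law\<close>

text \<open>The generating function \<open>Y\<close> satisfies \<open>Y = 1 + X\<^sup>2 Y\<^sup>2\<close>, so \<open>D = 1 - 2 X\<^sup>2 Y\<close> is a square root of
  \<open>1 - 4 X\<^sup>2\<close> and solves \<open>(1 - 4 X\<^sup>2) D' = - 4 X D\<close>. The semicircle law satisfies the same recursion
  by partial integration.\<close>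

lemma sc_moment_rec: "(real j + 3) * sc_moment (Suc j) = 4 * real j * sc_moment (j - 1)"
proof -
  define Y where "Y = Abs_fps sc_moment"
  define X2 where "X2 = (fps_X\<^sup>2 :: real fps)"
  have Y: "Y = 1 + X2 * Y\<^sup>2"
  proof (rule fps_ext)
    fix m
    show "fps_nth Y m = fps_nth (1 + X2 * Y\<^sup>2) m"
    proof (cases m)
      case 0
      then show ?thesis by (simp add: Y_def X2_def fps_mult_nth_0)
    next
      case (Suc k)
      show ?thesis
      proof (cases k)
        case 0
        then show ?thesis using Suc by (simp add: Y_def X2_def fps_X_power_mult_nth)
      next
        case (Suc i)
        have "fps_nth (1 + X2 * Y\<^sup>2) (Suc (Suc i)) = fps_nth (Y * Y) i"
          by (simp add: X2_def fps_X_power_mult_nth power2_eq_square[of Y])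
        also have "\<dots> = (\<Sum>l\<le>i. sc_moment l * sc_moment (i - l))"
          by (simp add: fps_mult_nth Y_def atLeast0AtMost)
        also have "\<dots> = fps_nth Y (Suc (Suc i))"
          by (simp add: Y_def lessThan_Suc_atMost del: sum.lessThan_Suc)
        finally show ?thesis using \<open>m = Suc k\<close> Suc by simp
      qed
    qed
  qed
  define D where "D = 1 - 2 * X2 * Y"
  have "D * D = 1 - 4 * X2 * (Y - X2 * Y\<^sup>2)"
    unfolding D_def by (simp add: power2_eq_square algebra_simps)
  also have "Y - X2 * Y\<^sup>2 = 1" using Y by (simp add: algebra_simps)
  finally have DD: "D * D = 1 - 4 * X2" by simp
  have dX2: "fps_deriv X2 = 2 * fps_X"
    by (simp add: X2_def power2_eq_square)
  have "fps_deriv (D * D) = - (8 * fps_X)"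
    unfolding DD by (simp add: dX2)
  then have "2 * (D * fps_deriv D) = 2 * (- (4 * fps_X))"
    by (simp add: mult.commute)
  then have "D * fps_deriv D = - (4 * fps_X)"
    by (subst (asm) mult_cancel_left) simp
  \<comment> \<open>Multiplying by \<open>D\<close> once more replaces its square by 1 - 4 X^2 and
    makes the equation linear.\<close>
  then have "D * (D * fps_deriv D) = D * - (4 * fps_X)"
    by (rule arg_cong)
  then have "D * D * fps_deriv D = - (4 * fps_X) * D"
    by (simp only: mult.assoc mult.commute[of D "- (4 * fps_X)"])
  then have ode: "fps_deriv D - 4 * (X2 * fps_deriv D) = - (4 * (fps_X * D))"
    unfolding DD by (simp add: algebra_simps)
  have num: "fps_nth (numeral c * f) m = numeral c * fps_nth f m" for c m and f :: "real fps"
    by (simp add: fps_numeral_fps_const)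
  \<comment> \<open>\<open>D\<close> stores the moments shifted by two, so the coefficient of index
    j + 2 in the differential equation relates the moments of orders j + 1 and j - 1.\<close>
  have D_nth: "fps_nth D (Suc (Suc k)) = - 2 * sc_moment k" for k
    by (simp add: D_def X2_def mult.assoc num fps_X_power_mult_nth Y_def)
  have D1: "fps_nth D 1 = 0"
    by (simp add: D_def X2_def mult.assoc num fps_X_power_mult_nth)
  have "fps_nth (fps_deriv D - 4 * (X2 * fps_deriv D)) (Suc (Suc j)) = fps_nth (- (4 * (fps_X * D))) (Suc (Suc j))"
    by (simp only: ode)
  moreover have "fps_nth (X2 * f) (Suc (Suc j)) = fps_nth f j" "fps_nth (fps_X * f) (Suc (Suc j)) = fps_nth f (Suc j)" for f
    by (simp_all add: X2_def fps_X_power_mult_nth)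
  moreover have "fps_nth (fps_deriv D) (Suc (Suc j)) = (real j + 3) * fps_nth D (Suc (Suc (Suc j)))"
    "fps_nth (fps_deriv D) j = (real j + 1) * fps_nth D (Suc j)"
    by (simp_all add: algebra_simps)
  ultimately have "(real j + 3) * fps_nth D (Suc (Suc (Suc j))) - 4 * ((real j + 1) * fps_nth D (Suc j)) = - (4 * fps_nth D (Suc j))"
    by (simp only: fps_sub_nth fps_neg_nth num)
  then have "(real j + 3) * fps_nth D (Suc (Suc (Suc j))) = 4 * real j * fps_nth D (Suc j)"
    by (simp add: algebra_simps)
  then show ?thesis
    using D_nth D1 by (cases j) (simp_all add: D_nth del: sc_moment.simps(2))
qed

text \<open>The recursion has step two, but a single initial value suffices, since its instance j =
  0 forces the first moment to vanish.\<close>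

lemma moments_eq_sc_moment:
  fixes m :: "nat \<Rightarrow> real"
  assumes m0: "m 0 = 1" and rec: "\<And>j. (real j + 3) * m (Suc j) = 4 * real j * \<sigma>\<^sup>2 * m (j - 1)"
  shows "m k = \<sigma> ^ k * sc_moment k"
proof (induction k rule: less_induct)
  case (less k)
  show ?case
  proof (cases k)
    case (Suc j)
    have "(real j + 3) * m (Suc j) = (real j + 3) * (\<sigma> ^ Suc j * sc_moment (Suc j))"
    proof (cases j)
      case 0
      then show ?thesis using rec[of 0] by simp
    next
      case (Suc i)
      have "(real j + 3) * m (Suc j) = 4 * real j * \<sigma>\<^sup>2 * (\<sigma> ^ i * sc_moment i)"
        using rec[of j] less[of i] Suc \<open>k = Suc j\<close> by simp
      also have "\<dots> = \<sigma>\<^sup>2 * \<sigma> ^ i * (4 * real j * sc_moment (j - 1))"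
        using Suc by simp
      also have "\<dots> = \<sigma>\<^sup>2 * \<sigma> ^ i * ((real j + 3) * sc_moment (Suc j))"
        by (simp only: sc_moment_rec)
      also have "\<dots> = (real j + 3) * (\<sigma> ^ Suc j * sc_moment (Suc j))"
        using Suc by (simp add: power2_eq_square del: sc_moment.simps)
      finally show ?thesis .
    qed
    then show ?thesis using Suc by (simp del: sc_moment.simps power_Suc)
  qed (use m0 in simp)
qed

text \<open>Each step of the recursion multiplies by (2 q + 1) / (2 q + 4) times 4, hence by at most
  4. The bound reflects the support [-2, 2] and supplies the radius for the limit path.\<close>

lemma sc_moment_even_bound: "0 \<le> sc_moment (2 * q) \<and> sc_moment (2 * q) \<le> 4 ^ q"
proof (induction q)
  case (Suc q)
  have r: "(real (2 * q + 1) + 3) * sc_moment (2 * Suc q) = 4 * real (2 * q + 1) * sc_moment (2 * q)"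
    using sc_moment_rec[of "2 * q + 1"] by (simp del: sc_moment.simps)
  have pos: "real (2 * q + 1) + 3 > 0" by simp
  have "0 \<le> (real (2 * q + 1) + 3) * sc_moment (2 * Suc q)"
    unfolding r using Suc by (intro mult_nonneg_nonneg) auto
  then have 1: "0 \<le> sc_moment (2 * Suc q)"
    using pos by (simp only: zero_le_mult_iff) linarith
  have "4 * real (2 * q + 1) * sc_moment (2 * q) \<le> 4 * (real (2 * q + 1) + 3) * 4 ^ q"
    using Suc by (intro mult_mono) auto
  then have "(real (2 * q + 1) + 3) * sc_moment (2 * Suc q) \<le> (real (2 * q + 1) + 3) * 4 ^ Suc q"
    unfolding r power_Suc by (simp only: mult_ac)
  then have "sc_moment (2 * Suc q) \<le> 4 ^ Suc q"
    using pos by (simp only: mult_le_cancel_left_pos)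
  with 1 show ?case by blast
qed simp

text \<open>The derivative of x^j (4 \<sigma>^2 - x^2)^(3/2) is a combination of the two integrands
  in the recursion, and the function vanishes at both ends of the support. The total mass is drawn
  from \<open>prob\<close>, which \<open>spectral_distribution\<close> supplies.\<close>

lemma semicircle_moments:
  assumes "0 \<le> \<sigma>" and prob: "real_distribution (semicircle \<sigma>)"
  shows "(\<integral>x. x ^ k \<partial>semicircle \<sigma>) = \<sigma> ^ k * sc_moment k"
proof (rule moments_eq_sc_moment)
  interpret real_distribution "semicircle \<sigma>" by fact
  show "(\<integral>x. x ^ 0 \<partial>semicircle \<sigma>) = 1" using prob_space by simp
  fix j
  show "(real j + 3) * (\<integral>x. x ^ Suc j \<partial>semicircle \<sigma>) = 4 * real j * \<sigma>\<^sup>2 * (\<integral>x. x ^ (j - 1) \<partial>semicircle \<sigma>)"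
  proof (cases "\<sigma> = 0")
    case True
    have "(\<integral>x. x ^ Suc j \<partial>return borel (0::real)) = 0"
      by (subst integral_return) auto
    then show ?thesis by (simp add: semicircle_def True)
  next
    case False
    then have \<sigma>: "0 < \<sigma>" using assms(1) by simp
    define u where "u x = 4 * \<sigma>\<^sup>2 - x\<^sup>2" for x
    have u_pos: "u x > 0" if "x \<in> {-2*\<sigma><..<2*\<sigma>}" for x
    proof -
      have "\<not> \<bar>2 * \<sigma>\<bar> \<le> \<bar>x\<bar>" using that \<sigma> by auto
      then have "\<not> (2 * \<sigma>)\<^sup>2 \<le> x\<^sup>2" unfolding abs_le_square_iff .
      then show ?thesis by (simp add: u_def power_mult_distrib)
    qed
    have u_nn: "u x \<ge> 0" if "x \<in> {-2*\<sigma>..2*\<sigma>}" for x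
    proof -
      have "\<bar>x\<bar> \<le> \<bar>2 * \<sigma>\<bar>" using that \<sigma> by auto
      then have "x\<^sup>2 \<le> (2 * \<sigma>)\<^sup>2" by (simp only: abs_le_square_iff)
      then show ?thesis by (simp add: u_def power_mult_distrib)
    qed
    let ?I = "{-2*\<sigma>..2*\<sigma>}"
    define w where "w = 1 / (2 * pi * \<sigma>\<^sup>2)"
    have si: "set_integrable lborel ?I (\<lambda>x. x ^ m * sqrt (u x))" for m
      unfolding u_def by (intro borel_integrable_atLeastAtMost' continuous_intros)
    have mom: "(\<integral>x. x ^ m \<partial>semicircle \<sigma>) = w * integral ?I (\<lambda>x. x ^ m * sqrt (u x))" for m
    proof -
      have "(\<integral>x. x ^ m \<partial>semicircle \<sigma>) = (\<integral>x. (w * sqrt (u x) * indicator ?I x) * x ^ m \<partial>lborel)"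
        unfolding semicircle_def using False u_nn
        by (subst if_not_P, simp, subst integral_density) (auto simp: w_def u_def indicator_def intro!: Bochner_Integration.integral_cong)
      also have "\<dots> = (\<integral>x. w * (indicator ?I x *\<^sub>R (x ^ m * sqrt (u x))) \<partial>lborel)"
        by (intro Bochner_Integration.integral_cong) auto
      also have "\<dots> = w * (LINT x:?I|lborel. x ^ m * sqrt (u x))"
        unfolding set_lebesgue_integral_def by simp
      also have "(LINT x:?I|lborel. x ^ m * sqrt (u x)) = integral ?I (\<lambda>x. x ^ m * sqrt (u x))"
        by (rule set_borel_integral_eq_integral(2)[OF si])
      finally show ?thesis .
    qed
    have int: "(\<lambda>x. x ^ m * sqrt (u x)) integrable_on ?I" for m
      by (rule set_borel_integral_eq_integral(1)[OF si])
    define F where "F x = x ^ j * (u x * sqrt (u x))" for x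
    define F' where "F' x = 4 * real j * \<sigma>\<^sup>2 * (x ^ (j - 1) * sqrt (u x)) - (real j + 3) * (x ^ Suc j * sqrt (u x))" for x
    have "(F' has_integral (F (2 * \<sigma>) - F (-2 * \<sigma>))) ?I"
    proof (rule fundamental_theorem_of_calculus_interior)
      show "-2 * \<sigma> \<le> 2 * \<sigma>" using \<sigma> by simp
      show "continuous_on ?I F" unfolding F_def u_def by (intro continuous_intros)
      fix x assume x: "x \<in> {-2*\<sigma><..<2*\<sigma>}"
      have up: "u x > 0" by (rule u_pos[OF x])
      have du: "(u has_real_derivative (- 2 * x)) (at x)"
        unfolding u_def by (auto intro!: derivative_eq_intros)
      have "(F has_real_derivative (real j * x ^ (j - 1) * (u x * sqrt (u x)) +
          ((- 2 * x) * sqrt (u x) + (inverse (sqrt (u x)) / 2 * (- 2 * x)) * u x) * x ^ j)) (at x)"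
        unfolding F_def by (intro DERIV_mult' DERIV_mult DERIV_pow[THEN DERIV_cong] du DERIV_chain2[OF DERIV_real_sqrt du]) (use up in auto)
      moreover have "real j * x ^ (j - 1) * (u x * sqrt (u x)) +
          ((- 2 * x) * sqrt (u x) + (inverse (sqrt (u x)) / 2 * (- 2 * x)) * u x) * x ^ j = F' x"
      proof -
        have "inverse (sqrt (u x)) * u x = sqrt (u x)"
          using up by (metis divide_inverse less_imp_le mult.commute real_div_sqrt)
        moreover have "(inverse (sqrt (u x)) / 2 * (- 2 * x)) * u x = - x * (inverse (sqrt (u x)) * u x)"
          by simp
        ultimately have A: "(inverse (sqrt (u x)) / 2 * (- 2 * x)) * u x = - x * sqrt (u x)"
          by (simp only:)
        have B: "real j * x ^ (j - 1) * (u x * sqrt (u x)) = 4 * real j * \<sigma>\<^sup>2 * (x ^ (j - 1) * sqrt (u x)) - real j * (x ^ Suc j * sqrt (u x))"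
          unfolding u_def by (cases j) (simp_all add: algebra_simps power2_eq_square)
        show ?thesis unfolding F'_def A B by (simp add: algebra_simps)
      qed
      ultimately show "(F has_vector_derivative F' x) (at x)"
        by (simp add: has_real_derivative_iff_has_vector_derivative)
    qed
    moreover have "F (2 * \<sigma>) = 0" "F (-2 * \<sigma>) = 0"
      by (simp_all add: F_def u_def power_mult_distrib)
    ultimately have "integral ?I F' = 0"
      by (metis diff_zero integral_unique)
    moreover have "integral ?I F' = 4 * real j * \<sigma>\<^sup>2 * integral ?I (\<lambda>x. x ^ (j - 1) * sqrt (u x)) -
        (real j + 3) * integral ?I (\<lambda>x. x ^ Suc j * sqrt (u x))"
      unfolding F'_def using int by (subst Henstock_Kurzweil_Integration.integral_diff) (auto intro!: integrable_on_mult_right simp del: power_Suc)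
    ultimately have "(real j + 3) * integral ?I (\<lambda>x. x ^ Suc j * sqrt (u x)) = 4 * real j * \<sigma>\<^sup>2 * integral ?I (\<lambda>x. x ^ (j - 1) * sqrt (u x))"
      by linarith
    then show ?thesis
      unfolding mom by (simp add: mult.left_commute[of _ w] del: power_Suc)
  qed
qed

section \<open>Moments of the matrix process\<close>

lemma powr_square: "(x powr H)\<^sup>2 = x powr (2 * H)" for x H :: real
  by (simp add: power2_eq_square powr_add[symmetric])

text \<open>Expanding the second moment of the combination requires integrability of the product of
  \<open>X s\<close> and \<open>X t\<close>, obtained by polarisation from Gaussian combinations.
  The second moment then determines the standard deviation, which \<open>centered_gaussian\<close>
  leaves open.\<close>

lemma fractional_BM_combination:
  fixes X :: "real \<Rightarrow> 'w \<Rightarrow> real"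
  assumes "prob_space M" and X: "fractional_BM M H X" and st: "0 \<le> s" "0 \<le> t" and \<sigma>: "0 \<le> \<sigma>"
    and \<sigma>2: "\<sigma>\<^sup>2 = c\<^sup>2 * fbm_cov H s s + 2 * c * d * fbm_cov H s t + d\<^sup>2 * fbm_cov H t t"
  shows "distr M borel (\<lambda>z. c * X s z + d * X t z) = centered_normal \<sigma>"
    and "X t \<in> borel_measurable M"
proof -
  interpret prob_space M by fact
  have gauss: "centered_gaussian M (\<lambda>z. c * X s z + d * X t z)" for c d
  proof -
    have "centered_gaussian M (\<lambda>z. \<Sum>i<2. (if i = 0 then c else d) * X (if i = (0::nat) then s else t) z)"
      using X st unfolding fractional_BM_def centered_gaussian_process_def
      by (elim conjE allE[of _ "2::nat"] allE[of _ "\<lambda>i. if i = 0 then c else d"] allE[of _ "\<lambda>i. if i = (0::nat) then s else t"]) simp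
    then show ?thesis by (simp add: numeral_2_eq_2)
  qed
  have sq: "integrable M (\<lambda>z. (c * X s z + d * X t z)\<^sup>2)" for c d
    using gauss[of c d] centered_normal_moments(1)[of "\<lambda>z. c * X s z + d * X t z" M _ 2]
    unfolding centered_gaussian_def by auto
  have i1: "integrable M (\<lambda>z. X s z * X s z)" and i2: "integrable M (\<lambda>z. X t z * X t z)"
    using sq[of 1 0] sq[of 0 1] by (simp_all add: power2_eq_square)
  have "integrable M (\<lambda>z. ((1 * X s z + 1 * X t z)\<^sup>2 - X s z * X s z - X t z * X t z) / 2)"
    using sq[of 1 1] i1 i2 by (intro Bochner_Integration.integrable_diff integrable_divide_zero) auto
  then have i3: "integrable M (\<lambda>z. X s z * X t z)"
    by (simp add: power2_eq_square algebra_simps)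
  have cov: "(\<integral>z. X s z * X s z \<partial>M) = fbm_cov H s s" "(\<integral>z. X s z * X t z \<partial>M) = fbm_cov H s t"
    "(\<integral>z. X t z * X t z \<partial>M) = fbm_cov H t t"
    using X st unfolding fractional_BM_def by auto
  obtain \<sigma>' where \<sigma>': "0 \<le> \<sigma>'" "distr M borel (\<lambda>z. c * X s z + d * X t z) = centered_normal \<sigma>'"
    and meas: "(\<lambda>z. c * X s z + d * X t z) \<in> borel_measurable M"
    using gauss[of c d] unfolding centered_gaussian_def by auto
  have "\<sigma>'\<^sup>2 = (\<integral>z. (c * X s z + d * X t z)\<^sup>2 \<partial>M)"
    using centered_normal_moments(2)[OF meas \<sigma>'(2,1), of 1] by (simp add: prob_space numeral_2_eq_2)
  also have "\<dots> = (\<integral>z. c\<^sup>2 * (X s z * X s z) + 2 * c * d * (X s z * X t z) + d\<^sup>2 * (X t z * X t z) \<partial>M)"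
    by (intro Bochner_Integration.integral_cong) (auto simp: power2_eq_square algebra_simps)
  also have "\<dots> = \<sigma>\<^sup>2"
    unfolding \<sigma>2 using i1 i2 i3 cov by simp
  finally have "\<sigma>' = \<sigma>" using \<sigma> \<sigma>'(1) by (simp add: power2_eq_iff_nonneg)
  then show "distr M borel (\<lambda>z. c * X s z + d * X t z) = centered_normal \<sigma>" using \<sigma>'(2) by simp
  show "X t \<in> borel_measurable M"
    using gauss[of 0 1] by (simp add: centered_gaussian_def)
qed

lemma fbm_cov_diag: "0 \<le> t \<Longrightarrow> fbm_cov H t t = t powr (2 * H)"
  by (simp add: fbm_cov_def)

locale matrix_fbm = prob_space M for M :: "'w measure" +
  fixes H :: real and n :: nat and b :: "nat \<Rightarrow> nat \<Rightarrow> real \<Rightarrow> 'w \<Rightarrow> real"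
  assumes H: "1 / 2 < H" "H < 1" and n_pos: "n \<ge> 1" and indep: "indep_fractional_BMs M H n b"
begin

definition entry :: "real \<Rightarrow> 'w \<Rightarrow> nat \<Rightarrow> nat \<Rightarrow> real" where
  "entry t z = sym_entry n (\<lambda>i j. b i j t z)"

definition Y :: "nat \<Rightarrow> real \<Rightarrow> 'w \<Rightarrow> real" where
  "Y k t z = ntr n (entry t z) k"

lemma fbm: "i \<le> j \<Longrightarrow> j < n \<Longrightarrow> fractional_BM M H (b i j)"
  using indep by (simp add: indep_fractional_BMs_def)

text \<open>The two-parameter form covers a fixed time (c = 0, d = 1) and an increment (c = -1, d =
  1) alike. Independence of the processes as path-valued variables passes to functions of their
  values at s and t.\<close>

lemma goe_combination:
  assumes st: "0 \<le> s" "0 \<le> t" and \<sigma>: "0 \<le> \<sigma>"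
    and \<sigma>2: "\<sigma>\<^sup>2 = c\<^sup>2 * fbm_cov H s s + 2 * c * d * fbm_cov H s t + d\<^sup>2 * fbm_cov H t t"
  shows "goe M n \<sigma> (\<lambda>z. sym_entry n (\<lambda>i j. c * b i j s z + d * b i j t z))"
proof (rule goe_of_indep_normal[OF prob_space_axioms n_pos \<sigma>])
  have "indep_vars (\<lambda>_. \<Pi>\<^sub>M t\<in>{0..}. borel) (\<lambda>(i, j) z. \<lambda>t\<in>{0..}. b i j t z) {(i, j). i \<le> j \<and> j < n}"
    using indep by (simp add: indep_fractional_BMs_def)
  then have "indep_vars (\<lambda>_. borel) (\<lambda>p z. (\<lambda>f. c * f s + d * f t) ((case p of (i, j) \<Rightarrow> \<lambda>z. \<lambda>t\<in>{0..}. b i j t z) z)) {(i, j). i \<le> j \<and> j < n}"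
  proof (rule indep_vars_compose2)
    show "(\<lambda>f. c * f s + d * f t) \<in> borel_measurable (\<Pi>\<^sub>M t\<in>{0..}. borel)"
      using st by (intro borel_measurable_add borel_measurable_times borel_measurable_const measurable_component_singleton) auto
  qed
  moreover have "(\<lambda>p z. (\<lambda>f. c * f s + d * f t) ((case p of (i, j) \<Rightarrow> \<lambda>z. \<lambda>t\<in>{0..}. b i j t z) z)) =
      (\<lambda>(i, j) z. c * b i j s z + d * b i j t z)"
    using st by (auto simp: fun_eq_iff)
  ultimately show "indep_vars (\<lambda>_. borel) (\<lambda>(i, j) z. c * b i j s z + d * b i j t z) {(i, j). i \<le> j \<and> j < n}"
    by simp
  show "distr M borel (\<lambda>z. c * b i j s z + d * b i j t z) = centered_normal \<sigma>" if "i \<le> j" "j < n" for i j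
    by (rule fractional_BM_combination(1)[OF prob_space_axioms fbm[OF that] st \<sigma> \<sigma>2])
qed

lemma goe_entry: "0 \<le> t \<Longrightarrow> goe M n (t powr H) (entry t)"
  using goe_combination[of t t "t powr H" 0 1] by (simp add: powr_square fbm_cov_diag entry_def[abs_def])

lemma goe_increment:
  assumes "0 \<le> s" "0 \<le> t"
  shows "goe M n (\<bar>t - s\<bar> powr H) (\<lambda>z i j. entry t z i j - entry s z i j)"
proof -
  have "goe M n (\<bar>t - s\<bar> powr H) (\<lambda>z. sym_entry n (\<lambda>i j. - 1 * b i j s z + 1 * b i j t z))"
    using assms by (intro goe_combination) (auto simp: powr_square fbm_cov_diag, simp add: fbm_cov_def field_simps)
  also have "(\<lambda>z. sym_entry n (\<lambda>i j. - 1 * b i j s z + 1 * b i j t z)) = (\<lambda>z i j. entry t z i j - entry s z i j)"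
    by (auto simp: fun_eq_iff entry_def sym_entry_def diff_divide_distrib[symmetric] right_diff_distrib)
  finally show ?thesis .
qed

lemma entry_sym: "entry t z i j = entry t z j i"
  by (simp add: entry_def sym_entry_def min.commute max.commute)

lemma Y_measurable [measurable]:
  assumes "0 \<le> t"
  shows "Y k t \<in> borel_measurable M"
proof -
  have e: "(\<lambda>z. entry t z i j) \<in> borel_measurable M" if "i < n" "j < n" for i j
  proof -
    have [measurable]: "b i' j' t \<in> borel_measurable M" if "i' \<le> j'" "j' < n" for i' j'
      by (rule fractional_BM_combination(2)[OF prob_space_axioms fbm[OF that] assms assms, of "t powr H" 0 1])
        (simp_all add: powr_square fbm_cov_diag assms)
    have "b i i t \<in> borel_measurable M" "b (min i j) (max i j) t \<in> borel_measurable M"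
      using that by auto
    then show ?thesis
      unfolding entry_def sym_entry_def by (cases "i = j") auto
  qed
  have "(\<lambda>z. mpow n (entry t z) k i j) \<in> borel_measurable M" if "i < n" for i j
    using that by (induction k arbitrary: i) (auto intro!: borel_measurable_sum borel_measurable_times e)
  then show ?thesis
    unfolding Y_def[abs_def] ntr_def by (intro borel_measurable_divide borel_measurable_sum) auto
qed

lemma Y_continuous:
  assumes z: "z \<in> space M"
  shows "continuous_on {0..} (\<lambda>t. Y k t z)"
proof -
  have b: "continuous_on {0..} (\<lambda>t. b i j t z)" if "i \<le> j" "j < n" for i j
    using fbm[OF that] z by (simp add: fractional_BM_def)
  have e: "continuous_on {0..} (\<lambda>t. entry t z i j)" if "i < n" "j < n" for i j
  proof -
    have "continuous_on {0..} (\<lambda>t. b i i t z)" "continuous_on {0..} (\<lambda>t. b (min i j) (max i j) t z)"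
      using that by (auto intro!: b)
    then show ?thesis
      unfolding entry_def sym_entry_def using n_pos by (cases "i = j") (auto intro!: continuous_intros)
  qed
  have "continuous_on {0..} (\<lambda>t. mpow n (entry t z) k i j)" if "i < n" for i j
    using that by (induction k arbitrary: i) (auto intro!: continuous_on_sum continuous_on_mult e)
  then show ?thesis
    unfolding Y_def ntr_def using n_pos by (intro continuous_on_divide continuous_on_sum) auto
qed

end

section \<open>Increments in time and uniform convergence of the moments\<close>

lemma powr_subadditive:
  fixes s t H :: real
  assumes "0 \<le> s" "s \<le> t" "0 < H" "H \<le> 1"
  shows "t powr H - s powr H \<le> (t - s) powr H"
proof (cases "t = 0")
  case False
  then have t: "t > 0" using assms by simp
  have u: "u \<le> u powr H" if "0 \<le> u" "u \<le> 1" for u :: real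
    using powr_mono'[of H 1 u] that assms by (cases "u = 0") auto
  have "1 = s / t + (t - s) / t" using t by (simp add: field_simps)
  also have "\<dots> \<le> (s / t) powr H + ((t - s) / t) powr H"
    using t assms by (intro add_mono u) auto
  also have "\<dots> = (s powr H + (t - s) powr H) / t powr H"
    using t assms by (simp add: powr_divide add_divide_distrib)
  finally show ?thesis using t by (simp add: le_divide_eq)
qed (use assms in auto)

lemma abs_power_diff_le:
  fixes x y R :: real
  assumes "0 \<le> x" "x \<le> R" "0 \<le> y" "y \<le> R"
  shows "\<bar>x ^ k - y ^ k\<bar> \<le> real k * R ^ (k - 1) * \<bar>x - y\<bar>"
proof (cases k)
  case (Suc m)
  have "x ^ Suc m - y ^ Suc m = (x - y) * (\<Sum>p<Suc m. x ^ p * y ^ (m - p))"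
    by (rule power_diff_sumr2[THEN trans]) (simp add: mult.commute)
  then have "\<bar>x ^ k - y ^ k\<bar> = \<bar>x - y\<bar> * \<bar>\<Sum>p<Suc m. x ^ p * y ^ (m - p)\<bar>"
    using Suc by (simp only: abs_mult)
  also have "\<dots> \<le> \<bar>x - y\<bar> * (\<Sum>p<Suc m. R ^ m)"
  proof (intro mult_left_mono order_trans[OF sum_abs] sum_mono)
    fix p assume "p \<in> {..<Suc m}"
    then have "R ^ m = R ^ p * R ^ (m - p)" by (simp flip: power_add)
    then show "\<bar>x ^ p * y ^ (m - p)\<bar> \<le> R ^ m"
      using assms by (simp add: abs_mult power_abs) (intro mult_mono power_mono, auto)
  qed simp
  finally show ?thesis using Suc by (simp add: mult_ac)
qed simp

text \<open>The minimum of two bounds is at most their geometric mean, here with weights \<theta>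
  and 1 - \<theta>.\<close>

lemma min_interpolation:
  fixes h x C N A \<theta> :: real
  assumes "0 \<le> h" "1 \<le> N" "0 < A" "0 < \<theta>" "\<theta> < 1" "0 \<le> C" "x \<le> C * h powr A" "x \<le> C / N"
  shows "x \<le> C * N powr (- (1 - \<theta>)) * h powr (A * \<theta>)"
proof -
  have inv: "(1 / N) powr (1 - \<theta>) = N powr (- (1 - \<theta>))"
    using assms by (simp only: powr_minus_divide) (simp add: powr_divide)
  have pp: "h powr (A * \<theta>) = (h powr A) powr \<theta>"
    by (simp add: powr_powr)
  show ?thesis
  proof (cases "h powr A \<le> 1 / N")
    case True
    have "h powr A = (h powr A) powr \<theta> * (h powr A) powr (1 - \<theta>)"
      using assms by (cases "h = 0") (simp_all add: powr_powr powr_add[symmetric] algebra_simps)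
    also have "\<dots> \<le> (h powr A) powr \<theta> * (1 / N) powr (1 - \<theta>)"
      using True assms by (intro mult_left_mono powr_mono2) auto
    also have "\<dots> = N powr (- (1 - \<theta>)) * h powr (A * \<theta>)"
      by (simp only: inv pp mult.commute)
    finally have "C * h powr A \<le> C * (N powr (- (1 - \<theta>)) * h powr (A * \<theta>))"
      using assms by (intro mult_left_mono)
    then show ?thesis using assms by (simp add: mult.assoc)
  next
    case False
    have "1 / N = (1 / N) powr (1 - \<theta>) * (1 / N) powr \<theta>"
      using assms by (simp add: powr_add[symmetric])
    also have "\<dots> \<le> (1 / N) powr (1 - \<theta>) * (h powr A) powr \<theta>"
      using False assms by (intro mult_left_mono powr_mono2) auto
    also have "\<dots> = N powr (- (1 - \<theta>)) * h powr (A * \<theta>)"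
      by (simp only: inv pp mult.commute)
    finally have "C * (1 / N) \<le> C * (N powr (- (1 - \<theta>)) * h powr (A * \<theta>))"
      using assms by (intro mult_left_mono)
    then show ?thesis using assms by (simp add: mult.assoc)
  qed
qed

text \<open>\<open>ntr_diff_le\<close> leaves products of the second moment \<open>d\<close> of the
  increment matrix, of size v = (t - s)^(2H), with traces at the two times. These factors are
  dependent; AM-GM with weight v separates them into \<open>d\<close>^2 / v and v times squared
  traces, both of expectation O(v).\<close>

lemma Y_increment:
  fixes H T :: real
  assumes T: "0 \<le> T"
  shows "\<exists>C\<ge>0. \<forall>(M :: 'w measure) n b s t. matrix_fbm M H n b \<and> 0 \<le> s \<and> s \<le> t \<and> t \<le> T \<longrightarrow>
    (\<integral>z. (matrix_fbm.Y n b k t z - matrix_fbm.Y n b k s z)\<^sup>2 \<partial>M) \<le> C * (t - s) powr (2 * H)"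
proof -
  have "\<forall>k. \<exists>C\<ge>0. \<forall>(M :: 'w measure) n s A. goe M n s A \<and> 0 \<le> s \<longrightarrow>
     integrable M (\<lambda>z. (ntr n (A z) k)\<^sup>2) \<and> (\<integral>z. (ntr n (A z) k)\<^sup>2 \<partial>M) \<le> C * s ^ (2 * k)"
    using goe_second_moment by blast
  then obtain C where C: "\<And>k. C k \<ge> 0"
    "\<And>k (M :: 'w measure) n s A. goe M n s A \<Longrightarrow> 0 \<le> s \<Longrightarrow> integrable M (\<lambda>z. (ntr n (A z) k)\<^sup>2)"
    "\<And>k (M :: 'w measure) n s A. goe M n s A \<Longrightarrow> 0 \<le> s \<Longrightarrow> (\<integral>z. (ntr n (A z) k)\<^sup>2 \<partial>M) \<le> C k * s ^ (2 * k)"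
    unfolding choice_iff by metis
  define B where "B m = C m * (T powr H) ^ (2 * m)" for m
  have B: "B m \<ge> 0" for m using C(1) by (simp add: B_def)
  define K where "K = real k * (\<Sum>l<k. (2 * C 2 + B (4 * l) + B (4 * (k - 1 - l))) / 4)"
  have K: "K \<ge> 0" unfolding K_def using C(1) B by (intro mult_nonneg_nonneg sum_nonneg) auto
  have "(\<integral>z. (matrix_fbm.Y n b k t z - matrix_fbm.Y n b k s z)\<^sup>2 \<partial>M) \<le> K * (t - s) powr (2 * H)"
    if mf: "matrix_fbm M H n b" and st: "0 \<le> s" "s \<le> t" "t \<le> T" for M :: "'w measure" and n b s t
  proof (cases "s = t")
    case False
    interpret matrix_fbm M H n b by fact
    define v where "v = (t - s) powr (2 * H)"
    have v: "v > 0" using False st by (simp add: v_def)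
    define d where "d z = ntr n (\<lambda>i j. entry t z i j - entry s z i j) 2" for z
    have d: "integrable M (\<lambda>z. (d z)\<^sup>2)" "expectation (\<lambda>z. (d z)\<^sup>2) \<le> C 2 * v\<^sup>2"
    proof -
      have g: "goe M n (\<bar>t - s\<bar> powr H) (\<lambda>z i j. entry t z i j - entry s z i j)"
        using st by (intro goe_increment) auto
      show "integrable M (\<lambda>z. (d z)\<^sup>2)" unfolding d_def by (rule C(2)[OF g]) simp
      have "(\<bar>t - s\<bar> powr H) ^ (2 * 2) = v\<^sup>2"
        unfolding power_mult powr_square v_def using st by simp
      then show "expectation (\<lambda>z. (d z)\<^sup>2) \<le> C 2 * v\<^sup>2"
        using C(3)[OF g, of 2] unfolding d_def by simp
    qed
    have q: "integrable M (\<lambda>z. (Y m r z)\<^sup>2)" "expectation (\<lambda>z. (Y m r z)\<^sup>2) \<le> B m" if "0 \<le> r" "r \<le> T" for m r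
    proof -
      show "integrable M (\<lambda>z. (Y m r z)\<^sup>2)" unfolding Y_def by (rule C(2)[OF goe_entry]) (use that in auto)
      have "expectation (\<lambda>z. (Y m r z)\<^sup>2) \<le> C m * (r powr H) ^ (2 * m)"
        unfolding Y_def by (rule C(3)[OF goe_entry]) (use that in auto)
      also have "\<dots> \<le> B m"
        unfolding B_def using C(1) that H by (intro mult_left_mono power_mono powr_mono2) auto
      finally show "expectation (\<lambda>z. (Y m r z)\<^sup>2) \<le> B m" .
    qed
    let ?g = "\<lambda>l z. 2 * ((d z)\<^sup>2 / v) + v * (Y (4 * l) t z)\<^sup>2 + v * (Y (4 * (k - 1 - l)) s z)\<^sup>2"
    have int_g: "integrable M (?g l)" for l
      using d q st by (intro Bochner_Integration.integrable_add integrable_mult_right integrable_divide_zero) auto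
    have amgm: "x * (y + z) / 2 \<le> (2 * (x\<^sup>2 / v) + v * y\<^sup>2 + v * z\<^sup>2) / 4" for x y z :: real
    proof -
      have "0 \<le> (x - v * y)\<^sup>2 / v + (x - v * z)\<^sup>2 / v" using v by simp
      also have "\<dots> = 2 * (x\<^sup>2 / v) + v * y\<^sup>2 + v * z\<^sup>2 - 2 * x * (y + z)"
        using v by (simp add: power2_eq_square field_simps)
      finally show ?thesis by (simp add: field_simps)
    qed
    have pw: "(Y k t z - Y k s z)\<^sup>2 \<le> real k * (\<Sum>l<k. ?g l z / 4)" for z
    proof -
      have "(Y k t z - Y k s z)\<^sup>2 \<le> real k * (\<Sum>l<k. d z * (Y (4 * l) t z + Y (4 * (k - 1 - l)) s z) / 2)"
        unfolding Y_def d_def by (rule ntr_diff_le[OF entry_sym entry_sym n_pos])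
      also have "\<dots> \<le> real k * (\<Sum>l<k. ?g l z / 4)"
        by (intro mult_left_mono sum_mono amgm) simp
      finally show ?thesis .
    qed
    have ig: "integrable M (\<lambda>z. real k * (\<Sum>l<k. ?g l z / 4))"
      by (intro integrable_mult_right Bochner_Integration.integrable_sum integrable_divide_zero int_g)
    have [measurable]: "Y k t \<in> borel_measurable M" "Y k s \<in> borel_measurable M"
      using st by (auto intro: Y_measurable)
    have "expectation (\<lambda>z. (Y k t z - Y k s z)\<^sup>2) \<le> expectation (\<lambda>z. real k * (\<Sum>l<k. ?g l z / 4))"
    proof (rule integral_mono[OF _ ig pw])
      show "integrable M (\<lambda>z. (Y k t z - Y k s z)\<^sup>2)"
        by (rule Bochner_Integration.integrable_bound[OF ig])
          (use pw in \<open>auto intro!: AE_I2 order_trans[OF _ abs_ge_self]\<close>)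
    qed
    also have "\<dots> = real k * (\<Sum>l<k. expectation (?g l) / 4)"
      using int_g by (subst integral_mult_right_zero, subst Bochner_Integration.integral_sum) auto
    also have "\<dots> \<le> real k * (\<Sum>l<k. v * ((2 * C 2 + B (4 * l) + B (4 * (k - 1 - l))) / 4))"
    proof (intro mult_left_mono sum_mono)
      fix l
      have "expectation (?g l) = 2 * (expectation (\<lambda>z. (d z)\<^sup>2) / v) + v * expectation (\<lambda>z. (Y (4 * l) t z)\<^sup>2) + v * expectation (\<lambda>z. (Y (4 * (k - 1 - l)) s z)\<^sup>2)"
        using d(1) q(1) st by (simp add: integrable_divide_zero)
      also have "\<dots> \<le> 2 * (C 2 * v\<^sup>2 / v) + v * B (4 * l) + v * B (4 * (k - 1 - l))"
        using d(2) q(2) st v by (intro add_mono mult_left_mono divide_right_mono) auto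
      also have "\<dots> = v * (2 * C 2 + B (4 * l) + B (4 * (k - 1 - l)))"
        using v by (simp add: power2_eq_square algebra_simps)
      finally show "expectation (?g l) / 4 \<le> v * ((2 * C 2 + B (4 * l) + B (4 * (k - 1 - l))) / 4)"
        by simp
    qed simp
    also have "\<dots> = K * v"
      unfolding K_def by (simp add: sum_distrib_left mult_ac)
    finally show ?thesis by (simp add: v_def)
  qed simp
  then show ?thesis using K by blast
qed

lemma uniform_moment_convergence:
  fixes H T \<epsilon> :: real
  assumes H: "1 / 2 < H" "H < 1" and T: "0 \<le> T" and \<epsilon>: "0 < \<epsilon>"
  shows "\<exists>C\<ge>0. \<forall>(M :: 'w measure) n b. matrix_fbm M H n b \<longrightarrow>
    (\<exists>E\<in>sets M. measure M E \<le> C * real n powr (- ((2 * H - 1) / (4 * H))) \<and>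
      (\<forall>z\<in>space M - E. \<forall>t\<in>{0..T}. \<bar>matrix_fbm.Y n b k t z - (t powr H) ^ k * sc_moment k\<bar> \<le> \<epsilon>))"
proof -
  \<comment> \<open>With this \<theta> the product 2 H \<theta> is H + 1/2, the midpoint between 1
    and 2 H; the complementary weight 1 - \<theta> is the power of 1/n that is gained.\<close>
  define \<theta> where "\<theta> = (2 * H + 1) / (4 * H)"
  have \<theta>: "0 < \<theta>" "\<theta> < 1" "1 < 2 * H * \<theta>" "1 - \<theta> = (2 * H - 1) / (4 * H)"
    using H by (auto simp: \<theta>_def field_simps)
  define R where "R = T powr H"
  have R: "0 \<le> R" by (simp add: R_def)
  define y where "y t = (t powr H) ^ k * sc_moment k" for t
  obtain C1 where C1: "C1 \<ge> 0" "\<And>(M :: 'w measure) n s A. goe M n s A \<Longrightarrow> 0 \<le> s \<Longrightarrow>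
     (\<integral>z. (ntr n (A z) k - s ^ k * sc_moment k)\<^sup>2 \<partial>M) \<le> C1 * s ^ (2 * k) / real n"
    using goe_variance[of k] by blast
  obtain C2 where C2: "C2 \<ge> 0" "\<And>(M :: 'w measure) n b s t. matrix_fbm M H n b \<Longrightarrow> 0 \<le> s \<Longrightarrow> s \<le> t \<Longrightarrow> t \<le> T \<Longrightarrow>
    (\<integral>z. (matrix_fbm.Y n b k t z - matrix_fbm.Y n b k s z)\<^sup>2 \<partial>M) \<le> C2 * (t - s) powr (2 * H)"
    using Y_increment[OF T, where k = k and H = H] by blast
  define L where "L = real k * R ^ (k - 1) * \<bar>sc_moment k\<bar>"
  have L: "0 \<le> L" using R by (simp add: L_def)
  have y_inc: "(y t - y s)\<^sup>2 \<le> L\<^sup>2 * (t - s) powr (2 * H)" if "0 \<le> s" "s \<le> t" "t \<le> T" for s t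
  proof -
    have "t powr H \<le> R" "s powr H \<le> R" "s powr H \<le> t powr H"
      unfolding R_def using that H by (auto intro!: powr_mono2)
    then have "\<bar>(t powr H) ^ k - (s powr H) ^ k\<bar> \<le> real k * R ^ (k - 1) * \<bar>t powr H - s powr H\<bar>"
      by (intro abs_power_diff_le) auto
    also have "\<bar>t powr H - s powr H\<bar> \<le> (t - s) powr H"
      using powr_subadditive[of s t H] that H \<open>s powr H \<le> t powr H\<close> by simp
    finally have "\<bar>(t powr H) ^ k - (s powr H) ^ k\<bar> * \<bar>sc_moment k\<bar> \<le> real k * R ^ (k - 1) * (t - s) powr H * \<bar>sc_moment k\<bar>"
      using R by (simp add: mult_left_mono mult_right_mono)
    then have "\<bar>y t - y s\<bar> \<le> L * (t - s) powr H"
      unfolding y_def L_def left_diff_distrib[symmetric] abs_mult by (simp add: mult_ac)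
    then have "\<bar>y t - y s\<bar>\<^sup>2 \<le> (L * (t - s) powr H)\<^sup>2"
      by (intro power_mono) auto
    then show ?thesis by (simp add: power_mult_distrib powr_square)
  qed
  \<comment> \<open>Three constants are majorised at once: that of the increments of
    \<open>Z\<close>, that of their bound by the variances at both ends, and that of the
    start.\<close>
  define D where "D = (2 * C2 + 2 * L\<^sup>2) + 4 * C1 * R ^ (2 * k) + C1"
  have D: "D \<ge> 0" using C1(1) C2(1) R by (simp add: D_def)
  obtain C where C: "C \<ge> 0" "\<And>(M :: 'w measure) Z K. mean_square_hoelder M T K (2 * H * \<theta>) Z \<Longrightarrow>
     (\<exists>E\<in>sets M. measure M E \<le> C * K \<and> (\<forall>z\<in>space M - E. \<forall>t\<in>{0..T}. \<bar>Z t z\<bar> \<le> \<epsilon>))"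
    using chaining[OF T \<theta>(3) \<epsilon>] by blast
  have "\<exists>E\<in>sets M. measure M E \<le> (C * D) * real n powr (- (1 - \<theta>)) \<and>
      (\<forall>z\<in>space M - E. \<forall>t\<in>{0..T}. \<bar>matrix_fbm.Y n b k t z - y t\<bar> \<le> \<epsilon>)"
    if mf: "matrix_fbm M H n b" for M :: "'w measure" and n b
  proof -
    interpret matrix_fbm M H n b by fact
    define K where "K = D * real n powr (- (1 - \<theta>))"
    define Z where "Z t z = Y k t z - y t" for t z
    have n1: "1 \<le> real n" using n_pos by simp
    have Zm: "Z t \<in> borel_measurable M" if "0 \<le> t" for t
      unfolding Z_def[abs_def] using Y_measurable[OF that] by simp
    have ntr_prod: "integrable M (Y k t)" "integrable M (\<lambda>z. (Y k t z)\<^sup>2)" if "0 \<le> t" for t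
    proof -
      interpret g: goe M n "t powr H" "entry t" by (rule goe_entry[OF that])
      show "integrable M (Y k t)" "integrable M (\<lambda>z. (Y k t z)\<^sup>2)"
        using g.integrable_ntr_prod[of "[k]"] g.integrable_ntr_prod[of "[k, k]"] unfolding Y_def[abs_def] power2_eq_square by simp_all
    qed
    have Z2: "integrable M (\<lambda>z. (Z t z)\<^sup>2)" if "0 \<le> t" for t
    proof -
      have "integrable M (\<lambda>z. (Y k t z)\<^sup>2 - 2 * y t * Y k t z + (y t)\<^sup>2)"
        using ntr_prod[OF that] by (intro Bochner_Integration.integrable_add Bochner_Integration.integrable_diff integrable_mult_right integrable_const) auto
      then show ?thesis unfolding Z_def by (simp add: power2_eq_square algebra_simps)
    qed
    have EZ: "expectation (\<lambda>z. (Z t z)\<^sup>2) \<le> C1 * (t powr H) ^ (2 * k) / real n" if "0 \<le> t" for t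
      using C1(2)[OF goe_entry[OF that]] unfolding Z_def y_def Y_def by simp
    have Z0: "expectation (\<lambda>z. (Z 0 z)\<^sup>2) \<le> K"
    proof -
      \<comment> \<open>For k = 0 the power \<open>(0 powr H) ^ (2 * k)\<close> is 1, hence the
        bound by 1 in the next line.\<close>
      have "expectation (\<lambda>z. (Z 0 z)\<^sup>2) \<le> C1 * (0 powr H) ^ (2 * k) / real n" by (rule EZ) simp
      also have "\<dots> \<le> C1 * 1 / real n"
        using C1(1) by (intro divide_right_mono mult_left_mono) (auto simp: power_le_one)
      also have "\<dots> \<le> D * (1 / real n)"
        using D C1(1) C2(1) R n1 unfolding D_def by (simp add: divide_right_mono)
      also have "\<dots> \<le> K"
      proof -
        have "1 / real n = real n powr (- 1)" using n1 by (simp add: powr_minus_divide)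
        also have "\<dots> \<le> real n powr (- (1 - \<theta>))" using n1 \<theta> by (intro powr_mono) auto
        finally show ?thesis unfolding K_def using D by (intro mult_left_mono) auto
      qed
      finally show ?thesis .
    qed
    have par: "(u - w)\<^sup>2 \<le> 2 * u\<^sup>2 + 2 * w\<^sup>2" for u w :: real
      using zero_le_power2[of "u + w"] by (simp add: power2_eq_square algebra_simps)
    have inc: "expectation (\<lambda>z. (Z t z - Z s z)\<^sup>2) \<le> K * (t - s) powr (2 * H * \<theta>)"
      if st: "0 \<le> s" "s \<le> t" "t \<le> T" for s t
    proof -
      have t0: "0 \<le> t" using st by simp
      have [measurable]: "Z t \<in> borel_measurable M" "Z s \<in> borel_measurable M" "Y k t \<in> borel_measurable M" "Y k s \<in> borel_measurable M"
        using Zm Y_measurable st t0 by auto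
      have iZ: "integrable M (\<lambda>z. (Z t z - Z s z)\<^sup>2)"
        by (rule Bochner_Integration.integrable_bound[of _ "\<lambda>z. 2 * (Z t z)\<^sup>2 + 2 * (Z s z)\<^sup>2"])
          (use Z2 st t0 par in \<open>auto intro!: AE_I2\<close>)
      have iY: "integrable M (\<lambda>z. (Y k t z - Y k s z)\<^sup>2)"
        by (rule Bochner_Integration.integrable_bound[of _ "\<lambda>z. 2 * (Y k t z)\<^sup>2 + 2 * (Y k s z)\<^sup>2"])
          (use ntr_prod st t0 par in \<open>auto intro!: AE_I2\<close>)
      have "expectation (\<lambda>z. (Z t z - Z s z)\<^sup>2) \<le> expectation (\<lambda>z. 2 * (Y k t z - Y k s z)\<^sup>2 + 2 * (y t - y s)\<^sup>2)"
      proof (rule integral_mono[OF iZ])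
        show "integrable M (\<lambda>z. 2 * (Y k t z - Y k s z)\<^sup>2 + 2 * (y t - y s)\<^sup>2)" using iY by simp
        show "(Z t z - Z s z)\<^sup>2 \<le> 2 * (Y k t z - Y k s z)\<^sup>2 + 2 * (y t - y s)\<^sup>2" for z
          using par[of "Y k t z - Y k s z" "y t - y s"] by (simp add: Z_def algebra_simps)
      qed
      also have "\<dots> = 2 * expectation (\<lambda>z. (Y k t z - Y k s z)\<^sup>2) + 2 * (y t - y s)\<^sup>2"
        using iY by (simp add: prob_space)
      also have "\<dots> \<le> 2 * (C2 * (t - s) powr (2 * H)) + 2 * (L\<^sup>2 * (t - s) powr (2 * H))"
        using C2(2)[OF mf st] y_inc[OF st] by simp
      also have "\<dots> = (2 * C2 + 2 * L\<^sup>2) * (t - s) powr (2 * H)"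
        by (simp add: algebra_simps)
      also have "\<dots> \<le> D * (t - s) powr (2 * H)"
        unfolding D_def using C1(1) R by (intro mult_right_mono) auto
      finally have b1: "expectation (\<lambda>z. (Z t z - Z s z)\<^sup>2) \<le> D * (t - s) powr (2 * H)" .
      have EZ': "expectation (\<lambda>z. (Z r z)\<^sup>2) \<le> C1 * R ^ (2 * k) / real n" if "0 \<le> r" "r \<le> T" for r
      proof -
        have "C1 * (r powr H) ^ (2 * k) / real n \<le> C1 * R ^ (2 * k) / real n"
          unfolding R_def using C1(1) that H by (intro divide_right_mono mult_left_mono power_mono powr_mono2) auto
        then show ?thesis using EZ[OF that(1)] by linarith
      qed
      have "expectation (\<lambda>z. (Z t z - Z s z)\<^sup>2) \<le> expectation (\<lambda>z. 2 * (Z t z)\<^sup>2 + 2 * (Z s z)\<^sup>2)"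
        using Z2 st t0 par by (intro integral_mono[OF iZ]) auto
      also have "\<dots> = 2 * expectation (\<lambda>z. (Z t z)\<^sup>2) + 2 * expectation (\<lambda>z. (Z s z)\<^sup>2)"
        using Z2 st t0 by simp
      also have "\<dots> \<le> 4 * (C1 * R ^ (2 * k) / real n)"
        using EZ'[of t] EZ'[of s] st by linarith
      also have "\<dots> = 4 * C1 * R ^ (2 * k) / real n" by simp
      also have "\<dots> \<le> D / real n"
        unfolding D_def using C1(1) C2(1) by (intro divide_right_mono) auto
      finally have b2: "expectation (\<lambda>z. (Z t z - Z s z)\<^sup>2) \<le> D / real n" .
      show ?thesis
        unfolding K_def using st n1 H \<theta> D b1 b2 by (intro min_interpolation) auto
    qed
    have "continuous_on {0..} (\<lambda>t. Z t z)" if "z \<in> space M" for z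
      unfolding Z_def y_def using H
      by (intro continuous_on_diff Y_continuous[OF that] continuous_on_mult continuous_on_power continuous_on_powr' continuous_intros) auto
    then have "\<exists>E\<in>sets M. prob E \<le> C * K \<and> (\<forall>z\<in>space M - E. \<forall>t\<in>{0..T}. \<bar>Z t z\<bar> \<le> \<epsilon>)"
      using prob_space_axioms Zm Z2 Z0 inc by (intro C(2)) (simp add: mean_square_hoelder_def)
    then show ?thesis by (simp only: K_def Z_def mult.assoc)
  qed
  then show ?thesis
    using C(1) D unfolding y_def \<theta>(4) by (intro exI[of _ "C * D"]) auto
qed

section \<open>The spectral process as a random path of measures\<close>

context matrix_fbm
begin

abbreviation X :: "'w \<Rightarrow> real \<Rightarrow> real measure" where
  "X \<equiv> spectral_empirical_process n b"

lemma renormalized_eq: "renormalized_matrix_fBM n b t z = mat n n (\<lambda>(i, j). entry t z i j)"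
  by (rule eq_matI) (auto simp: renormalized_matrix_fBM_def matrix_fBM_def entry_def sym_entry_def)

lemma real_distribution_X: "0 \<le> t \<Longrightarrow> real_distribution (X z t)"
  using real_distribution_empirical_measure[OF n_pos] by (simp add: spectral_empirical_process_def)

lemma X_moments:
  assumes "0 \<le> t"
  shows "integrable (X z t) (\<lambda>x. x ^ k)" "(\<integral>x. x ^ k \<partial>X z t) = Y k t z"
  using assms integral_empirical_measure[OF n_pos, of "\<lambda>x. x ^ k"] sum_ordered_eigenvalue_power[of "entry t z" n k, OF entry_sym]
  by (simp_all add: spectral_empirical_process_def renormalized_eq Y_def ntr_def)

lemma has_moments_X: "has_moments (X z)"
  by (simp add: has_moments_def real_distribution_X X_moments)

text \<open>Each squared eigenvalue is at most the trace of the squared matrix, n times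
  \<open>Y 2 t z\<close>, which is bounded on compact intervals by continuity. The radius depends on
  n and on the sample point; this is harmless, as the property concerns one path at a time.\<close>

lemma moments_locally_bounded_X:
  assumes z: "z \<in> space M"
  shows "moments_locally_bounded (X z)"
  unfolding moments_locally_bounded_def
proof
  fix T :: real
  have "continuous_on {0..T} (\<lambda>t. Y 2 t z)"
    by (rule continuous_on_subset[OF Y_continuous[OF z]]) auto
  then have "bounded ((\<lambda>t. Y 2 t z) ` {0..T})"
    by (intro compact_imp_bounded compact_continuous_image) auto
  then obtain B where "\<forall>t\<in>{0..T}. \<bar>Y 2 t z\<bar> \<le> B"
    unfolding bounded_iff by auto
  then have B: "\<bar>Y 2 t z\<bar> \<le> B" if "t \<in> {0..T}" for t
    using that by blast
  define R where "R = max 1 (sqrt (real n * B))"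
  have "(\<integral>x. x ^ (2 * q) \<partial>X z t) \<le> R ^ (2 * q)" if t: "t \<in> {0..T}" for t q
  proof -
    define x where "x = ordered_eigenvalue (mat n n (\<lambda>(i, j). entry t z i j))"
    have sum: "(\<Sum>j<n. x j ^ k) = real n * Y k t z" for k
      unfolding x_def sum_ordered_eigenvalue_power[of "entry t z" n k, OF entry_sym] using n_pos by (simp add: Y_def ntr_def)
    have xj: "x j ^ (2 * q) \<le> R ^ (2 * q)" if "j < n" for j
    proof -
      have "(x j)\<^sup>2 \<le> (\<Sum>j<n. (x j)\<^sup>2)" using that by (intro member_le_sum) auto
      also have "\<dots> \<le> real n * B" unfolding sum using B[OF t] by (intro mult_left_mono) auto
      also have "\<dots> \<le> R\<^sup>2"
      proof (cases "0 \<le> real n * B")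
        case True
        then have "real n * B = (sqrt (real n * B))\<^sup>2" by simp
        also have "\<dots> \<le> R\<^sup>2" unfolding R_def using True by (intro power_mono) auto
        finally show ?thesis .
      qed (use zero_le_power2[of R] in linarith)
      finally have "(x j)\<^sup>2 \<le> R\<^sup>2" .
      then show ?thesis unfolding power_mult by (rule power_mono) simp
    qed
    have "(\<integral>x. x ^ (2 * q) \<partial>X z t) = (\<Sum>j<n. x j ^ (2 * q)) / real n"
      using X_moments(2)[of t z "2 * q"] t sum[of "2 * q"] n_pos by simp
    also have "\<dots> \<le> (\<Sum>j<n. R ^ (2 * q)) / real n"
      using xj by (intro divide_right_mono sum_mono) auto
    finally show ?thesis using n_pos by simp
  qed
  then show "\<exists>R\<ge>1. \<forall>t\<in>{0..T}. \<forall>q. (\<integral>x. x ^ (2 * q) \<partial>X z t) \<le> R ^ (2 * q)"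
    by (intro exI[of _ R]) (auto simp: R_def)
qed

lemma X_in_C_Pr:
  assumes z: "z \<in> space M"
  shows "X z \<in> C_Pr"
proof (rule C_Pr_if_moments_continuous)
  show "X z \<in> extensional {0..}" by (simp add: spectral_empirical_process_def)
  show "continuous_on {0..} (\<lambda>t. \<integral>x. x ^ k \<partial>X z t)" for k
    using Y_continuous[OF z, of k] by (subst continuous_on_cong[OF refl X_moments(2)]) auto
qed (use has_moments_X moments_locally_bounded_X[OF z] in auto)

text \<open>An open set containing a sample path contains all sample paths whose first moments, the
  continuous processes \<open>Y k\<close>, are uniformly close on a compact interval. Preimages of
  open sets thus have the form treated by \<open>sets_of_path_neighbourhoods\<close>.\<close>

lemma X_measurable: "X \<in> M \<rightarrow>\<^sub>M borel_of C_Pr_topology"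
proof -
  have sub: "{U. openin C_Pr_topology U} \<subseteq> Pow (topspace C_Pr_topology)"
    using openin_subset by blast
  show ?thesis
    unfolding borel_of_def
  proof (rule measurable_sigma_sets[OF sets_measure_of[OF sub] sub])
    show "X \<in> space M \<rightarrow> topspace C_Pr_topology"
      using X_in_C_Pr by (simp add: topspace_C_Pr_topology)
    fix U assume "U \<in> {U. openin C_Pr_topology U}"
    then have U: "openin C_Pr_topology U" by simp
    show "X -` U \<inter> space M \<in> sets M"
    proof (rule sets_of_path_neighbourhoods[of Y])
      fix z assume "z \<in> X -` U \<inter> space M"
      then have z: "X z \<in> U" "z \<in> space M" by auto
      obtain T F e where F: "finite F" "F \<subseteq> bounded_continuous" "0 < e" "C_Pr_nbhd (X z) T F e \<subseteq> U"
        using U z(1) unfolding openin_C_Pr_topology by blast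
      obtain N \<delta> where N: "\<delta> > 0" "\<And>m'. m' \<in> C_Pr \<Longrightarrow> has_moments m' \<and>
          (\<forall>k\<le>N. \<forall>t\<in>{0..T}. \<bar>(\<integral>x. x ^ k \<partial>m' t) - (\<integral>x. x ^ k \<partial>X z t)\<bar> < \<delta>) \<Longrightarrow> m' \<in> C_Pr_nbhd (X z) T F e"
        using C_Pr_nbhd_if_moments_close[OF F(1-3) has_moments_X moments_locally_bounded_X[OF z(2)], of T] by blast
      have "{z' \<in> space M. \<forall>k\<le>N. \<forall>t\<in>{0..T}. \<bar>Y k t z' - Y k t z\<bar> < \<delta>} \<subseteq> X -` U \<inter> space M"
      proof (intro subsetI, elim CollectE conjE)
        fix z' assume z': "z' \<in> space M" "\<forall>k\<le>N. \<forall>t\<in>{0..T}. \<bar>Y k t z' - Y k t z\<bar> < \<delta>"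
        then have "X z' \<in> C_Pr_nbhd (X z) T F e"
          by (intro N(2) X_in_C_Pr) (auto simp: has_moments_X X_moments)
        then show "z' \<in> X -` U \<inter> space M" using F(4) z'(1) by auto
      qed
      then show "\<exists>T K. \<exists>\<delta>>0. {z' \<in> space M. \<forall>k\<le>K. \<forall>t\<in>{0..T}. \<bar>Y k t z' - Y k t z\<bar> < \<delta>} \<subseteq> X -` U \<inter> space M"
        using N(1) by blast
    qed (use Y_measurable Y_continuous in auto)
  qed
qed

end

section \<open>Moments of the limit and convergence in law\<close>

lemma limit_moments:
  assumes nc: "nc_probability_space cscale star \<phi>" and fbm: "nc_fractional_BM cscale star \<phi> H S"
    and sp: "spectral_distribution \<phi> (S t) \<mu>" and t: "0 \<le> t"
  shows "real_distribution \<mu>" "integrable \<mu> (\<lambda>x. x ^ k)" "(\<integral>x. x ^ k \<partial>\<mu>) = (t powr H) ^ k * sc_moment k"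
proof -
  show rd: "real_distribution \<mu>" using sp by (simp add: spectral_distribution_def)
  interpret real_distribution \<mu> by fact
  interpret nc: nc_probability_space cscale star \<phi> by fact
  obtain K where "measure \<mu> {-K..K} = 1" using sp by (auto simp: spectral_distribution_def)
  then have "AE x in \<mu>. x \<in> {-K..K}" by (intro AE_prob_1) auto
  then have "AE x in \<mu>. norm (x ^ k) \<le> \<bar>K\<bar> ^ k"
    by eventually_elim (auto simp: power_abs intro!: power_mono)
  then show "integrable \<mu> (\<lambda>x. x ^ k)"
    by (intro integrable_const_bound[of _ "\<bar>K\<bar> ^ k"]) auto
  \<comment> \<open>One summand with coefficient 1 gives a semicircle law for \<open>S t\<close>
    itself. Its \<sigma> remains unknown until the second moment is compared with the
    covariance.\<close>
  have "\<exists>\<sigma>\<ge>0. spectral_distribution \<phi> (\<Sum>i<1::nat. cscale (complex_of_real 1) (S t)) (semicircle \<sigma>)"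
    using fbm t unfolding nc_fractional_BM_def centered_semicircular_process_def
    by (elim conjE allE[of _ "1::nat"] allE[of _ "\<lambda>_. 1"] allE[of _ "\<lambda>_. t"]) simp
  then obtain \<sigma> where \<sigma>: "0 \<le> \<sigma>" "spectral_distribution \<phi> (S t) (semicircle \<sigma>)"
    by auto
  have m: "(\<integral>x. x ^ j \<partial>\<mu>) = \<sigma> ^ j * sc_moment j" for j
  proof -
    have "complex_of_real (\<integral>x. x ^ j \<partial>\<mu>) = complex_of_real (\<integral>x. x ^ j \<partial>semicircle \<sigma>)"
      using sp \<sigma>(2) unfolding spectral_distribution_def by metis
    then show ?thesis
      using semicircle_moments[OF \<sigma>(1)] \<sigma>(2) by (simp add: spectral_distribution_def)
  qed
  have "complex_of_real (\<integral>x. x ^ 2 \<partial>\<mu>) = complex_of_real (fbm_cov H t t)"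
    using sp fbm t unfolding spectral_distribution_def nc_fractional_BM_def by (metis power2_eq_square)
  then have "\<sigma> ^ 2 * sc_moment 2 = fbm_cov H t t"
    unfolding of_real_eq_iff m .
  moreover have "sc_moment 2 = 1" by (simp add: numeral_2_eq_2)
  ultimately have "\<sigma>\<^sup>2 = (t powr H)\<^sup>2"
    unfolding powr_square fbm_cov_diag[OF t] by simp
  then have "\<sigma> = t powr H" using \<sigma>(1) by (simp add: power2_eq_iff_nonneg)
  then show "(\<integral>x. x ^ k \<partial>\<mu>) = (t powr H) ^ k * sc_moment k" using m by simp
qed

lemma space_borel_of: "space (borel_of T) = topspace T"
  unfolding borel_of_def using openin_subset[of T] by (intro space_measure_of) blast

lemma measurable_borel_of:
  fixes \<Phi> :: "'a \<Rightarrow> real"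
  assumes "continuous_map T euclideanreal \<Phi>"
  shows "\<Phi> \<in> borel_measurable (borel_of T)"
proof (rule borel_measurableI)
  have sub: "{U. openin T U} \<subseteq> Pow (topspace T)" using openin_subset by blast
  fix S :: "real set" assume "open S"
  then have "openin T {x \<in> topspace T. \<Phi> x \<in> S}"
    using assms by (simp add: continuous_map_def)
  moreover have "\<Phi> -` S \<inter> space (borel_of T) = {x \<in> topspace T. \<Phi> x \<in> S}"
    unfolding space_borel_of by auto
  ultimately show "\<Phi> -` S \<inter> space (borel_of T) \<in> sets (borel_of T)"
    unfolding borel_of_def sets_measure_of[OF sub] by auto
qed

theorem theorem1:
  fixes H :: real
    and M :: "nat \<Rightarrow> 'w measure"
    and b :: "nat \<Rightarrow> nat \<Rightarrow> nat \<Rightarrow> real \<Rightarrow> 'w \<Rightarrow> real"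
    and cscale :: "complex \<Rightarrow> 'a :: ring_1 \<Rightarrow> 'a"
    and star :: "'a \<Rightarrow> 'a"
    and \<phi> :: "'a \<Rightarrow> complex"
    and S :: "real \<Rightarrow> 'a"
    and \<mu> :: "real \<Rightarrow> real measure"
  assumes "1 / 2 < H" and "H < 1"
    and "\<And>n. n \<ge> 1 \<Longrightarrow> prob_space (M n)"
    and "\<And>n. n \<ge> 1 \<Longrightarrow> indep_fractional_BMs (M n) H n (b n)"
    and "nc_probability_space cscale star \<phi>"
    and "nc_fractional_BM cscale star \<phi> H S"
    and "\<And>t. t \<ge> 0 \<Longrightarrow> spectral_distribution \<phi> (S t) (\<mu> t)"
  shows "converges_in_law C_Pr_topology M
           (\<lambda>n. spectral_empirical_process n (b n))
           (return (borel_of C_Pr_topology) (\<lambda>t\<in>{0..}. \<mu> t))"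
proof -
  let ?T = C_Pr_topology
  let ?X = "\<lambda>n. spectral_empirical_process n (b n)"
  define m where "m = (\<lambda>t\<in>{0..}. \<mu> t)"
  have mf: "matrix_fbm (M n) H n (b n)" if "n \<ge> 1" for n
    using assms(1-4) that by (intro matrix_fbm.intro matrix_fbm_axioms.intro) auto
  have lim: "real_distribution (m t)" "integrable (m t) (\<lambda>x. x ^ k)" "(\<integral>x. x ^ k \<partial>m t) = (t powr H) ^ k * sc_moment k"
    if "0 \<le> t" for t k
    using limit_moments[OF assms(5,6) assms(7)[OF that] that] that by (simp_all add: m_def)
  have hm: "has_moments m" using lim by (simp add: has_moments_def)
  have mb: "moments_locally_bounded m"
    unfolding moments_locally_bounded_def
  proof
    fix T :: real
    \<comment> \<open>The moments at time t are those of a law on the interval of radius 2 t^H,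
      which grows with t.\<close>
    define R where "R = max 1 (2 * T powr H)"
    have "(\<integral>x. x ^ (2 * q) \<partial>m t) \<le> R ^ (2 * q)" if t: "t \<in> {0..T}" for t q
    proof -
      have "(\<integral>x. x ^ (2 * q) \<partial>m t) \<le> (t powr H) ^ (2 * q) * 4 ^ q"
        unfolding lim(3)[of t, OF atLeastAtMost_iff[THEN iffD1, OF t, THEN conjunct1]]
        using sc_moment_even_bound[of q] by (intro mult_left_mono) auto
      also have "\<dots> = (2 * t powr H) ^ (2 * q)"
        by (simp add: power_mult_distrib power_mult)
      also have "\<dots> \<le> R ^ (2 * q)"
      proof (rule power_mono)
        have "t powr H \<le> T powr H" using t assms(1) by (intro powr_mono2) auto
        then show "2 * t powr H \<le> R" unfolding R_def by linarith
      qed simp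
      finally show ?thesis .
    qed
    then show "\<exists>R\<ge>1. \<forall>t\<in>{0..T}. \<forall>q. (\<integral>x. x ^ (2 * q) \<partial>m t) \<le> R ^ (2 * q)"
      by (intro exI[of _ R]) (auto simp: R_def)
  qed
  have mC: "m \<in> C_Pr"
  proof (rule C_Pr_if_moments_continuous[OF _ hm _ mb])
    show "m \<in> extensional {0..}" by (simp add: m_def)
    have "continuous_on {0..} (\<lambda>t. (t powr H) ^ k * sc_moment k)" for k
      using assms(1) by (intro continuous_on_mult continuous_on_power continuous_on_powr' continuous_intros) auto
    then show "continuous_on {0..} (\<lambda>t. \<integral>x. x ^ k \<partial>m t)" for k
      by (subst continuous_on_cong[OF refl lim(3)]) auto
  qed
  have m_space: "m \<in> space (borel_of ?T)"
    unfolding space_borel_of topspace_C_Pr_topology by (rule mC)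
  have "(\<lambda>n. \<integral>z. \<Phi> (?X n z) \<partial>M n) \<longlonglongrightarrow> (\<integral>x. \<Phi> x \<partial>return (borel_of ?T) m)"
    if \<Phi>: "continuous_map ?T euclideanreal \<Phi>" and bd: "bounded (\<Phi> ` topspace ?T)" for \<Phi>
  proof -
    have [measurable]: "\<Phi> \<in> borel_measurable (borel_of ?T)" by (rule measurable_borel_of[OF \<Phi>])
    have ret: "(\<integral>x. \<Phi> x \<partial>return (borel_of ?T) m) = \<Phi> m"
      by (rule integral_return[OF m_space]) simp
    obtain B where B: "\<And>x. x \<in> C_Pr \<Longrightarrow> \<bar>\<Phi> x\<bar> \<le> B"
      using bd unfolding bounded_iff topspace_C_Pr_topology by auto
    have B0: "0 \<le> B" using B[OF mC] by linarith
    show ?thesis unfolding ret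
    proof (rule LIMSEQ_I)
      fix r :: real assume r: "0 < r"
      \<comment> \<open>Half of r is meant for the oscillation of \<Phi> near m, the other half for
        the exceptional event.\<close>
      define e where "e = r / 2"
      have e: "0 < e" using r by (simp add: e_def)
      have "openin ?T {x \<in> topspace ?T. \<Phi> x \<in> ball (\<Phi> m) e}"
        by (rule openin_continuous_map_preimage[OF \<Phi>]) (simp only: open_openin[symmetric] open_ball)
      moreover have "m \<in> {x \<in> topspace ?T. \<Phi> x \<in> ball (\<Phi> m) e}"
        using mC e by (simp add: topspace_C_Pr_topology)
      ultimately obtain T F d where F: "T \<ge> 0" "finite F" "F \<subseteq> bounded_continuous" "0 < d"
        "C_Pr_nbhd m T F d \<subseteq> {x \<in> topspace ?T. \<Phi> x \<in> ball (\<Phi> m) e}"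
        unfolding openin_C_Pr_topology by blast
      obtain N \<delta> where N: "\<delta> > 0" "\<And>m'. m' \<in> C_Pr \<Longrightarrow> has_moments m' \<and>
        (\<forall>k\<le>N. \<forall>t\<in>{0..T}. \<bar>(\<integral>x. x ^ k \<partial>m' t) - (\<integral>x. x ^ k \<partial>m t)\<bar> < \<delta>) \<Longrightarrow> m' \<in> C_Pr_nbhd m T F d"
        using C_Pr_nbhd_if_moments_close[OF F(2-4) hm mb, of T] by blast
      define \<kappa> where "\<kappa> = (2 * H - 1) / (4 * H)"
      have \<kappa>: "0 < \<kappa>" using assms(1) by (simp add: \<kappa>_def)
      \<comment> \<open>The constants are fixed before n and the probability space, which vary
        together along the sequence; only the exceptional events depend on them.\<close>
      have "\<forall>k. \<exists>C\<ge>0. \<forall>(M :: 'w measure) n b. matrix_fbm M H n b \<longrightarrow>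
        (\<exists>E\<in>sets M. measure M E \<le> C * real n powr (- \<kappa>) \<and>
        (\<forall>z\<in>space M - E. \<forall>t\<in>{0..T}. \<bar>matrix_fbm.Y n b k t z - (t powr H) ^ k * sc_moment k\<bar> \<le> \<delta> / 2))"
        unfolding \<kappa>_def using N(1) by (intro allI uniform_moment_convergence[OF assms(1,2) F(1)]) simp
      then obtain C where C: "\<And>k. C k \<ge> 0" "\<And>k n. n \<ge> 1 \<Longrightarrow>
        \<exists>E\<in>sets (M n). measure (M n) E \<le> C k * real n powr (- \<kappa>) \<and>
        (\<forall>z\<in>space (M n) - E. \<forall>t\<in>{0..T}. \<bar>matrix_fbm.Y n (b n) k t z - (t powr H) ^ k * sc_moment k\<bar> \<le> \<delta> / 2)"
        unfolding choice_iff using mf by metis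
      define D where "D = (\<Sum>k\<le>N. C k)"
      have main: "\<bar>(\<integral>z. \<Phi> (?X n z) \<partial>M n) - \<Phi> m\<bar> \<le> e + 2 * B * D * real n powr (- \<kappa>)" if n: "n \<ge> 1" for n
      proof -
        interpret matrix_fbm "M n" H n "b n" by (rule mf[OF n])
        obtain E where E: "\<And>k. E k \<in> sets (M n)" "\<And>k. prob (E k) \<le> C k * real n powr (- \<kappa>)"
          "\<And>k z t. z \<in> space (M n) - E k \<Longrightarrow> t \<in> {0..T} \<Longrightarrow> \<bar>Y k t z - (t powr H) ^ k * sc_moment k\<bar> \<le> \<delta> / 2"
          using C(2)[OF n] by metis
        define EE where "EE = (\<Union>k\<le>N. E k)"
        have EE [measurable]: "EE \<in> sets (M n)" unfolding EE_def using E(1) by auto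
        have "prob EE \<le> (\<Sum>k\<le>N. prob (E k))"
          unfolding EE_def using E(1) by (intro finite_measure_subadditive_finite) auto
        also have "\<dots> \<le> D * real n powr (- \<kappa>)"
          unfolding D_def sum_distrib_right by (intro sum_mono E(2))
        finally have PE: "prob EE \<le> D * real n powr (- \<kappa>)" .
        have good: "\<bar>\<Phi> (X z) - \<Phi> m\<bar> \<le> e" if z: "z \<in> space (M n)" "z \<notin> EE" for z
        proof -
          have "\<bar>(\<integral>x. x ^ k \<partial>X z t) - (\<integral>x. x ^ k \<partial>m t)\<bar> < \<delta>" if "k \<le> N" "t \<in> {0..T}" for k t
            using E(3)[of z k t] that z N(1) by (auto simp: EE_def X_moments lim)
          then have "X z \<in> C_Pr_nbhd m T F d"
            using z(1) by (intro N(2) X_in_C_Pr) (auto simp: has_moments_X)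
          then have "\<Phi> (X z) \<in> ball (\<Phi> m) e" using F(5) by blast
          then show ?thesis by (simp add: dist_real_def abs_minus_commute)
        qed
        \<comment> \<open>On the exceptional event only the bound B on \<Phi> is available, at a
          cost of 2 B.\<close>
        have pw: "\<bar>\<Phi> (X z) - \<Phi> m\<bar> \<le> e + 2 * B * indicator EE z" if "z \<in> space (M n)" for z
        proof (cases "z \<in> EE")
          case True
          then show ?thesis using B[OF X_in_C_Pr[OF that]] B[OF mC] e by simp
        qed (use good that in simp)
        have [measurable]: "(\<lambda>z. \<Phi> (X z)) \<in> borel_measurable (M n)"
          by (rule measurable_compose[OF X_measurable]) simp
        have i: "integrable (M n) (\<lambda>z. \<Phi> (X z))"
          using B X_in_C_Pr by (intro integrable_const_bound[of _ B]) auto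
        have "\<bar>(\<integral>z. \<Phi> (X z) \<partial>M n) - \<Phi> m\<bar> = \<bar>\<integral>z. \<Phi> (X z) - \<Phi> m \<partial>M n\<bar>"
          using i by (simp add: prob_space)
        also have "\<dots> \<le> (\<integral>z. \<bar>\<Phi> (X z) - \<Phi> m\<bar> \<partial>M n)"
          by (rule integral_abs_bound)
        also have "\<dots> \<le> (\<integral>z. e + 2 * B * indicator EE z \<partial>M n)"
          using i pw by (intro integral_mono) (auto simp: less_top[symmetric])
        also have "\<dots> = e + 2 * B * prob EE"
          by (subst Bochner_Integration.integral_add) (auto simp: prob_space less_top[symmetric])
        also have "\<dots> \<le> e + 2 * B * (D * real n powr (- \<kappa>))"
          using PE B0 by (intro add_left_mono mult_left_mono) auto
        finally show ?thesis by (simp add: mult.assoc)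
      qed
      have "(\<lambda>n. 2 * B * D * real n powr (- \<kappa>)) \<longlonglongrightarrow> 2 * B * D * 0"
        using \<kappa> by (intro tendsto_mult tendsto_const tendsto_neg_powr filterlim_real_sequentially) auto
      then have "\<forall>\<^sub>F n in sequentially. 2 * B * D * real n powr (- \<kappa>) < r / 2"
        using r by (intro order_tendstoD(2)) auto
      then obtain n0 where n0: "\<And>n. n \<ge> n0 \<Longrightarrow> 2 * B * D * real n powr (- \<kappa>) < r / 2"
        unfolding eventually_sequentially by blast
      show "\<exists>n0. \<forall>n\<ge>n0. norm ((\<integral>z. \<Phi> (?X n z) \<partial>M n) - \<Phi> m) < r"
      proof (intro exI[of _ "max 1 n0"] allI impI)
        fix n assume "max 1 n0 \<le> n"
        then show "norm ((\<integral>z. \<Phi> (?X n z) \<partial>M n) - \<Phi> m) < r"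
          using main[of n] n0[of n] by (simp add: e_def)
      qed
    qed
  qed
  then show ?thesis
    unfolding converges_in_law_def m_def[symmetric]
    using matrix_fbm.X_measurable[OF mf] prob_space_return[OF m_space] by simp
qed

end
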